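(* Let $\gamma\in(1/2,1)$ and let $x:[0,T]\to\mathbb R^{1,d}$ and $\tilde x^1$ satisfy: $x$ is $\gamma$-Hölder continuous, $\tilde x^1\in\tilde{\mathcal C}^\gamma_{2,\gamma}(\mathbb R^{1,d})$ and $\tilde\delta\tilde x^1=0$. Let $z:[0,T]\to\mathbb R^{d,m}$ be $\gamma$-Hölder continuous, and set, for $\xi\ge0$, $$\mathcal J(\tilde dx\,z)(\xi)=\tilde x^1(\xi)z+\tilde\Lambda[\tilde x^1\delta z](\xi),$$ i.e. $\mathcal J_{ts}(\tilde dx\,z)=\tilde x^1_{ts}z_s+\tilde\Lambda[h]_{ts}$ with $h_{tus}=\tilde x^1_{tu}(z_u-z_s)$. Then: (1) $\mathcal J(\tilde dx\,z)$ is well defined as an element of $\tilde{\mathcal C}^\gamma_{2,\gamma}$, and, when $x$ is a smooth path with $\tilde x^1_{ts}(\xi)=\int_s^te^{-\xi(t-v)}dx_v$ (and $z$ smooth), $\mathcal J_{ts}(\tilde dx\,z)(\xi)=\int_s^te^{-\xi(t-v)}dx_v\,z_v$ (Riemann integral). (2) There is a constant $c_x>0$ such that for all $\ell_1<\ell_2$ in $[0,T]$, $$\mathcal N[\mathcal J(\tilde dx\,z);\tilde{\mathcal C}^\gamma_{2,\gamma}([\ell_1,\ell_2])]\le c_x\{\mathcal N[z;\mathcal C_1^0([\ell_1,\ell_2])]+\varepsilon^\gamma\mathcal N[z;\mathcal C_1^\gamma([\ell_1,\ell_2])]\},\quad \varepsilon=|\ell_2-\ell_1|.$$ (3) For any $\ell_1\le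 s<t\le\ell_2$, $\mathcal J_{ts}(\tilde dx\,z)=\lim\sum_{i=0}^{n}e^{-\cdot(t-t_{i+1})}\tilde x^1_{t_{i+1}t_i}z_{t_i}$ in $\mathcal L_\gamma$, the limit being taken over partitions $s=t_0<t_1<\dots<t_{n+1}=t$ whose mesh tends to $0$.
   Context: Measurable $\hat\phi:(0,\infty)\to\mathbb R$ is fixed. For $\beta>0$ and a finite-dimensional normed space $V$, $\mathcal L_\beta(V)$ is the space of measurable $g:[0,\infty)\to V$ with $\mathcal N[g;\mathcal L_\beta]=\int_0^\infty|\hat\phi(\xi)|(1+\xi^\beta)\|g(\xi)\|d\xi<\infty$. For an interval $J=[\ell_1,\ell_2]$, $\tilde{\mathcal C}_{k,\beta}(J;V)$ is the set of continuous maps from $\{(t_1,\dots,t_k)\in J^k:t_1\ge\dots\ge t_k\}$ to $\mathcal L_\beta(V)$. Put $a_{ts}(\xi)=e^{-\xi(t-s)}-1$; $(\tilde\delta f)_{ts}(\xi)=f_t(\xi)-e^{-\xi(t-s)}f_s(\xi)$, $(\tilde\delta B)_{tus}(\xi)=B_{ts}(\xi)-B_{tu}(\xi)-e^{-\xi(t-u)}B_{us}(\xi)$. Norms: $\mathcal N[B;\tilde{\mathcal C}^\mu_{2,\beta}(J)]=\sup_{s<t}\mathcal N[B_{ts};\mathcal L_\beta]/|t-s|^\mu$; for three-parameter $h$, $\mathcal N[h;\tilde{\mathcal C}^\mu_{3,\beta}]=\inf\sum_i\sup_{s<u<t}\mathcal N[h^i_{tus};\mathcal L_\beta]|t-u|^{-\rho_i}|u-s|^{-(\mu-\rho_i)}$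 over decompositions $h=\sum_ih^i$, $\rho_i\in(0,\mu)$. Spaces $\tilde{\mathcal C}^\mu_{k,\beta}$: finite norm. For paths $z$: $\mathcal N[z;\mathcal C_1^0]=\sup\|z_s\|$, $\mathcal N[z;\mathcal C_1^\gamma]=\sup_{s\ne t}\|z_t-z_s\|/|t-s|^\gamma$. $\tilde\Lambda$ denotes the convolutional sewing map: for $\mu>1$ and $\tilde h\in\tilde{\mathcal C}^\mu_{3,\beta}$ of the form $\tilde\delta B$, $\tilde\Lambda\tilde h$ is the unique element of $\tilde{\mathcal C}^\mu_{2,\beta}$ with $\tilde\delta\tilde\Lambda\tilde h=\tilde h$. In (3), $e^{-\cdot(t-t_{i+1})}$ denotes the function $\xi\mapsto e^{-\xi(t-t_{i+1})}$. *)

theory Defs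
  imports "HOL-Analysis.Analysis"
begin

(* L_beta(V): measurable g on (0,oo) with finite weighted integral.  Functions are
   represented as total maps real => 'V; only their values on (0,oo) matter. *)
definition Lb :: "(real \<Rightarrow> real) \<Rightarrow> real \<Rightarrow> (real \<Rightarrow> 'v::real_normed_vector) set" where
  "Lb phi beta = {g. set_borel_measurable lborel {0<..} g \<and>
      set_integrable lborel {0<..} (\<lambda>\<xi>. \<bar>phi \<xi>\<bar> * (1 + \<xi> powr beta) * norm (g \<xi>))}"

definition Nrm :: "(real \<Rightarrow> real) \<Rightarrow> real \<Rightarrow> (real \<Rightarrow> 'v::real_normed_vector) \<Rightarrow> real" where
  "Nrm phi beta g = (LINT \<xi>:{0<..}|lborel. \<bar>phi \<xi>\<bar> * (1 + \<xi> powr beta) * norm (g \<xi>))"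

definition Leq :: "(real \<Rightarrow> real) \<Rightarrow> real \<Rightarrow> (real \<Rightarrow> 'v::real_normed_vector) \<Rightarrow> (real \<Rightarrow> 'v) \<Rightarrow> bool" where
  "Leq phi beta f g \<longleftrightarrow> (\<lambda>\<xi>. f \<xi> - g \<xi>) \<in> Lb phi beta \<and> Nrm phi beta (\<lambda>\<xi>. f \<xi> - g \<xi>) = 0"

definition dtil3 :: "(real \<Rightarrow> real \<Rightarrow> real \<Rightarrow> 'v::real_normed_vector) \<Rightarrow> real \<Rightarrow> real \<Rightarrow> real \<Rightarrow> real \<Rightarrow> 'v" where
  "dtil3 B t u s \<xi> = B t s \<xi> - B t u \<xi> - exp (- \<xi> * (t - u)) *\<^sub>R B u s \<xi>"

definition C2 :: "(real \<Rightarrow> real) \<Rightarrow> real \<Rightarrow> real \<Rightarrow> real \<Rightarrow> (real \<Rightarrow> real \<Rightarrow> real \<Rightarrow> 'v::real_normed_vector) \<Rightarrow> bool" where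
  "C2 phi beta a b B \<longleftrightarrow>
     (\<forall>s t. a \<le> s \<and> s \<le> t \<and> t \<le> b \<longrightarrow> B t s \<in> Lb phi beta) \<and>
     (\<forall>s t. a \<le> s \<and> s \<le> t \<and> t \<le> b \<longrightarrow> (\<forall>e>0. \<exists>d>0. \<forall>s' t'.
         a \<le> s' \<and> s' \<le> t' \<and> t' \<le> b \<and> \<bar>s' - s\<bar> < d \<and> \<bar>t' - t\<bar> < d \<longrightarrow>
         Nrm phi beta (\<lambda>\<xi>. B t' s' \<xi> - B t s \<xi>) < e))"

definition C3 :: "(real \<Rightarrow> real) \<Rightarrow> real \<Rightarrow> real \<Rightarrow> real \<Rightarrow> (real \<Rightarrow> real \<Rightarrow> real \<Rightarrow> real \<Rightarrow> 'v::real_normed_vector) \<Rightarrow> bool" where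
  "C3 phi beta a b h \<longleftrightarrow>
     (\<forall>s u t. a \<le> s \<and> s \<le> u \<and> u \<le> t \<and> t \<le> b \<longrightarrow> h t u s \<in> Lb phi beta) \<and>
     (\<forall>s u t. a \<le> s \<and> s \<le> u \<and> u \<le> t \<and> t \<le> b \<longrightarrow> (\<forall>e>0. \<exists>d>0. \<forall>s' u' t'.
         a \<le> s' \<and> s' \<le> u' \<and> u' \<le> t' \<and> t' \<le> b \<and> \<bar>s' - s\<bar> < d \<and> \<bar>u' - u\<bar> < d \<and> \<bar>t' - t\<bar> < d \<longrightarrow>
         Nrm phi beta (\<lambda>\<xi>. h t' u' s' \<xi> - h t u s \<xi>) < e))"

definition N2 :: "(real \<Rightarrow> real) \<Rightarrow> real \<Rightarrow> real \<Rightarrow> real \<Rightarrow> real \<Rightarrow> (real \<Rightarrow> real \<Rightarrow> real \<Rightarrow> 'v::real_normed_vector) \<Rightarrow> real" where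
  "N2 phi beta mu a b B = Sup {Nrm phi beta (B t s) / (t - s) powr mu | s t. a \<le> s \<and> s < t \<and> t \<le> b}"

definition C2hol :: "(real \<Rightarrow> real) \<Rightarrow> real \<Rightarrow> real \<Rightarrow> real \<Rightarrow> real \<Rightarrow> (real \<Rightarrow> real \<Rightarrow> real \<Rightarrow> 'v::real_normed_vector) \<Rightarrow> bool" where
  "C2hol phi beta mu a b B \<longleftrightarrow> C2 phi beta a b B \<and>
     bdd_above {Nrm phi beta (B t s) / (t - s) powr mu | s t. a \<le> s \<and> s < t \<and> t \<le> b}"

definition C3hol :: "(real \<Rightarrow> real) \<Rightarrow> real \<Rightarrow> real \<Rightarrow> real \<Rightarrow> real \<Rightarrow> (real \<Rightarrow> real \<Rightarrow> real \<Rightarrow> real \<Rightarrow> 'v::real_normed_vector) \<Rightarrow> bool" where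
  "C3hol phi beta mu a b h \<longleftrightarrow> C3 phi beta a b h \<and>
     (\<exists>(n::nat) hs rho. (\<forall>i<n. C3 phi beta a b (hs i) \<and> 0 < rho i \<and> rho i < mu \<and>
          bdd_above {Nrm phi beta (hs i t u s) / ((t - u) powr (rho i) * (u - s) powr (mu - rho i))
                     | s u t. a \<le> s \<and> s < u \<and> u < t \<and> t \<le> b}) \<and>
        (\<forall>s u t \<xi>. a \<le> s \<and> s \<le> u \<and> u \<le> t \<and> t \<le> b \<and> 0 \<le> \<xi> \<longrightarrow>
            h t u s \<xi> = (\<Sum>i<n. hs i t u s \<xi>)))"

(* convolutional sewing map: the (unique as element of L_beta) A in \<tilde>C^mu_{2,beta}
   with \<tilde>\<delta> A = h *)
definition sew :: "(real \<Rightarrow> real) \<Rightarrow> real \<Rightarrow> real \<Rightarrow> real \<Rightarrow> real \<Rightarrow> (real \<Rightarrow> real \<Rightarrow> real \<Rightarrow> real \<Rightarrow> 'v::real_normed_vector) \<Rightarrow> real \<Rightarrow> real \<Rightarrow> real \<Rightarrow> 'v" where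
  "sew phi beta mu a b h = (SOME A. C2hol phi beta mu a b A \<and>
      (\<forall>s u t. a \<le> s \<and> s \<le> u \<and> u \<le> t \<and> t \<le> b \<longrightarrow> Leq phi beta (dtil3 A t u s) (h t u s)))"

definition holder_on :: "real \<Rightarrow> real set \<Rightarrow> (real \<Rightarrow> 'v::real_normed_vector) \<Rightarrow> bool" where
  "holder_on g S f \<longleftrightarrow> (\<exists>C. \<forall>s\<in>S. \<forall>t\<in>S. norm (f t - f s) \<le> C * \<bar>t - s\<bar> powr g)"

definition N1sup :: "(real \<Rightarrow> 'v::real_normed_vector) \<Rightarrow> real \<Rightarrow> real \<Rightarrow> real" where
  "N1sup z a b = Sup {norm (z s) | s. a \<le> s \<and> s \<le> b}"

definition N1hol :: "real \<Rightarrow> (real \<Rightarrow> 'v::real_normed_vector) \<Rightarrow> real \<Rightarrow> real \<Rightarrow> real" where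
  "N1hol g z a b = Sup {norm (z t - z s) / \<bar>t - s\<bar> powr g | s t. a \<le> s \<and> s \<le> b \<and> a \<le> t \<and> t \<le> b \<and> s \<noteq> t}"

(* h_{tus} = x1_{tu} (z_u - z_s); row vector (R^{1,d} = real^'d) times d x m matrix *)
definition hJ :: "(real \<Rightarrow> real \<Rightarrow> real \<Rightarrow> real ^ 'd) \<Rightarrow> (real \<Rightarrow> real ^ 'm ^ 'd) \<Rightarrow> real \<Rightarrow> real \<Rightarrow> real \<Rightarrow> real \<Rightarrow> real ^ 'm" where
  "hJ x1 z t u s \<xi> = x1 t u \<xi> v* (z u - z s)"

definition Jint :: "(real \<Rightarrow> real) \<Rightarrow> real \<Rightarrow> real \<Rightarrow> (real \<Rightarrow> real \<Rightarrow> real \<Rightarrow> real ^ 'd) \<Rightarrow> (real \<Rightarrow> real ^ 'm ^ 'd) \<Rightarrow> real \<Rightarrow> real \<Rightarrow> real \<Rightarrow> real ^ 'm" where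
  "Jint phi g T x1 z t s \<xi> = x1 t s \<xi> v* z s + sew phi g (2 * g) 0 T (hJ x1 z) t s \<xi>"

end

theory Submission
  imports Defs
begin

text \<open>
  The germ \<open>x1\<^sub>t\<^sub>s z\<^sub>s\<close> fails to be additive (for the convolutional increment) exactly by
  \<open>- h\<^sub>t\<^sub>u\<^sub>s = - x1\<^sub>t\<^sub>u (z\<^sub>u - z\<^sub>s)\<close>, which is of order \<open>(t - s)\<^bsup>2\<gamma>\<^esup>\<close> with \<open>2\<gamma> > 1\<close>. Hence its Riemann sums along
  dyadic grids clamped to \<open>[s,t]\<close> form a Cauchy sequence in the weighted \<open>L\<^sup>1\<close> space, because the factors
  \<open>e\<^bsup>-\<xi>(t-u)\<^esup>\<close> are contractions there. The limit is additive and differs from the germ by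
  \<open>O((t - s)\<^bsup>2\<gamma>\<^esup>)\<close>; this difference is the sewing map. Bisecting an interval shows that any solution of
  the sewing problem satisfies a bound depending only on the local size of \<open>h\<close>, which yields uniqueness and
  the estimate (2). Additivity together with the superlinear error gives convergence of all Riemann sums, and
  in the smooth case the same sums converge pointwise in \<open>\<xi>\<close> to the ordinary integral.
\<close>

section \<open>The weighted \<open>L\<^sup>1\<close> space\<close>

text \<open>Functions matter only modulo null sets of the weight, and limits are picked by choice
  for each pair of times. So identities between limits are recorded as vanishing norms of
  differences, and only bounds are passed on. A bound of \<open>dtil3 B\<close> by a positive power
  of the length also covers three equal times, which forces \<open>B t t\<close> to have norm zero;
  degenerate cells are then free. This permits one dyadic grid of the whole time interval, clamped
  to [s,t]. Grids adapted to [s,t], [s,u] and [u,t] would not match, whereas the clamped ones share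
  the index of their cells, so additivity can be checked cell by cell. The price is that refining
  the common grid gives an error in terms of the whole interval, not of t - s; a separate estimate
  for arbitrary partitions supplies the latter. The space of two-time maps demands joint continuity,
  which a bound near the diagonal does not give by itself; additivity has to be exploited once more.
  The sewing map is selected on all of [0,T] and comes with an uncontrolled global constant. This is
  why the a priori estimate takes any such constant as input and works on any subinterval.\<close>

locale measurable_weight =
  fixes phi :: "real \<Rightarrow> real" and \<beta> :: real
  assumes phi_meas: "set_borel_measurable lborel {0<..} phi"
begin

text \<open>Absorbing the indicator turns integrals over the half-line into plain
  \<open>lborel\<close> integrals, so that values of a function outside (0,oo) never have to be
  mentioned in norms.\<close>

definition W :: "real \<Rightarrow> real" where
  "W \<xi> = indicator {0<..} \<xi> * (\<bar>phi \<xi>\<bar> * (1 + \<xi> powr \<beta>))"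

lemma W_nonneg [simp]: "0 \<le> W \<xi>"
  by (simp add: W_def)

lemma W_measurable [measurable]: "W \<in> borel_measurable borel"
proof -
  have [measurable]: "(\<lambda>\<xi>. indicator {0<..} \<xi> *\<^sub>R phi \<xi>) \<in> borel_measurable borel"
    using phi_meas by (simp add: set_borel_measurable_def)
  have "W = (\<lambda>\<xi>. \<bar>indicator {0<..} \<xi> *\<^sub>R phi \<xi>\<bar> * (1 + \<xi> powr \<beta>))"
    by (auto simp: W_def fun_eq_iff indicator_def)
  also have "\<dots> \<in> borel_measurable borel" by measurable
  finally show ?thesis .
qed

lemma Lb_iff:
  "g \<in> Lb phi \<beta> \<longleftrightarrow> (\<lambda>\<xi>. indicator {0<..} \<xi> *\<^sub>R g \<xi>) \<in> borel_measurable borel \<and>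
     integrable lborel (\<lambda>\<xi>. W \<xi> * norm (g \<xi>))"
  by (simp add: Lb_def set_borel_measurable_def set_integrable_def W_def mult.assoc)

lemma Nrm_eq: "Nrm phi \<beta> g = (\<integral>\<xi>. W \<xi> * norm (g \<xi>) \<partial>lborel)"
  by (simp add: Nrm_def set_lebesgue_integral_def W_def mult.assoc)

lemma Nrm_nonneg [simp]: "0 \<le> Nrm phi \<beta> g"
  unfolding Nrm_eq by (rule integral_nonneg_AE) simp

lemma Lb_measurable:
  "g \<in> Lb phi \<beta> \<Longrightarrow> (\<lambda>\<xi>. indicator {0<..} \<xi> *\<^sub>R g \<xi>) \<in> borel_measurable borel"
  by (simp add: Lb_iff)

lemma Lb_integrable: "g \<in> Lb phi \<beta> \<Longrightarrow> integrable lborel (\<lambda>\<xi>. W \<xi> * norm (g \<xi>))"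
  by (simp add: Lb_iff)

lemma W_mult_measurable:
  fixes g :: "real \<Rightarrow> 'v::real_normed_vector"
  assumes "(\<lambda>\<xi>. indicator {0<..} \<xi> *\<^sub>R g \<xi>) \<in> borel_measurable borel"
  shows "(\<lambda>\<xi>. W \<xi> * norm (g \<xi>)) \<in> borel_measurable borel"
proof -
  have "(\<lambda>\<xi>. W \<xi> * norm (indicator {0<..} \<xi> *\<^sub>R g \<xi>)) \<in> borel_measurable borel"
    using assms by measurable
  moreover have "(\<lambda>\<xi>. W \<xi> * norm (indicator {0<..} \<xi> *\<^sub>R g \<xi>)) = (\<lambda>\<xi>. W \<xi> * norm (g \<xi>))"
    by (auto simp: W_def indicator_def fun_eq_iff)
  ultimately show ?thesis by simp
qed

text \<open>The majorant enters only through the product with \<open>W\<close>; the pointwise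
  comparison is asked for only where the weight can be nonzero.\<close>

lemma Lb_dominated:
  fixes g :: "real \<Rightarrow> 'v::real_normed_vector"
  assumes m: "(\<lambda>\<xi>. indicator {0<..} \<xi> *\<^sub>R g \<xi>) \<in> borel_measurable borel"
    and i: "integrable lborel (\<lambda>\<xi>. W \<xi> * G \<xi>)"
    and le: "\<And>\<xi>. 0 < \<xi> \<Longrightarrow> norm (g \<xi>) \<le> G \<xi>"
  shows "g \<in> Lb phi \<beta>" "Nrm phi \<beta> g \<le> (\<integral>\<xi>. W \<xi> * G \<xi> \<partial>lborel)"
proof -
  have b: "W \<xi> * norm (g \<xi>) \<le> W \<xi> * G \<xi>" for \<xi>
    using le[of \<xi>] by (cases "0 < \<xi>") (auto simp: W_def indicator_def intro!: mult_left_mono)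
  have "integrable lborel (\<lambda>\<xi>. W \<xi> * norm (g \<xi>))"
  proof (rule Bochner_Integration.integrable_bound[OF i])
    show "(\<lambda>\<xi>. W \<xi> * norm (g \<xi>)) \<in> borel_measurable lborel"
      using W_mult_measurable[OF m] by simp
    show "AE \<xi> in lborel. norm (W \<xi> * norm (g \<xi>)) \<le> norm (W \<xi> * G \<xi>)"
      using b by (auto intro!: AE_I2 order_trans[OF _ abs_ge_self] simp del: abs_mult)
  qed
  then show "g \<in> Lb phi \<beta>" "Nrm phi \<beta> g \<le> (\<integral>\<xi>. W \<xi> * G \<xi> \<partial>lborel)"
    using m b i by (auto simp: Lb_iff Nrm_eq intro!: integral_mono)
qed

text \<open>The two functions may take values in different spaces, as multiplication of a row vector
  by a matrix requires.\<close>

lemma Lb_scaled: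
  fixes f :: "real \<Rightarrow> 'u::real_normed_vector" and g :: "real \<Rightarrow> 'v::real_normed_vector"
  assumes m: "(\<lambda>\<xi>. indicator {0<..} \<xi> *\<^sub>R g \<xi>) \<in> borel_measurable borel"
    and f: "f \<in> Lb phi \<beta>"
    and le: "\<And>\<xi>. 0 < \<xi> \<Longrightarrow> norm (g \<xi>) \<le> c * norm (f \<xi>)"
  shows "g \<in> Lb phi \<beta>" "Nrm phi \<beta> g \<le> c * Nrm phi \<beta> f"
proof -
  have eq: "(\<lambda>\<xi>. W \<xi> * (c * norm (f \<xi>))) = (\<lambda>\<xi>. c * (W \<xi> * norm (f \<xi>)))"
    by (simp add: fun_eq_iff)
  have i: "integrable lborel (\<lambda>\<xi>. W \<xi> * (c * norm (f \<xi>)))"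
    unfolding eq by (intro integrable_mult_right Lb_integrable f)
  show "g \<in> Lb phi \<beta>" by (rule Lb_dominated(1)[OF m i le])
  have "Nrm phi \<beta> g \<le> (\<integral>\<xi>. W \<xi> * (c * norm (f \<xi>)) \<partial>lborel)"
    by (rule Lb_dominated(2)[OF m i le])
  then show "Nrm phi \<beta> g \<le> c * Nrm phi \<beta> f"
    unfolding eq by (simp add: Nrm_eq)
qed

lemma Lb_zero [simp]: "(\<lambda>\<xi>. 0) \<in> Lb phi \<beta>"
  by (simp add: Lb_iff)

lemma Nrm_zero [simp]: "Nrm phi \<beta> (\<lambda>\<xi>. 0) = 0"
  by (simp add: Nrm_eq)

lemma Lb_add:
  fixes f g :: "real \<Rightarrow> 'v::euclidean_space"
  assumes f: "f \<in> Lb phi \<beta>" and g: "g \<in> Lb phi \<beta>"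
  shows "(\<lambda>\<xi>. f \<xi> + g \<xi>) \<in> Lb phi \<beta>"
    and Nrm_triangle: "Nrm phi \<beta> (\<lambda>\<xi>. f \<xi> + g \<xi>) \<le> Nrm phi \<beta> f + Nrm phi \<beta> g"
proof -
  have [measurable]: "(\<lambda>\<xi>. indicator {0<..} \<xi> *\<^sub>R f \<xi>) \<in> borel_measurable borel"
    "(\<lambda>\<xi>. indicator {0<..} \<xi> *\<^sub>R g \<xi>) \<in> borel_measurable borel"
    using f g by (auto dest: Lb_measurable)
  have m: "(\<lambda>\<xi>. indicator {0<..} \<xi> *\<^sub>R (f \<xi> + g \<xi>)) \<in> borel_measurable borel"
    by (simp add: scaleR_add_right)
  have i: "integrable lborel (\<lambda>\<xi>. W \<xi> * (norm (f \<xi>) + norm (g \<xi>)))"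
    unfolding distrib_left by (intro Bochner_Integration.integrable_add Lb_integrable f g)
  show "(\<lambda>\<xi>. f \<xi> + g \<xi>) \<in> Lb phi \<beta>"
    by (rule Lb_dominated(1)[OF m i]) (rule norm_triangle_ineq)
  have "Nrm phi \<beta> (\<lambda>\<xi>. f \<xi> + g \<xi>) \<le> (\<integral>\<xi>. W \<xi> * (norm (f \<xi>) + norm (g \<xi>)) \<partial>lborel)"
    by (rule Lb_dominated(2)[OF m i]) (rule norm_triangle_ineq)
  also have "\<dots> = Nrm phi \<beta> f + Nrm phi \<beta> g"
    using f g by (simp add: Nrm_eq distrib_left Lb_integrable)
  finally show "Nrm phi \<beta> (\<lambda>\<xi>. f \<xi> + g \<xi>) \<le> Nrm phi \<beta> f + Nrm phi \<beta> g" .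
qed

lemma Nrm_uminus [simp]: "Nrm phi \<beta> (\<lambda>\<xi>. - f \<xi>) = Nrm phi \<beta> f"
  by (simp add: Nrm_eq)

lemma Lb_uminus:
  fixes f :: "real \<Rightarrow> 'v::euclidean_space"
  assumes f: "f \<in> Lb phi \<beta>"
  shows "(\<lambda>\<xi>. - f \<xi>) \<in> Lb phi \<beta>"
  using f by (simp add: Lb_iff)

lemma Lb_diff:
  fixes f g :: "real \<Rightarrow> 'v::euclidean_space"
  assumes "f \<in> Lb phi \<beta>" "g \<in> Lb phi \<beta>"
  shows "(\<lambda>\<xi>. f \<xi> - g \<xi>) \<in> Lb phi \<beta>"
    and Nrm_triangle_diff: "Nrm phi \<beta> (\<lambda>\<xi>. f \<xi> - g \<xi>) \<le> Nrm phi \<beta> f + Nrm phi \<beta> g"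
  using Lb_add[OF assms(1) Lb_uminus[OF assms(2)]] by simp_all

lemma Nrm_minus_commute: "Nrm phi \<beta> (\<lambda>\<xi>. f \<xi> - g \<xi>) = Nrm phi \<beta> (\<lambda>\<xi>. g \<xi> - f \<xi>)"
  by (simp add: Nrm_eq norm_minus_commute)

lemma Nrm_sum:
  fixes f :: "'i \<Rightarrow> real \<Rightarrow> 'v::euclidean_space"
  assumes "finite I" "\<And>i. i \<in> I \<Longrightarrow> f i \<in> Lb phi \<beta>"
  shows "(\<lambda>\<xi>. \<Sum>i\<in>I. f i \<xi>) \<in> Lb phi \<beta> \<and>
    Nrm phi \<beta> (\<lambda>\<xi>. \<Sum>i\<in>I. f i \<xi>) \<le> (\<Sum>i\<in>I. Nrm phi \<beta> (f i))"
  using assms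
proof (induction I rule: finite_induct)
  case (insert i I)
  have "Nrm phi \<beta> (\<lambda>\<xi>. f i \<xi> + (\<Sum>i\<in>I. f i \<xi>)) \<le> Nrm phi \<beta> (f i) + Nrm phi \<beta> (\<lambda>\<xi>. \<Sum>i\<in>I. f i \<xi>)"
    using insert by (intro Nrm_triangle) auto
  with insert show ?case by (auto intro!: Lb_add)
qed simp

lemma Lb_exp:
  fixes f :: "real \<Rightarrow> 'v::euclidean_space"
  assumes f: "f \<in> Lb phi \<beta>" and \<tau>: "0 \<le> \<tau>"
  shows "(\<lambda>\<xi>. exp (- \<xi> * \<tau>) *\<^sub>R f \<xi>) \<in> Lb phi \<beta>"
    and Nrm_exp_le: "Nrm phi \<beta> (\<lambda>\<xi>. exp (- \<xi> * \<tau>) *\<^sub>R f \<xi>) \<le> Nrm phi \<beta> f"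
proof -
  have [measurable]: "(\<lambda>\<xi>. indicator {0<..} \<xi> *\<^sub>R f \<xi>) \<in> borel_measurable borel"
    using f by (rule Lb_measurable)
  have "(\<lambda>\<xi>. exp (- \<xi> * \<tau>) *\<^sub>R (indicator {0<..} \<xi> *\<^sub>R f \<xi>)) \<in> borel_measurable borel"
    by measurable
  then have m: "(\<lambda>\<xi>. indicator {0<..} \<xi> *\<^sub>R (exp (- \<xi> * \<tau>) *\<^sub>R f \<xi>)) \<in> borel_measurable borel"
    by (simp add: mult.commute)
  have le: "norm (exp (- \<xi> * \<tau>) *\<^sub>R f \<xi>) \<le> 1 * norm (f \<xi>)" if "0 < \<xi>" for \<xi>
    using that \<tau> by (auto intro!: mult_left_le_one_le)
  show "(\<lambda>\<xi>. exp (- \<xi> * \<tau>) *\<^sub>R f \<xi>) \<in> Lb phi \<beta>"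
    by (rule Lb_scaled(1)[OF m f le])
  show "Nrm phi \<beta> (\<lambda>\<xi>. exp (- \<xi> * \<tau>) *\<^sub>R f \<xi>) \<le> Nrm phi \<beta> f"
    using Lb_scaled(2)[OF m f le] by simp
qed

text \<open>Triangle inequality with the bounds as premises: together with the next two lemmas it
  lets \<open>intro\<close> follow the syntax of a long expression and collect one summand per
  term.\<close>

lemma Nrm_add_le:
  fixes f g :: "real \<Rightarrow> 'v::euclidean_space"
  assumes "f \<in> Lb phi \<beta>" "g \<in> Lb phi \<beta>" "Nrm phi \<beta> f \<le> x" "Nrm phi \<beta> g \<le> y"
  shows "Nrm phi \<beta> (\<lambda>\<xi>. f \<xi> + g \<xi>) \<le> x + y"
  using Nrm_triangle[OF assms(1,2)] assms(3,4) by linarith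

lemma Nrm_diff_le:
  fixes f g :: "real \<Rightarrow> 'v::euclidean_space"
  assumes "f \<in> Lb phi \<beta>" "g \<in> Lb phi \<beta>" "Nrm phi \<beta> f \<le> x" "Nrm phi \<beta> g \<le> y"
  shows "Nrm phi \<beta> (\<lambda>\<xi>. f \<xi> - g \<xi>) \<le> x + y"
  using Nrm_triangle_diff[OF assms(1,2)] assms(3,4) by linarith

lemma Nrm_exp_le_bound:
  fixes f :: "real \<Rightarrow> 'v::euclidean_space"
  assumes "f \<in> Lb phi \<beta>" "0 \<le> \<tau>" "Nrm phi \<beta> f \<le> x"
  shows "Nrm phi \<beta> (\<lambda>\<xi>. exp (- \<xi> * \<tau>) *\<^sub>R f \<xi>) \<le> x"
  using Nrm_exp_le[OF assms(1,2)] assms(3) by linarith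

text \<open>Dominated convergence: for \<xi> > 0 both exponentials lie in (0,1], so they differ by
  at most 1. The argument gives no rate uniform in \<open>f\<close>, which is why later continuity
  proofs compare against a fixed function.\<close>

lemma Nrm_exp_tendsto:
  fixes f :: "real \<Rightarrow> 'v::euclidean_space"
  assumes f: "f \<in> Lb phi \<beta>" and pos: "\<And>n. 0 \<le> \<tau> n" and lim: "\<tau> \<longlonglongrightarrow> \<sigma>"
  shows "(\<lambda>n. Nrm phi \<beta> (\<lambda>\<xi>. exp (- \<xi> * \<tau> n) *\<^sub>R f \<xi> - exp (- \<xi> * \<sigma>) *\<^sub>R f \<xi>)) \<longlonglongrightarrow> 0"
proof -
  have \<sigma>: "0 \<le> \<sigma>" using LIMSEQ_le_const[OF lim] pos by blast
  have b: "\<bar>exp (- \<xi> * \<tau> n) - exp (- \<xi> * \<sigma>)\<bar> \<le> 1" if "0 < \<xi>" for \<xi> n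
  proof -
    have "0 < exp (- \<xi> * \<tau> n)" "exp (- \<xi> * \<tau> n) \<le> 1" "0 < exp (- \<xi> * \<sigma>)" "exp (- \<xi> * \<sigma>) \<le> 1"
      using that pos[of n] \<sigma> by auto
    then show ?thesis by linarith
  qed
  have nrm: "W \<xi> * norm (exp (- \<xi> * \<tau> n) *\<^sub>R f \<xi> - exp (- \<xi> * \<sigma>) *\<^sub>R f \<xi>) =
    \<bar>exp (- \<xi> * \<tau> n) - exp (- \<xi> * \<sigma>)\<bar> * (W \<xi> * norm (f \<xi>))" for \<xi> n
    by (simp flip: scaleR_left_diff_distrib)
  have [measurable]: "(\<lambda>\<xi>. W \<xi> * norm (f \<xi>)) \<in> borel_measurable borel"
    using W_mult_measurable[OF Lb_measurable[OF f]] .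
  have "(\<lambda>n. \<integral>\<xi>. \<bar>exp (- \<xi> * \<tau> n) - exp (- \<xi> * \<sigma>)\<bar> * (W \<xi> * norm (f \<xi>)) \<partial>lborel)
      \<longlonglongrightarrow> (\<integral>\<xi>. 0 \<partial>(lborel :: real measure))"
  proof (rule integral_dominated_convergence[where w="\<lambda>\<xi>. W \<xi> * norm (f \<xi>)"])
    show "integrable lborel (\<lambda>\<xi>. W \<xi> * norm (f \<xi>))" using f by (rule Lb_integrable)
    show "AE \<xi> in lborel. (\<lambda>n. \<bar>exp (- \<xi> * \<tau> n) - exp (- \<xi> * \<sigma>)\<bar> * (W \<xi> * norm (f \<xi>))) \<longlonglongrightarrow> 0"
    proof (rule AE_I2)
      fix \<xi> :: real
      have "(\<lambda>n. \<bar>exp (- \<xi> * \<tau> n) - exp (- \<xi> * \<sigma>)\<bar> * (W \<xi> * norm (f \<xi>))) \<longlonglongrightarrow>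
         \<bar>exp (- \<xi> * \<sigma>) - exp (- \<xi> * \<sigma>)\<bar> * (W \<xi> * norm (f \<xi>))"
        by (intro tendsto_intros lim)
      then show "(\<lambda>n. \<bar>exp (- \<xi> * \<tau> n) - exp (- \<xi> * \<sigma>)\<bar> * (W \<xi> * norm (f \<xi>))) \<longlonglongrightarrow> 0" by simp
    qed
    show "AE \<xi> in lborel. norm (\<bar>exp (- \<xi> * \<tau> n) - exp (- \<xi> * \<sigma>)\<bar> * (W \<xi> * norm (f \<xi>)))
        \<le> W \<xi> * norm (f \<xi>)" for n
    proof (rule AE_I2)
      fix \<xi> :: real
      show "norm (\<bar>exp (- \<xi> * \<tau> n) - exp (- \<xi> * \<sigma>)\<bar> * (W \<xi> * norm (f \<xi>))) \<le> W \<xi> * norm (f \<xi>)"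
      proof (cases "0 < \<xi>")
        case True
        then show ?thesis using b[OF True, of n] by (simp add: abs_mult mult_left_le_one_le)
      qed (simp add: W_def)
    qed
  qed simp_all
  then show ?thesis by (simp only: Nrm_eq nrm) simp
qed

text \<open>Riesz-Fischer for sequences with summable increments: the weighted increments are
  summable almost everywhere, which gives both a pointwise limit and the integrable majorant
  \<open>G\<close>.\<close>

lemma Lb_complete:
  fixes f :: "nat \<Rightarrow> real \<Rightarrow> 'v::euclidean_space"
  assumes f: "\<And>n. f n \<in> Lb phi \<beta>"
    and a: "\<And>n. Nrm phi \<beta> (\<lambda>\<xi>. f (Suc n) \<xi> - f n \<xi>) \<le> a n" "summable a"
  shows "\<exists>g\<in>Lb phi \<beta>. (\<lambda>n. Nrm phi \<beta> (\<lambda>\<xi>. f n \<xi> - g \<xi>)) \<longlonglongrightarrow> 0"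
proof -
  define F where "F n \<xi> = indicator {0<..} \<xi> *\<^sub>R f n \<xi>" for n \<xi>
  have Fm [measurable]: "F n \<in> borel_measurable borel" for n
    using Lb_measurable[OF f[of n]] by (simp add: F_def[abs_def])
  \<comment> \<open>The cut-off functions \<open>F n\<close> are measurable on the whole line, so
    \<open>lim\<close> is measurable too, whatever value it takes where the sequence
    diverges.\<close>
  define g where "g \<xi> = lim (\<lambda>n. F n \<xi>)" for \<xi>
  have gm [measurable]: "g \<in> borel_measurable borel"
    unfolding g_def[abs_def] by measurable
  have gm': "(\<lambda>\<xi>. indicator {0<..} \<xi> *\<^sub>R g \<xi>) \<in> borel_measurable borel" by measurable
  define d where "d n \<xi> = W \<xi> * norm (f (Suc n) \<xi> - f n \<xi>)" for n \<xi>
  have dL: "(\<lambda>\<xi>. f (Suc n) \<xi> - f n \<xi>) \<in> Lb phi \<beta>" for n by (intro Lb_diff f)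
  have di: "integrable lborel (d n)" for n
    unfolding d_def[abs_def] by (intro Lb_integrable dL)
  have d0: "0 \<le> d n \<xi>" for n \<xi> by (simp add: d_def)
  have dint: "integral\<^sup>L lborel (d n) = Nrm phi \<beta> (\<lambda>\<xi>. f (Suc n) \<xi> - f n \<xi>)" for n
    by (simp add: Nrm_eq d_def[abs_def])
  have sd: "summable (\<lambda>n. integral\<^sup>L lborel (d n))"
    unfolding dint by (rule summable_comparison_test'[OF a(2), of 0]) (use a(1) in auto)
  \<comment> \<open>Exchanging sum and integral in the extended reals needs no prior convergence;
    finiteness of the result then yields it almost everywhere.\<close>
  have "(\<integral>\<^sup>+\<xi>. (\<Sum>n. ennreal (d n \<xi>)) \<partial>lborel) = (\<Sum>n. \<integral>\<^sup>+\<xi>. ennreal (d n \<xi>) \<partial>lborel)"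
    using di by (intro nn_integral_suminf) auto
  also have "\<dots> = (\<Sum>n. ennreal (integral\<^sup>L lborel (d n)))"
    using di d0 by (intro arg_cong[where f=suminf] ext nn_integral_eq_integral) auto
  also have "\<dots> \<noteq> \<infinity>"
    using sd by (simp add: ennreal_suminf_neq_top dint)
  finally have "AE \<xi> in lborel. (\<Sum>n. ennreal (d n \<xi>)) \<noteq> \<infinity>"
    using di by (intro nn_integral_PInf_AE) auto
  then have sumd: "AE \<xi> in lborel. summable (\<lambda>n. d n \<xi>)"
    by eventually_elim (auto intro!: summable_suminf_not_top d0)
  define G where "G \<xi> = W \<xi> * norm (f 0 \<xi>) + (\<Sum>n. d n \<xi>)" for \<xi>
  have Gi: "integrable lborel G"
    unfolding G_def[abs_def]
  proof (intro Bochner_Integration.integrable_add Lb_integrable f)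
    show "integrable lborel (\<lambda>\<xi>. \<Sum>n. d n \<xi>)"
      using sumd sd d0 by (intro integrable_suminf di) auto
  qed
  have main: "AE \<xi> in lborel. (\<forall>n. W \<xi> * norm (f n \<xi>) \<le> G \<xi>) \<and>
      (\<lambda>n. W \<xi> * norm (f n \<xi> - g \<xi>)) \<longlonglongrightarrow> 0 \<and> W \<xi> * norm (g \<xi>) \<le> G \<xi>"
    using sumd
  proof eventually_elim
    case (elim \<xi>)
    have tele: "f n \<xi> = f 0 \<xi> + (\<Sum>k<n. f (Suc k) \<xi> - f k \<xi>)" for n
      by (subst sum_lessThan_telescope) simp
    have bd: "W \<xi> * norm (f n \<xi>) \<le> G \<xi>" for n
    proof -
      have "norm (f n \<xi>) \<le> norm (f 0 \<xi>) + (\<Sum>k<n. norm (f (Suc k) \<xi> - f k \<xi>))"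
        by (subst tele) (intro order_trans[OF norm_triangle_ineq] add_left_mono norm_sum)
      then have "W \<xi> * norm (f n \<xi>) \<le> W \<xi> * (norm (f 0 \<xi>) + (\<Sum>k<n. norm (f (Suc k) \<xi> - f k \<xi>)))"
        by (intro mult_left_mono) auto
      also have "\<dots> = W \<xi> * norm (f 0 \<xi>) + (\<Sum>k<n. d k \<xi>)"
        by (simp add: distrib_left sum_distrib_left d_def)
      also have "\<dots> \<le> G \<xi>"
        unfolding G_def using elim d0 by (intro add_left_mono sum_le_suminf) auto
      finally show ?thesis .
    qed
    have conv: "(\<lambda>n. W \<xi> * norm (f n \<xi> - g \<xi>)) \<longlonglongrightarrow> 0"
    \<comment> \<open>Where the weight vanishes the sequence may diverge, but the product is zero.
      Elsewhere division by \<open>W \<xi>\<close> turns summability of \<open>d\<close> into that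
      of the increments.\<close>
    proof (cases "W \<xi> = 0")
      case False
      then have \<xi>: "0 < \<xi>" by (auto simp: W_def indicator_def split: if_splits)
      then have F: "F n \<xi> = f n \<xi>" for n by (simp add: F_def)
      have "summable (\<lambda>n. inverse (W \<xi>) * d n \<xi>)" using elim by (rule summable_mult)
      then have "summable (\<lambda>n. norm (f (Suc n) \<xi> - f n \<xi>))"
        using False by (simp add: d_def field_simps)
      then have "summable (\<lambda>n. f (Suc n) \<xi> - f n \<xi>)" by (rule summable_norm_cancel)
      then have "(\<lambda>n. f 0 \<xi> + (\<Sum>k<n. f (Suc k) \<xi> - f k \<xi>)) \<longlonglongrightarrow> f 0 \<xi> + (\<Sum>n. f (Suc n) \<xi> - f n \<xi>)"
        by (intro tendsto_intros summable_LIMSEQ)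
      then have "convergent (\<lambda>n. F n \<xi>)" unfolding F tele[symmetric] convergent_def by blast
      then have "(\<lambda>n. f n \<xi>) \<longlonglongrightarrow> g \<xi>" unfolding g_def F by (simp add: convergent_LIMSEQ_iff)
      then have "(\<lambda>n. W \<xi> * norm (f n \<xi> - g \<xi>)) \<longlonglongrightarrow> W \<xi> * norm (g \<xi> - g \<xi>)"
        by (intro tendsto_intros)
      then show ?thesis by simp
    qed simp
    have "W \<xi> * norm (g \<xi>) \<le> G \<xi> + W \<xi> * norm (f n \<xi> - g \<xi>)" for n
    proof -
      have "norm (g \<xi>) \<le> norm (f n \<xi>) + norm (f n \<xi> - g \<xi>)"
        by (metis norm_minus_commute norm_triangle_sub)
      then have "W \<xi> * norm (g \<xi>) \<le> W \<xi> * norm (f n \<xi>) + W \<xi> * norm (f n \<xi> - g \<xi>)"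
        by (metis W_nonneg distrib_left mult_left_mono)
      with bd[of n] show ?thesis by linarith
    qed
    moreover have "(\<lambda>n. G \<xi> + W \<xi> * norm (f n \<xi> - g \<xi>)) \<longlonglongrightarrow> G \<xi> + 0"
      by (intro tendsto_intros conv)
    ultimately have "W \<xi> * norm (g \<xi>) \<le> G \<xi>"
      by (auto intro!: LIMSEQ_le_const)
    with bd conv show ?case by blast
  qed
  have "integrable lborel (\<lambda>\<xi>. W \<xi> * norm (g \<xi>))"
  proof (rule Bochner_Integration.integrable_bound[OF Gi])
    show "AE \<xi> in lborel. norm (W \<xi> * norm (g \<xi>)) \<le> norm (G \<xi>)"
      using main by eventually_elim (auto simp: abs_mult)
  qed simp
  then have gL: "g \<in> Lb phi \<beta>" using gm' by (simp add: Lb_iff)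
  have "(\<lambda>n. \<integral>\<xi>. W \<xi> * norm (f n \<xi> - g \<xi>) \<partial>lborel) \<longlonglongrightarrow> (\<integral>\<xi>. 0 \<partial>(lborel :: real measure))"
  proof (rule integral_dominated_convergence[where w="\<lambda>\<xi>. 2 * G \<xi>"])
    show "(\<lambda>\<xi>. W \<xi> * norm (f n \<xi> - g \<xi>)) \<in> borel_measurable lborel" for n
      using W_mult_measurable[OF Lb_measurable[OF Lb_diff(1)[OF f[of n] gL]]] by simp
    show "AE \<xi> in lborel. norm (W \<xi> * norm (f n \<xi> - g \<xi>)) \<le> 2 * G \<xi>" for n
      using main
    proof eventually_elim
      case (elim \<xi>)
      have "W \<xi> * norm (f n \<xi> - g \<xi>) \<le> W \<xi> * (norm (f n \<xi>) + norm (g \<xi>))"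
        by (intro mult_left_mono norm_triangle_ineq4) simp
      moreover have "W \<xi> * norm (f n \<xi>) \<le> G \<xi>" "W \<xi> * norm (g \<xi>) \<le> G \<xi>" using elim by auto
      ultimately show ?case by (simp add: abs_mult distrib_left)
    qed
    show "AE \<xi> in lborel. (\<lambda>n. W \<xi> * norm (f n \<xi> - g \<xi>)) \<longlonglongrightarrow> 0"
      using main by eventually_elim auto
  qed (use Gi in auto)
  then have "(\<lambda>n. Nrm phi \<beta> (\<lambda>\<xi>. f n \<xi> - g \<xi>)) \<longlonglongrightarrow> 0" by (simp add: Nrm_eq)
  with gL show ?thesis by blast
qed

end

section \<open>Convolutional sewing\<close>

definition RS :: "(real \<Rightarrow> real \<Rightarrow> real \<Rightarrow> 'v::real_normed_vector) \<Rightarrow> (nat \<Rightarrow> real) \<Rightarrow> nat \<Rightarrow> nat \<Rightarrow> real \<Rightarrow> 'v" where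
  "RS B p i j \<xi> = (\<Sum>k=i..<j. exp (- \<xi> * (p j - p (Suc k))) *\<^sub>R B (p (Suc k)) (p k) \<xi>)"

lemma RS_same [simp]: "RS B p i i = (\<lambda>\<xi>. 0)"
  by (simp add: RS_def fun_eq_iff)

lemma RS_one [simp]: "RS B p i (Suc i) = B (p (Suc i)) (p i)"
  by (simp add: RS_def fun_eq_iff)

lemma exp_split: "exp (- \<xi> * (t - s)) = exp (- \<xi> * (t - u)) * exp (- \<xi> * (u - s :: real))"
  by (simp add: algebra_simps flip: exp_add)

text \<open>The exponential in \<open>RS\<close> transports each term from the end of its cell to
  the end \<open>p j\<close> of the range. Since transport is multiplicative in time, the sums
  satisfy the additivity rule exactly, for any germ. Partitions are sequences read between two
  indices, and repeated points are allowed.\<close>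

lemma RS_split:
  assumes "i \<le> k" "k \<le> j"
  shows "RS B p i j \<xi> = RS B p k j \<xi> + exp (- \<xi> * (p j - p k)) *\<^sub>R RS B p i k \<xi>"
proof -
  have "exp (- \<xi> * (p j - p k)) *\<^sub>R RS B p i k \<xi> =
      (\<Sum>l=i..<k. exp (- \<xi> * (p j - p (Suc l))) *\<^sub>R B (p (Suc l)) (p l) \<xi>)"
    unfolding RS_def scaleR_sum_right
    by (simp only: scaleR_scaleR exp_split[symmetric])
  then show ?thesis
    by (simp only: RS_def sum.atLeastLessThan_concat[OF assms, symmetric] add.commute)
qed

text \<open>Cutting one cell replaces its germ by the two halves, a change of exactly
  \<open>- dtil3 B\<close>. The identity is purely algebraic, so the odd points of \<open>q\<close>
  may lie anywhere.\<close>

lemma RS_refine: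
  assumes "\<And>k. q (2 * k) = p k"
  shows "RS B q 0 (2 * N) \<xi> - RS B p 0 N \<xi> =
    - (\<Sum>k<N. exp (- \<xi> * (p N - p (Suc k))) *\<^sub>R dtil3 B (p (Suc k)) (q (Suc (2 * k))) (p k) \<xi>)"
proof -
  have pairs: "(\<Sum>k<2 * N. f k) = (\<Sum>k<N. f (2 * k) + f (Suc (2 * k)))" for f :: "nat \<Rightarrow> 'a"
    by (induction N) (simp_all add: algebra_simps)
  have q2: "q (Suc (Suc (2 * k))) = p (Suc k)" for k
    using assms[of "Suc k"] by simp
  show ?thesis
    unfolding RS_def pairs atLeast0LessThan sum_subtractf[symmetric] sum_negf[symmetric]
  proof (intro sum.cong refl)
    fix k
    show "exp (- \<xi> * (q (2 * N) - q (Suc (2 * k)))) *\<^sub>R B (q (Suc (2 * k))) (q (2 * k)) \<xi> +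
         exp (- \<xi> * (q (2 * N) - q (Suc (Suc (2 * k))))) *\<^sub>R B (q (Suc (Suc (2 * k)))) (q (Suc (2 * k))) \<xi> -
         exp (- \<xi> * (p N - p (Suc k))) *\<^sub>R B (p (Suc k)) (p k) \<xi> =
         - (exp (- \<xi> * (p N - p (Suc k))) *\<^sub>R dtil3 B (p (Suc k)) (q (Suc (2 * k))) (p k) \<xi>)"
      unfolding assms q2 dtil3_def exp_split[of \<xi> "p N" "q (Suc (2 * k))" "p (Suc k)"]
      by (simp add: scaleR_diff_right)
  qed
qed

text \<open>Level \<open>n\<close> of the dyadic grid of [a,b], projected to [s,t]. Points outside
  collapse to an endpoint, so there are \<open>2 ^ n\<close> cells for every choice of s and t, many
  of them possibly degenerate.\<close>

definition dgrid :: "real \<Rightarrow> real \<Rightarrow> real \<Rightarrow> real \<Rightarrow> nat \<Rightarrow> nat \<Rightarrow> real" where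
  "dgrid a b s t n k = max s (min (a + real k * ((b - a) / 2 ^ n)) t)"

lemma dgrid_mono:
  assumes "a \<le> b"
  shows "mono (dgrid a b s t n)"
proof (rule monoI)
  fix k l :: nat assume "k \<le> l"
  then have "real k * ((b - a) / 2 ^ n) \<le> real l * ((b - a) / 2 ^ n)"
    using assms by (intro mult_right_mono) auto
  then show "dgrid a b s t n k \<le> dgrid a b s t n l" by (auto simp: dgrid_def)
qed

lemma dgrid_bounds: "s \<le> t \<Longrightarrow> s \<le> dgrid a b s t n k" "s \<le> t \<Longrightarrow> dgrid a b s t n k \<le> t"
  by (auto simp: dgrid_def)

lemma dgrid_0: "a \<le> s \<Longrightarrow> s \<le> t \<Longrightarrow> dgrid a b s t n 0 = s"
  by (auto simp: dgrid_def)

lemma dgrid_last: "s \<le> t \<Longrightarrow> t \<le> b \<Longrightarrow> dgrid a b s t n (2 ^ n) = t"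
  by (auto simp: dgrid_def)

lemma dgrid_double: "dgrid a b s t (Suc n) (2 * k) = dgrid a b s t n k"
  by (simp add: dgrid_def)

text \<open>Clamping does not increase distances.\<close>

lemma dgrid_step:
  assumes "a \<le> b"
  shows "dgrid a b s t n (Suc k) - dgrid a b s t n k \<le> (b - a) / 2 ^ n"
proof -
  define d where "d = (b - a) / 2 ^ n"
  have "0 \<le> d" using assms by (simp add: d_def)
  then show ?thesis
    unfolding dgrid_def d_def[symmetric] by (auto simp: distrib_right min_def max_def)
qed

text \<open>The arithmetic behind every convergence below: \<open>2 ^ n\<close> cells, each with an
  error of order \<mu>, add up to a geometric sequence whose ratio is below 1 exactly when \<mu> >
  1.\<close>

lemma dyadic_powr:
  fixes l C \<mu> :: real
  assumes "0 \<le> l"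
  shows "2 ^ n * (C * (l / 2 ^ n) powr \<mu>) = C * l powr \<mu> * (2 powr (1 - \<mu>)) ^ n"
proof -
  have "(l / 2 ^ n) powr \<mu> = l powr \<mu> / (2 ^ n) powr \<mu>"
    using assms by (simp add: powr_divide)
  moreover have "(2 ^ n) powr \<mu> = (2 powr \<mu>) ^ n"
    by (simp add: powr_realpow[symmetric] powr_powr powr_power mult.commute)
  moreover have "2 powr (1 - \<mu>) = 2 / 2 powr \<mu>" by (simp add: powr_diff)
  ultimately show ?thesis by (simp add: power_divide)
qed

section \<open>Estimates for Riemann sums and the additive limit\<close>

context measurable_weight
begin

lemma dtil3_Lb:
  fixes B :: "real \<Rightarrow> real \<Rightarrow> real \<Rightarrow> 'v::euclidean_space"
  assumes BL: "\<And>s t. a \<le> s \<Longrightarrow> s \<le> t \<Longrightarrow> t \<le> b \<Longrightarrow> B t s \<in> Lb phi \<beta>"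
    and "a \<le> s" "s \<le> u" "u \<le> t" "t \<le> b"
  shows "dtil3 B t u s \<in> Lb phi \<beta>"
  using assms(2-) unfolding dtil3_def[abs_def] by (intro Lb_diff Lb_exp BL) auto

text \<open>At three equal times the increment is \<open>- B t t\<close>. Any bound on
  \<open>dtil3 B\<close> by a positive power of \<open>t - s\<close> therefore shows that
  \<open>B t t\<close> has norm zero.\<close>

lemma Nrm_dtil3_diag: "Nrm phi \<beta> (dtil3 B t t t) = Nrm phi \<beta> (B t t)"
  by (simp add: dtil3_def[abs_def])

lemma Lb_RS:
  fixes B :: "real \<Rightarrow> real \<Rightarrow> real \<Rightarrow> 'v::euclidean_space"
  assumes BL: "\<And>s t. a \<le> s \<Longrightarrow> s \<le> t \<Longrightarrow> t \<le> b \<Longrightarrow> B t s \<in> Lb phi \<beta>"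
    and p: "mono p" "\<And>k. a \<le> p k" "\<And>k. p k \<le> b"
  shows "RS B p i j \<in> Lb phi \<beta>"
  unfolding RS_def[abs_def]
proof (rule conjunct1[OF Nrm_sum])
  fix k assume "k \<in> {i..<j}"
  then show "(\<lambda>\<xi>. exp (- \<xi> * (p j - p (Suc k))) *\<^sub>R B (p (Suc k)) (p k) \<xi>) \<in> Lb phi \<beta>"
    by (intro Lb_exp BL p) (auto intro: monoD[OF p(1)])
qed simp

text \<open>Splitting at the subinterval containing the midpoint leaves two blocks of at most half the
  length, so the induction closes because \<open>2 * (1/2)\<^sup>\<mu> < 1\<close>; the splitting itself costs two values
  of \<open>dtil3 B\<close>.\<close>

lemma RS_germ_bound:
  fixes B :: "real \<Rightarrow> real \<Rightarrow> real \<Rightarrow> 'v::euclidean_space"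
  assumes BL: "\<And>s t. a \<le> s \<Longrightarrow> s \<le> t \<Longrightarrow> t \<le> b \<Longrightarrow> B t s \<in> Lb phi \<beta>"
    and dB: "\<And>s u t. a \<le> s \<Longrightarrow> s \<le> u \<Longrightarrow> u \<le> t \<Longrightarrow> t \<le> b \<Longrightarrow>
        Nrm phi \<beta> (dtil3 B t u s) \<le> C * (t - s) powr \<mu>"
    and C: "0 \<le> C" and \<mu>: "1 < \<mu>"
    and p: "mono p" "\<And>k. a \<le> p k" "\<And>k. p k \<le> b" and "i \<le> j"
  shows "Nrm phi \<beta> (\<lambda>\<xi>. RS B p i j \<xi> - B (p j) (p i) \<xi>) \<le>
     2 * C / (1 - 2 powr (1 - \<mu>)) * (p j - p i) powr \<mu>"
  using \<open>i \<le> j\<close>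
proof (induction "j - i" arbitrary: i j rule: less_induct)
  case less
  \<comment> \<open>\<open>K\<close> solves \<open>K = 2 powr (1 - \<mu>) * K + 2 * C\<close>: two
    blocks of length at most \<open>L / 2\<close> give the first summand, the two values of
    \<open>dtil3 B\<close> the second.\<close>
  define K where "K = 2 * C / (1 - 2 powr (1 - \<mu>))"
  have lt: "2 powr (1 - \<mu>) < (1::real)"
    using \<mu> by (simp add: powr_less_one)
  have K: "0 \<le> K" "2 powr (1 - \<mu>) * K + 2 * C = K"
  proof -
    have "K * (1 - 2 powr (1 - \<mu>)) = 2 * C" using \<mu> by (simp add: K_def)
    then show "2 powr (1 - \<mu>) * K + 2 * C = K" by (simp add: algebra_simps)
    show "0 \<le> K" using C lt by (simp add: K_def)
  qed
  note BLp = BL[OF p(2) monoD[OF p(1)] p(3)]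
  show ?case
  proof (cases "i = j")
    case True
    have "Nrm phi \<beta> (B (p j) (p j)) \<le> 0"
      using dB[of "p j" "p j" "p j"] p(2,3) by (simp add: Nrm_dtil3_diag)
    with True show ?thesis by simp
  next
    case False
    with less.prems have ij: "i < j" by simp
    define L where "L = p j - p i"
    have L: "0 \<le> L" unfolding L_def using monoD[OF p(1), of i j] ij by simp
    \<comment> \<open>Its maximum \<open>k\<close> is the last point within the left half, measured
      by length and not by index. The cell from \<open>k\<close> to \<open>Suc k\<close> is left out
      of the recursion because its Riemann sum is the germ itself; both remaining blocks have
      strictly fewer cells.\<close>
    define S where "S = {k. i \<le> k \<and> k < j \<and> p k - p i \<le> L / 2}"
    have S: "finite S" "i \<in> S" using L ij by (auto simp: S_def)
    define k where "k = Max S"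
    have "k \<in> S" using Max_in[OF S(1)] S(2) by (auto simp: k_def)
    then have k: "i \<le> k" "k < j" "p k - p i \<le> L / 2" by (auto simp: S_def)
    have k2: "p j - p (Suc k) \<le> L / 2"
    proof (cases "Suc k = j")
      case False
      have "Suc k \<notin> S" using Max_ge[OF S(1), of "Suc k"] by (auto simp: k_def)
      with False k show ?thesis by (auto simp: S_def L_def)
    qed (use L in auto)
    have mp: "p i \<le> p k" "p k \<le> p (Suc k)" "p (Suc k) \<le> p j"
      using k by (auto intro!: monoD[OF p(1)])
    define X where "X \<xi> = RS B p (Suc k) j \<xi> - B (p j) (p (Suc k)) \<xi>" for \<xi>
    define Y where "Y \<xi> = RS B p i k \<xi> - B (p k) (p i) \<xi>" for \<xi>
    have XL: "X \<in> Lb phi \<beta>" and YL: "Y \<in> Lb phi \<beta>"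
      unfolding X_def[abs_def] Y_def[abs_def]
      using k by (auto intro!: Lb_diff Lb_RS[OF BL p] BLp)
    have half: "K * l powr \<mu> \<le> K * (L / 2) powr \<mu>" if "0 \<le> l" "l \<le> L / 2" for l
      using that \<mu> K(1) by (intro mult_left_mono powr_mono2) auto
    have nX: "Nrm phi \<beta> X \<le> K * (L / 2) powr \<mu>"
      unfolding X_def[abs_def]
      by (rule order_trans[OF less.hyps[folded K_def] half[OF _ k2]]) (use k mp in auto)
    have nY: "Nrm phi \<beta> Y \<le> K * (L / 2) powr \<mu>"
      unfolding Y_def[abs_def]
      by (rule order_trans[OF less.hyps[folded K_def] half[OF _ k(3)]]) (use k mp in auto)
    have d1L: "dtil3 B (p j) (p (Suc k)) (p i) \<in> Lb phi \<beta>"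
      and d2L: "dtil3 B (p (Suc k)) (p k) (p i) \<in> Lb phi \<beta>"
      using mp by (auto intro!: dtil3_Lb[OF BL] p)
    have mono': "C * (p (Suc k) - p i) powr \<mu> \<le> C * L powr \<mu>"
      using mp \<mu> C by (intro mult_left_mono powr_mono2) (auto simp: L_def)
    have n1: "Nrm phi \<beta> (dtil3 B (p j) (p (Suc k)) (p i)) \<le> C * L powr \<mu>"
      using dB[of "p i" "p (Suc k)" "p j"] mp p(2,3) by (auto simp: L_def)
    have n2: "Nrm phi \<beta> (dtil3 B (p (Suc k)) (p k) (p i)) \<le> C * L powr \<mu>"
      using dB[of "p i" "p k" "p (Suc k)"] mp p(2)[of i] p(3)[of "Suc k"] mono' by linarith
    have eq: "RS B p i j \<xi> - B (p j) (p i) \<xi> =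
        (X \<xi> + exp (- \<xi> * (p j - p k)) *\<^sub>R Y \<xi>) -
        (dtil3 B (p j) (p (Suc k)) (p i) \<xi> +
         exp (- \<xi> * (p j - p (Suc k))) *\<^sub>R dtil3 B (p (Suc k)) (p k) (p i) \<xi>)" for \<xi>
    proof -
      have "RS B p i j \<xi> = RS B p (Suc k) j \<xi> + exp (- \<xi> * (p j - p (Suc k))) *\<^sub>R
          (B (p (Suc k)) (p k) \<xi> + exp (- \<xi> * (p (Suc k) - p k)) *\<^sub>R RS B p i k \<xi>)"
        using RS_split[of i "Suc k" j B p \<xi>] RS_split[of i k "Suc k" B p \<xi>] k by simp
      then show ?thesis
        unfolding X_def Y_def dtil3_def exp_split[of \<xi> "p j" "p k" "p (Suc k)"]
        by (simp add: algebra_simps)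
    qed
    have "Nrm phi \<beta> (\<lambda>\<xi>. RS B p i j \<xi> - B (p j) (p i) \<xi>) \<le>
        (Nrm phi \<beta> X + Nrm phi \<beta> Y) +
        (Nrm phi \<beta> (dtil3 B (p j) (p (Suc k)) (p i)) + Nrm phi \<beta> (dtil3 B (p (Suc k)) (p k) (p i)))"
      unfolding eq using mp
      by (intro Nrm_diff_le Nrm_add_le Nrm_exp_le_bound Lb_add Lb_exp XL YL d1L d2L order_refl) auto
    also have "\<dots> \<le> 2 * (K * (L / 2) powr \<mu>) + 2 * (C * L powr \<mu>)"
      using nX nY n1 n2 by linarith
    also have "\<dots> = (2 powr (1 - \<mu>) * K + 2 * C) * L powr \<mu>"
      using L by (simp add: powr_divide powr_diff field_simps)
    also have "\<dots> = K * L powr \<mu>" by (simp add: K(2))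
    finally show ?thesis by (simp add: K_def L_def)
  qed
qed

text \<open>Passing to the next level cuts each clamped cell once, and each has length at most
  \<open>(b - a) / 2 ^ n\<close>. The resulting geometric bound is uniform in s and t.\<close>

lemma Nrm_RS_refine:
  fixes B :: "real \<Rightarrow> real \<Rightarrow> real \<Rightarrow> 'v::euclidean_space"
  assumes BL: "\<And>s t. a \<le> s \<Longrightarrow> s \<le> t \<Longrightarrow> t \<le> b \<Longrightarrow> B t s \<in> Lb phi \<beta>"
    and dB: "\<And>s u t. a \<le> s \<Longrightarrow> s \<le> u \<Longrightarrow> u \<le> t \<Longrightarrow> t \<le> b \<Longrightarrow>
        Nrm phi \<beta> (dtil3 B t u s) \<le> C * (t - s) powr \<mu>"
    and C: "0 \<le> C" and \<mu>: "1 < \<mu>"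
    and st: "a \<le> s" "s \<le> t" "t \<le> b"
  shows "Nrm phi \<beta> (\<lambda>\<xi>. RS B (dgrid a b s t (Suc n)) 0 (2 ^ Suc n) \<xi> - RS B (dgrid a b s t n) 0 (2 ^ n) \<xi>)
     \<le> C * (b - a) powr \<mu> * (2 powr (1 - \<mu>)) ^ n"
proof -
  have ab: "a \<le> b" using st by linarith
  let ?p = "dgrid a b s t n" and ?q = "dgrid a b s t (Suc n)"
  have q2: "?q (2 * k) = ?p k" for k by (rule dgrid_double)
  have q3: "?q (Suc (2 * k)) \<le> ?p (Suc k)" "?p k \<le> ?q (Suc (2 * k))" for k
    using monoD[OF dgrid_mono[OF ab], of "Suc (2*k)" "2 * Suc k" s t "Suc n"]
      monoD[OF dgrid_mono[OF ab], of "2*k" "Suc (2 * k)" s t "Suc n"] unfolding q2 by simp_all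
  have in_ab: "a \<le> ?p k" "?p k \<le> b" for k
    using dgrid_bounds[OF st(2), of a b n k] st by auto
  have dL: "dtil3 B (?p (Suc k)) (?q (Suc (2 * k))) (?p k) \<in> Lb phi \<beta>" for k
    by (rule dtil3_Lb[OF BL in_ab(1) q3(2) q3(1) in_ab(2)])
  have pm: "?p (Suc k) \<le> ?p (2 ^ n)" if "k < 2 ^ n" for k
    using that by (intro monoD[OF dgrid_mono[OF ab]]) auto
  have term_le: "Nrm phi \<beta> (\<lambda>\<xi>. exp (- \<xi> * (?p (2 ^ n) - ?p (Suc k))) *\<^sub>R
        dtil3 B (?p (Suc k)) (?q (Suc (2 * k))) (?p k) \<xi>) \<le> C * ((b - a) / 2 ^ n) powr \<mu>"
    if "k < 2 ^ n" for k
  proof -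
    have "Nrm phi \<beta> (\<lambda>\<xi>. exp (- \<xi> * (?p (2 ^ n) - ?p (Suc k))) *\<^sub>R
        dtil3 B (?p (Suc k)) (?q (Suc (2 * k))) (?p k) \<xi>) \<le> C * (?p (Suc k) - ?p k) powr \<mu>"
      using pm[OF that] by (intro order_trans[OF Nrm_exp_le[OF dL] dB] in_ab q3) auto
    also have "\<dots> \<le> C * ((b - a) / 2 ^ n) powr \<mu>"
      using dgrid_step[OF ab, of s t n k] monoD[OF dgrid_mono[OF ab], of k "Suc k" s t n] \<mu> C
      by (intro mult_left_mono powr_mono2) auto
    finally show ?thesis .
  qed
  have "Nrm phi \<beta> (\<lambda>\<xi>. RS B ?q 0 (2 ^ Suc n) \<xi> - RS B ?p 0 (2 ^ n) \<xi>) =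
     Nrm phi \<beta> (\<lambda>\<xi>. \<Sum>k<2^n. exp (- \<xi> * (?p (2 ^ n) - ?p (Suc k))) *\<^sub>R
        dtil3 B (?p (Suc k)) (?q (Suc (2 * k))) (?p k) \<xi>)"
    unfolding power_Suc RS_refine[of ?q ?p, OF q2] Nrm_uminus ..
  also have "\<dots> \<le> (\<Sum>k<2^n. Nrm phi \<beta> (\<lambda>\<xi>. exp (- \<xi> * (?p (2 ^ n) - ?p (Suc k))) *\<^sub>R
        dtil3 B (?p (Suc k)) (?q (Suc (2 * k))) (?p k) \<xi>))"
    using pm by (intro conjunct2[OF Nrm_sum] Lb_exp dL) auto
  also have "\<dots> \<le> (\<Sum>k<(2::nat)^n. C * ((b - a) / 2 ^ n) powr \<mu>)"
    using term_le by (intro sum_mono) auto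
  also have "\<dots> = C * (b - a) powr \<mu> * (2 powr (1 - \<mu>)) ^ n"
    using ab by (simp add: dyadic_powr)
  finally show ?thesis .
qed

text \<open>Only the grid cell that contains \<open>u\<close> in its interior contributes to the additivity defect.\<close>

lemma Nrm_dtil3_RS:
  fixes B :: "real \<Rightarrow> real \<Rightarrow> real \<Rightarrow> 'v::euclidean_space"
  assumes BL: "\<And>s t. a \<le> s \<Longrightarrow> s \<le> t \<Longrightarrow> t \<le> b \<Longrightarrow> B t s \<in> Lb phi \<beta>"
    and dB: "\<And>s u t. a \<le> s \<Longrightarrow> s \<le> u \<Longrightarrow> u \<le> t \<Longrightarrow> t \<le> b \<Longrightarrow>
        Nrm phi \<beta> (dtil3 B t u s) \<le> C * (t - s) powr \<mu>"
    and C: "0 \<le> C" and \<mu>: "1 < \<mu>"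
    and st: "a \<le> s" "s \<le> u" "u \<le> t" "t \<le> b"
  shows "Nrm phi \<beta> (dtil3 (\<lambda>t s. RS B (dgrid a b s t n) 0 (2 ^ n)) t u s)
     \<le> C * (b - a) powr \<mu> * (2 powr (1 - \<mu>)) ^ n"
proof -
  have ab: "a \<le> b" using st by linarith
  let ?p = "dgrid a b s t n" and ?q = "dgrid a b u t n" and ?r = "dgrid a b s u n"
  \<comment> \<open>The three sums run over the same index, so the defect can be collected cell by
    cell. In each case \<open>r\<close> lives on [s,u] and needs the extra transport from u to
    t.\<close>
  define D where "D k \<xi> = exp (- \<xi> * (t - ?p (Suc k))) *\<^sub>R B (?p (Suc k)) (?p k) \<xi> -
     exp (- \<xi> * (t - ?q (Suc k))) *\<^sub>R B (?q (Suc k)) (?q k) \<xi> -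
     exp (- \<xi> * (t - u)) *\<^sub>R exp (- \<xi> * (u - ?r (Suc k))) *\<^sub>R B (?r (Suc k)) (?r k) \<xi>" for k \<xi>
  have last: "?p (2 ^ n) = t" "?q (2 ^ n) = t" "?r (2 ^ n) = u"
    using st by (auto intro!: dgrid_last)
  have eq: "dtil3 (\<lambda>t s. RS B (dgrid a b s t n) 0 (2 ^ n)) t u s = (\<lambda>\<xi>. \<Sum>k<2^n. D k \<xi>)"
    unfolding dtil3_def[abs_def] RS_def D_def last
    by (simp only: atLeast0LessThan sum_subtractf scaleR_sum_right)
  have diag: "Nrm phi \<beta> (B u u) = 0"
    using dB[of u u u] st by (simp add: Nrm_dtil3_diag order_antisym)
  have uL: "B u u \<in> Lb phi \<beta>" using st by (intro BL) auto
  have D: "D k \<in> Lb phi \<beta> \<and> Nrm phi \<beta> (D k) \<le> C * ((b - a) / 2 ^ n) powr \<mu>" for k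
  proof -
    define x where "x = a + real k * ((b - a) / 2 ^ n)"
    define y where "y = a + real (Suc k) * ((b - a) / 2 ^ n)"
    have "0 \<le> (b - a) / 2 ^ n" "y - x = (b - a) / 2 ^ n" "0 \<le> real k * ((b - a) / 2 ^ n)"
      unfolding x_def y_def of_nat_Suc distrib_right using ab by simp_all
    then have xy: "x \<le> y" "y - x = (b - a) / 2 ^ n" "a \<le> x"
      by (simp_all add: x_def)
    have pk: "?p k = max s (min x t)" "?p (Suc k) = max s (min y t)"
      "?q k = max u (min x t)" "?q (Suc k) = max u (min y t)"
      "?r k = max s (min x u)" "?r (Suc k) = max s (min y u)"
      by (simp_all only: dgrid_def x_def y_def)
    \<comment> \<open>Cells on one side of \<open>u\<close> cancel between two of the grids; the
      third grid contributes only a degenerate cell at \<open>u\<close>, whose germ has norm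
      zero.\<close>
    have small: ?thesis if "D k = (\<lambda>\<xi>. - (exp (- \<xi> * \<tau>) *\<^sub>R B u u \<xi>))" "0 \<le> \<tau>" for \<tau>
      unfolding that(1) Nrm_uminus
      by (intro conjI Lb_uminus Lb_exp Nrm_exp_le_bound uL that(2)) (simp add: diag C)
    consider "y \<le> u" | "u \<le> x" | "x < u" "u < y" by linarith
    then show ?thesis
    proof cases
      case 1
      then have e: "?q k = u" "?q (Suc k) = u" "?p k = ?r k" "?p (Suc k) = ?r (Suc k)"
        using xy st by (auto simp: pk)
      have "D k = (\<lambda>\<xi>. - (exp (- \<xi> * (t - u)) *\<^sub>R B u u \<xi>))"
        unfolding D_def[abs_def] e exp_split[of _ t "?r (Suc k)" u] by (simp add: fun_eq_iff)
      then show ?thesis using st by (intro small[of "t - u"]) auto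
    next
      case 2
      then have e: "?r k = u" "?r (Suc k) = u" "?p k = ?q k" "?p (Suc k) = ?q (Suc k)"
        using xy st by (auto simp: pk)
      have "D k = (\<lambda>\<xi>. - (exp (- \<xi> * (t - u)) *\<^sub>R B u u \<xi>))"
        unfolding D_def[abs_def] e by (simp add: fun_eq_iff)
      then show ?thesis using st by (intro small[of "t - u"]) auto
    next
      case 3
      \<comment> \<open>The cell around \<open>u\<close> is split by the grids of [s,u] and [u,t]
        into two pieces meeting at \<open>u\<close>, so its defect is a transported value of
        \<open>dtil3 B\<close>.\<close>
      define Y where "Y = ?p (Suc k)"
      define X where "X = ?p k"
      have e: "?q k = u" "?q (Suc k) = Y" "?r (Suc k) = u" "?r k = X"
        using 3 st xy by (auto simp: pk Y_def X_def)
      have XY: "a \<le> X" "X \<le> u" "u \<le> Y" "Y \<le> t" "Y \<le> b" "Y - X \<le> (b - a) / 2 ^ n"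
        using 3 st xy by (auto simp: pk Y_def X_def)
      have "D k = (\<lambda>\<xi>. exp (- \<xi> * (t - Y)) *\<^sub>R dtil3 B Y u X \<xi>)"
        unfolding D_def[abs_def] e X_def[symmetric] Y_def[symmetric] dtil3_def exp_split[of _ t u Y]
        by (simp add: fun_eq_iff scaleR_diff_right)
      moreover have dL: "dtil3 B Y u X \<in> Lb phi \<beta>"
        by (rule dtil3_Lb[OF BL XY(1,2,3,5)])
      moreover have "Nrm phi \<beta> (dtil3 B Y u X) \<le> C * ((b - a) / 2 ^ n) powr \<mu>"
        using XY C \<mu> by (intro order_trans[OF dB[OF XY(1,2,3,5)]] mult_left_mono powr_mono2) auto
      ultimately show ?thesis
        using XY(4) by (simp only:) (intro conjI Lb_exp Nrm_exp_le_bound; simp)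
    qed
  qed
  have "Nrm phi \<beta> (\<lambda>\<xi>. \<Sum>k<2^n. D k \<xi>) \<le> (\<Sum>k<2^n. Nrm phi \<beta> (D k))"
    using D by (intro conjunct2[OF Nrm_sum]) auto
  also have "\<dots> \<le> (\<Sum>k<(2::nat)^n. C * ((b - a) / 2 ^ n) powr \<mu>)"
    using D by (intro sum_mono) auto
  also have "\<dots> = C * (b - a) powr \<mu> * (2 powr (1 - \<mu>)) ^ n"
    using ab by (simp add: dyadic_powr)
  finally show ?thesis unfolding eq .
qed

text \<open>The approximations at level \<open>n\<close> have a germ error bounded independently of
  \<open>n\<close> and an additivity defect that tends to zero; both facts survive the limit because
  the transport factors are contractions.\<close>

lemma sewing:
  fixes B :: "real \<Rightarrow> real \<Rightarrow> real \<Rightarrow> 'v::euclidean_space"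
  assumes BL: "\<And>s t. a \<le> s \<Longrightarrow> s \<le> t \<Longrightarrow> t \<le> b \<Longrightarrow> B t s \<in> Lb phi \<beta>"
    and dB: "\<And>s u t. a \<le> s \<Longrightarrow> s \<le> u \<Longrightarrow> u \<le> t \<Longrightarrow> t \<le> b \<Longrightarrow>
        Nrm phi \<beta> (dtil3 B t u s) \<le> C * (t - s) powr \<mu>"
    and C: "0 \<le> C" and \<mu>: "1 < \<mu>"
  obtains J where
    "\<And>s t. a \<le> s \<Longrightarrow> s \<le> t \<Longrightarrow> t \<le> b \<Longrightarrow> J t s \<in> Lb phi \<beta>"
    "\<And>s u t. a \<le> s \<Longrightarrow> s \<le> u \<Longrightarrow> u \<le> t \<Longrightarrow> t \<le> b \<Longrightarrow> Nrm phi \<beta> (dtil3 J t u s) = 0"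
    "\<And>s t. a \<le> s \<Longrightarrow> s \<le> t \<Longrightarrow> t \<le> b \<Longrightarrow>
       Nrm phi \<beta> (\<lambda>\<xi>. J t s \<xi> - B t s \<xi>) \<le> 2 * C / (1 - 2 powr (1 - \<mu>)) * (t - s) powr \<mu>"
proof -
  define Jn where "Jn n t s = RS B (dgrid a b s t n) 0 (2 ^ n)" for n t s
  have r: "0 \<le> 2 powr (1 - \<mu>)" "2 powr (1 - \<mu>) < (1::real)"
    using \<mu> by (auto simp: powr_less_one)
  have sm: "summable (\<lambda>n. C * (b - a) powr \<mu> * (2 powr (1 - \<mu>)) ^ n)"
    using r by (intro summable_mult summable_geometric) auto
  have JnL: "Jn n t s \<in> Lb phi \<beta>" if "a \<le> s" "s \<le> t" "t \<le> b" for n s t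
    unfolding Jn_def
  proof (rule Lb_RS[OF BL])
    show "mono (dgrid a b s t n)" using that by (intro dgrid_mono) auto
    show "a \<le> dgrid a b s t n k" "dgrid a b s t n k \<le> b" for k
      using dgrid_bounds[of s t a b n k] that by auto
  qed
  \<comment> \<open>A representative is chosen for each pair of times independently, so additivity
    can only be expected up to norm zero.\<close>
  define J where "J t s = (SOME g. g \<in> Lb phi \<beta> \<and> (\<lambda>n. Nrm phi \<beta> (\<lambda>\<xi>. Jn n t s \<xi> - g \<xi>)) \<longlonglongrightarrow> 0)" for t s
  have J: "J t s \<in> Lb phi \<beta> \<and> (\<lambda>n. Nrm phi \<beta> (\<lambda>\<xi>. Jn n t s \<xi> - J t s \<xi>)) \<longlonglongrightarrow> 0"
    if st: "a \<le> s" "s \<le> t" "t \<le> b" for s t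
  proof -
    have "Nrm phi \<beta> (\<lambda>\<xi>. Jn (Suc n) t s \<xi> - Jn n t s \<xi>) \<le> C * (b - a) powr \<mu> * (2 powr (1 - \<mu>)) ^ n" for n
      unfolding Jn_def by (rule Nrm_RS_refine[OF BL dB C \<mu> st])
    from Lb_complete[OF JnL[OF st] this sm]
    have "\<exists>g. g \<in> Lb phi \<beta> \<and> (\<lambda>n. Nrm phi \<beta> (\<lambda>\<xi>. Jn n t s \<xi> - g \<xi>)) \<longlonglongrightarrow> 0" by blast
    from someI_ex[OF this] show ?thesis unfolding J_def .
  qed
  show thesis
  proof
    show JL: "J t s \<in> Lb phi \<beta>" if "a \<le> s" "s \<le> t" "t \<le> b" for s t
      using J[OF that] by blast
    show "Nrm phi \<beta> (\<lambda>\<xi>. J t s \<xi> - B t s \<xi>) \<le> 2 * C / (1 - 2 powr (1 - \<mu>)) * (t - s) powr \<mu>"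
      (is "_ \<le> ?R") if st: "a \<le> s" "s \<le> t" "t \<le> b" for s t
    proof -
      have "Nrm phi \<beta> (\<lambda>\<xi>. J t s \<xi> - B t s \<xi>) \<le> ?R + Nrm phi \<beta> (\<lambda>\<xi>. Jn n t s \<xi> - J t s \<xi>)" for n
      proof -
        have "Nrm phi \<beta> (\<lambda>\<xi>. (Jn n t s \<xi> - B t s \<xi>) - (Jn n t s \<xi> - J t s \<xi>))
           \<le> Nrm phi \<beta> (\<lambda>\<xi>. Jn n t s \<xi> - B t s \<xi>) + Nrm phi \<beta> (\<lambda>\<xi>. Jn n t s \<xi> - J t s \<xi>)"
          using st by (intro Nrm_triangle_diff Lb_diff JnL JL BL) auto
        moreover have "Nrm phi \<beta> (\<lambda>\<xi>. Jn n t s \<xi> - B t s \<xi>) \<le> ?R"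
        proof -
          let ?p = "dgrid a b s t n"
          have "Nrm phi \<beta> (\<lambda>\<xi>. RS B ?p 0 (2 ^ n) \<xi> - B (?p (2 ^ n)) (?p 0) \<xi>) \<le>
            2 * C / (1 - 2 powr (1 - \<mu>)) * (?p (2 ^ n) - ?p 0) powr \<mu>"
          proof (rule RS_germ_bound[OF BL dB C \<mu>])
            show "mono ?p" using st by (intro dgrid_mono) auto
            show "a \<le> ?p k" "?p k \<le> b" for k
              using dgrid_bounds[of s t a b n k] st by auto
            show "(0::nat) \<le> 2 ^ n" by (rule le0)
          qed
          then show ?thesis using st by (simp add: Jn_def dgrid_0 dgrid_last)
        qed
        ultimately show ?thesis by simp
      qed
      moreover have "(\<lambda>n. ?R + Nrm phi \<beta> (\<lambda>\<xi>. Jn n t s \<xi> - J t s \<xi>)) \<longlonglongrightarrow> ?R + 0"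
        using J[OF st] by (intro tendsto_intros) auto
      ultimately show ?thesis by (auto intro!: LIMSEQ_le_const)
    qed
    show "Nrm phi \<beta> (dtil3 J t u s) = 0" if st: "a \<le> s" "s \<le> u" "u \<le> t" "t \<le> b" for s u t
    proof -
      \<comment> \<open>Defect of the approximations at level \<open>n\<close>, plus the errors of
        replacing each of the three limits by its approximation.\<close>
      define R where "R n = C * (b - a) powr \<mu> * (2 powr (1 - \<mu>)) ^ n +
         (Nrm phi \<beta> (\<lambda>\<xi>. Jn n t s \<xi> - J t s \<xi>) + (Nrm phi \<beta> (\<lambda>\<xi>. Jn n t u \<xi> - J t u \<xi>) +
          Nrm phi \<beta> (\<lambda>\<xi>. Jn n u s \<xi> - J u s \<xi>)))" for n
      have "Nrm phi \<beta> (dtil3 J t u s) \<le> R n" for n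
      proof -
        have dL: "dtil3 (Jn n) t u s \<in> Lb phi \<beta>" by (rule dtil3_Lb[OF JnL st])
        have eq: "dtil3 J t u s = (\<lambda>\<xi>. dtil3 (Jn n) t u s \<xi> - ((Jn n t s \<xi> - J t s \<xi>) -
             ((Jn n t u \<xi> - J t u \<xi>) + exp (- \<xi> * (t - u)) *\<^sub>R (Jn n u s \<xi> - J u s \<xi>))))"
          by (simp add: dtil3_def fun_eq_iff algebra_simps)
        have "Nrm phi \<beta> (dtil3 J t u s) \<le> Nrm phi \<beta> (dtil3 (Jn n) t u s) + (Nrm phi \<beta> (\<lambda>\<xi>. Jn n t s \<xi> - J t s \<xi>) +
           (Nrm phi \<beta> (\<lambda>\<xi>. Jn n t u \<xi> - J t u \<xi>) + Nrm phi \<beta> (\<lambda>\<xi>. Jn n u s \<xi> - J u s \<xi>)))"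
          unfolding eq using st dL
          by (intro Nrm_diff_le Nrm_add_le Nrm_exp_le_bound Lb_add Lb_exp Lb_diff JnL JL order_refl) auto
        also have "\<dots> \<le> R n"
          unfolding R_def Jn_def
          by (intro add_right_mono Nrm_dtil3_RS[OF BL dB C \<mu> st])
        finally show ?thesis .
      qed
      moreover have "R \<longlonglongrightarrow> 0 + (0 + (0 + 0))"
        unfolding R_def using J[of s t] J[of u t] J[of s u] st
        by (intro tendsto_add summable_LIMSEQ_zero[OF sm]) auto
      ultimately have "Nrm phi \<beta> (dtil3 J t u s) \<le> 0"
        by (auto intro!: LIMSEQ_le_const)
      then show ?thesis by (simp add: order_antisym)
    qed
  qed
qed

section \<open>Joint continuity in the two times\<close>

text \<open>Sequential form of continuity on the simplex, which is what dominated convergence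
  delivers. If the \<epsilon>-\<delta> form failed, bad points at distance below 1/(n+1) would form
  a contradicting sequence.\<close>

lemma C2_I:
  assumes L: "\<And>s t. a \<le> s \<Longrightarrow> s \<le> t \<Longrightarrow> t \<le> b \<Longrightarrow> B t s \<in> Lb phi \<beta>"
    and lim: "\<And>s t S U. a \<le> s \<Longrightarrow> s \<le> t \<Longrightarrow> t \<le> b \<Longrightarrow> (\<And>n. a \<le> S n \<and> S n \<le> U n \<and> U n \<le> b) \<Longrightarrow>
       S \<longlonglongrightarrow> s \<Longrightarrow> U \<longlonglongrightarrow> t \<Longrightarrow> (\<lambda>n. Nrm phi \<beta> (\<lambda>\<xi>. B (U n) (S n) \<xi> - B t s \<xi>)) \<longlonglongrightarrow> 0"
  shows "C2 phi \<beta> a b B"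
  unfolding C2_def
proof (intro conjI allI impI)
  fix s t and e :: real assume st: "a \<le> s \<and> s \<le> t \<and> t \<le> b" and e: "0 < e"
  show "\<exists>d>0. \<forall>s' t'. a \<le> s' \<and> s' \<le> t' \<and> t' \<le> b \<and> \<bar>s' - s\<bar> < d \<and> \<bar>t' - t\<bar> < d \<longrightarrow>
         Nrm phi \<beta> (\<lambda>\<xi>. B t' s' \<xi> - B t s \<xi>) < e"
  proof (rule ccontr)
    assume neg: "\<not> ?thesis"
    have "\<exists>s' t'. a \<le> s' \<and> s' \<le> t' \<and> t' \<le> b \<and> \<bar>s' - s\<bar> < inverse (real (Suc n)) \<and>
        \<bar>t' - t\<bar> < inverse (real (Suc n)) \<and> e \<le> Nrm phi \<beta> (\<lambda>\<xi>. B t' s' \<xi> - B t s \<xi>)" for n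
    proof (rule ccontr)
      assume no: "\<not> ?thesis"
      have "Nrm phi \<beta> (\<lambda>\<xi>. B t' s' \<xi> - B t s \<xi>) < e"
        if "a \<le> s' \<and> s' \<le> t' \<and> t' \<le> b \<and> \<bar>s' - s\<bar> < inverse (real (Suc n)) \<and>
          \<bar>t' - t\<bar> < inverse (real (Suc n))" for s' t'
        using no that not_le by blast
      moreover have "0 < inverse (real (Suc n))" by simp
      ultimately have "\<exists>d>0. \<forall>s' t'. a \<le> s' \<and> s' \<le> t' \<and> t' \<le> b \<and> \<bar>s' - s\<bar> < d \<and> \<bar>t' - t\<bar> < d \<longrightarrow>
         Nrm phi \<beta> (\<lambda>\<xi>. B t' s' \<xi> - B t s \<xi>) < e"
        by blast
      with neg show False by blast
    qed
    from choice[OF allI, OF this] obtain S where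
      "\<forall>n. \<exists>t'. a \<le> S n \<and> S n \<le> t' \<and> t' \<le> b \<and> \<bar>S n - s\<bar> < inverse (real (Suc n)) \<and>
        \<bar>t' - t\<bar> < inverse (real (Suc n)) \<and> e \<le> Nrm phi \<beta> (\<lambda>\<xi>. B t' (S n) \<xi> - B t s \<xi>)" ..
    from choice[OF this] obtain U where SU: "\<forall>n. a \<le> S n \<and> S n \<le> U n \<and> U n \<le> b \<and>
        \<bar>S n - s\<bar> < inverse (real (Suc n)) \<and> \<bar>U n - t\<bar> < inverse (real (Suc n)) \<and>
        e \<le> Nrm phi \<beta> (\<lambda>\<xi>. B (U n) (S n) \<xi> - B t s \<xi>)"
      ..
    have "(\<lambda>n. S n - s) \<longlonglongrightarrow> 0" "(\<lambda>n. U n - t) \<longlonglongrightarrow> 0"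
      by (rule Lim_null_comparison[OF always_eventually LIMSEQ_inverse_real_of_nat],
          use SU in \<open>simp add: less_imp_le del: of_nat_Suc\<close>)+
    then have "S \<longlonglongrightarrow> s" "U \<longlonglongrightarrow> t" by (simp_all add: LIM_zero_iff)
    then have "(\<lambda>n. Nrm phi \<beta> (\<lambda>\<xi>. B (U n) (S n) \<xi> - B t s \<xi>)) \<longlonglongrightarrow> 0"
      using st SU by (intro lim) auto
    from order_tendstoD(2)[OF this e] show False
      using SU by (auto simp: eventually_sequentially not_less[symmetric])
  qed
qed (use L in auto)

lemma C2_Lb: "C2 phi \<beta> a b B \<Longrightarrow> a \<le> s \<Longrightarrow> s \<le> t \<Longrightarrow> t \<le> b \<Longrightarrow> B t s \<in> Lb phi \<beta>"
  by (simp add: C2_def)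

lemma C2_tendsto:
  assumes B: "C2 phi \<beta> a b B" and st: "a \<le> s" "s \<le> t" "t \<le> b"
    and SU: "\<And>n. a \<le> S n \<and> S n \<le> U n \<and> U n \<le> b" "S \<longlonglongrightarrow> s" "U \<longlonglongrightarrow> t"
  shows "(\<lambda>n. Nrm phi \<beta> (\<lambda>\<xi>. B (U n) (S n) \<xi> - B t s \<xi>)) \<longlonglongrightarrow> 0"
proof (rule order_tendstoI)
  fix e :: real assume "0 < e"
  with B st obtain d where d: "d > 0" "\<And>s' t'. a \<le> s' \<and> s' \<le> t' \<and> t' \<le> b \<and> \<bar>s' - s\<bar> < d \<and> \<bar>t' - t\<bar> < d \<Longrightarrow>
         Nrm phi \<beta> (\<lambda>\<xi>. B t' s' \<xi> - B t s \<xi>) < e"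
    unfolding C2_def by meson
  have "\<forall>\<^sub>F n in sequentially. \<bar>S n - s\<bar> < d" "\<forall>\<^sub>F n in sequentially. \<bar>U n - t\<bar> < d"
    using tendstoD[OF SU(2) d(1)] tendstoD[OF SU(3) d(1)] by (auto simp: dist_real_def)
  then show "\<forall>\<^sub>F n in sequentially. Nrm phi \<beta> (\<lambda>\<xi>. B (U n) (S n) \<xi> - B t s \<xi>) < e"
    by eventually_elim (use d(2) SU(1) in auto)
next
  fix e :: real assume "e < 0"
  then show "\<forall>\<^sub>F n in sequentially. e < Nrm phi \<beta> (\<lambda>\<xi>. B (U n) (S n) \<xi> - B t s \<xi>)"
    by (intro always_eventually allI) (auto intro: less_le_trans)
qed

lemma Nrm_tendsto_0:
  assumes "\<And>n. Nrm phi \<beta> (f n) \<le> r n" "r \<longlonglongrightarrow> 0"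
  shows "(\<lambda>n. Nrm phi \<beta> (f n)) \<longlonglongrightarrow> 0"
  by (rule tendsto_sandwich[OF always_eventually always_eventually tendsto_const assms(2)])
    (use assms(1) in auto)

lemma C2_add:
  fixes B B' :: "real \<Rightarrow> real \<Rightarrow> real \<Rightarrow> 'v::euclidean_space"
  assumes B: "C2 phi \<beta> a b B" and B': "C2 phi \<beta> a b B'"
  shows "C2 phi \<beta> a b (\<lambda>t s \<xi>. B t s \<xi> + B' t s \<xi>)"
proof (rule C2_I)
  fix s t S U assume st: "a \<le> s" "s \<le> t" "t \<le> b"
    and SU: "\<And>n. a \<le> S n \<and> S n \<le> U n \<and> U n \<le> b" "S \<longlonglongrightarrow> s" "U \<longlonglongrightarrow> t"
  have eq: "B (U n) (S n) \<xi> + B' (U n) (S n) \<xi> - (B t s \<xi> + B' t s \<xi>) =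
      (B (U n) (S n) \<xi> - B t s \<xi>) + (B' (U n) (S n) \<xi> - B' t s \<xi>)" for n \<xi> by simp
  show "(\<lambda>n. Nrm phi \<beta> (\<lambda>\<xi>. B (U n) (S n) \<xi> + B' (U n) (S n) \<xi> - (B t s \<xi> + B' t s \<xi>))) \<longlonglongrightarrow> 0"
    unfolding eq
  proof (rule Nrm_tendsto_0)
    show "Nrm phi \<beta> (\<lambda>\<xi>. (B (U n) (S n) \<xi> - B t s \<xi>) + (B' (U n) (S n) \<xi> - B' t s \<xi>)) \<le>
      Nrm phi \<beta> (\<lambda>\<xi>. B (U n) (S n) \<xi> - B t s \<xi>) + Nrm phi \<beta> (\<lambda>\<xi>. B' (U n) (S n) \<xi> - B' t s \<xi>)" for n
      using st SU(1)[of n] by (intro Nrm_triangle Lb_diff C2_Lb[OF B] C2_Lb[OF B']) auto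
    show "(\<lambda>n. Nrm phi \<beta> (\<lambda>\<xi>. B (U n) (S n) \<xi> - B t s \<xi>) + Nrm phi \<beta> (\<lambda>\<xi>. B' (U n) (S n) \<xi> - B' t s \<xi>)) \<longlonglongrightarrow> 0"
      using tendsto_add[OF C2_tendsto[OF B st SU] C2_tendsto[OF B' st SU]] by simp
  qed
qed (intro Lb_add C2_Lb[OF B] C2_Lb[OF B'])

lemma C2_uminus:
  fixes B :: "real \<Rightarrow> real \<Rightarrow> real \<Rightarrow> 'v::euclidean_space"
  assumes B: "C2 phi \<beta> a b B"
  shows "C2 phi \<beta> a b (\<lambda>t s \<xi>. - B t s \<xi>)"
proof -
  have "Nrm phi \<beta> (\<lambda>\<xi>. - B t' s' \<xi> - - B t s \<xi>) = Nrm phi \<beta> (\<lambda>\<xi>. B t' s' \<xi> - B t s \<xi>)" for t' s' t s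
    using Nrm_minus_commute[of "B t s" "B t' s'"] by simp
  then show ?thesis using B by (auto simp only: C2_def intro!: Lb_uminus)
qed

text \<open>Writing \<open>J\<^sub>t\<^sub>s = I\<^sub>t - e\<^bsup>-\<xi>(t-s)\<^esup> I\<^sub>s\<close> with \<open>I\<^sub>t = J\<^sub>t\<^sub>a\<close> reduces joint continuity to that of the path \<open>I\<close>.
  To get left continuity of \<open>I\<close> at \<open>t\<close>, both \<open>I\<^sub>t\<close> and nearby values are compared with the fixed function
  \<open>I\<close> at a time slightly before \<open>t\<close>.\<close>

lemma C2_of_additive:
  fixes J :: "real \<Rightarrow> real \<Rightarrow> real \<Rightarrow> 'v::euclidean_space"
  assumes JL: "\<And>s t. a \<le> s \<Longrightarrow> s \<le> t \<Longrightarrow> t \<le> b \<Longrightarrow> J t s \<in> Lb phi \<beta>"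
    and dJ: "\<And>s u t. a \<le> s \<Longrightarrow> s \<le> u \<Longrightarrow> u \<le> t \<Longrightarrow> t \<le> b \<Longrightarrow> Nrm phi \<beta> (dtil3 J t u s) = 0"
    and JC: "\<And>s t. a \<le> s \<Longrightarrow> s \<le> t \<Longrightarrow> t \<le> b \<Longrightarrow> Nrm phi \<beta> (J t s) \<le> C * (t - s) powr \<alpha>"
    and C: "0 \<le> C" and \<alpha>: "0 < \<alpha>"
  shows "C2 phi \<beta> a b J"
proof (rule C2_I)
  show "J t s \<in> Lb phi \<beta>" if "a \<le> s" "s \<le> t" "t \<le> b" for s t by (rule JL[OF that])
  have dL: "dtil3 J t s a \<in> Lb phi \<beta>" if "a \<le> s" "s \<le> t" "t \<le> b" for s t
    using that by (intro dtil3_Lb[OF JL]) auto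
  have d0: "Nrm phi \<beta> (dtil3 J t s a) \<le> 0" if "a \<le> s" "s \<le> t" "t \<le> b" for s t
    using that dJ[of a s t] by simp
  have path: "(\<lambda>n. Nrm phi \<beta> (\<lambda>\<xi>. J (V n) a \<xi> - J t a \<xi>)) \<longlonglongrightarrow> 0"
    if t: "a \<le> t" "t \<le> b" and V: "\<And>n. a \<le> V n \<and> V n \<le> b" "V \<longlonglongrightarrow> t" for t V
  proof (rule order_tendstoI)
    fix e :: real assume e: "0 < e"
    \<comment> \<open>Chosen so that \<open>J\<close> over any interval of length at most \<eta> has
      norm below \<open>e / 3\<close>; the \<open>+ 1\<close> covers \<open>C = 0\<close> and makes
      the inequality strict.\<close>
    define \<eta> where "\<eta> = (e / (3 * (C + 1))) powr (1 / \<alpha>)"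
    have \<eta>: "0 < \<eta>" using e C by (simp add: \<eta>_def)
    have "\<eta> powr \<alpha> = e / (3 * (C + 1))" using e C \<alpha> by (simp add: \<eta>_def powr_powr)
    then have C\<eta>: "C * \<eta> powr \<alpha> < e / 3" using e C \<eta> by (simp add: field_simps) (smt (verit) powr_gt_zero)
    \<comment> \<open>Times within \<open>\<eta> / 2\<close> of \<open>t\<close> are at least
      \<open>w\<close> and at distance at most \<eta> from it, on either side of \<open>t\<close>;
      the maximum keeps \<open>w\<close> inside the interval.\<close>
    define w where "w = max a (t - \<eta> / 2)"
    have w: "a \<le> w" "w \<le> t" using t \<eta> by (auto simp: w_def)
    have Jw: "Nrm phi \<beta> (J v w) \<le> e / 3" if "w \<le> v" "v \<le> b" "v - t < \<eta> / 2" for v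
    proof -
      have "v - w \<le> \<eta>" using that by (auto simp: w_def)
      then have "C * (v - w) powr \<alpha> \<le> C * \<eta> powr \<alpha>"
        using that \<alpha> C by (intro mult_left_mono powr_mono2) auto
      with JC[of w v] that w C\<eta> show ?thesis by linarith
    qed
    \<comment> \<open>The strong continuity lemma wants nonnegative times for every
      \<open>n\<close>, while \<open>V n\<close> exceeds \<open>w\<close> only eventually;
      truncation does not change the limit.\<close>
    define \<tau> where "\<tau> n = max 0 (V n - w)" for n
    have "\<tau> \<longlonglongrightarrow> max 0 (t - w)" unfolding \<tau>_def by (intro tendsto_intros V)
    then have \<tau>: "\<tau> \<longlonglongrightarrow> t - w" using w by simp
    have "J w a \<in> Lb phi \<beta>" using w t by (intro JL) auto
    from Nrm_exp_tendsto[OF this _ \<tau>]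
    have "(\<lambda>n. Nrm phi \<beta> (\<lambda>\<xi>. exp (- \<xi> * \<tau> n) *\<^sub>R J w a \<xi> - exp (- \<xi> * (t - w)) *\<^sub>R J w a \<xi>)) \<longlonglongrightarrow> 0"
      by (simp add: \<tau>_def)
    from order_tendstoD(2)[OF this, of "e / 3"] e
    have "\<forall>\<^sub>F n in sequentially. Nrm phi \<beta> (\<lambda>\<xi>. exp (- \<xi> * \<tau> n) *\<^sub>R J w a \<xi> - exp (- \<xi> * (t - w)) *\<^sub>R J w a \<xi>) < e / 3"
      by simp
    moreover have "\<forall>\<^sub>F n in sequentially. \<bar>V n - t\<bar> < \<eta> / 2"
      using tendstoD[OF V(2), of "\<eta> / 2"] \<eta> by (simp add: dist_real_def)
    ultimately show "\<forall>\<^sub>F n in sequentially. Nrm phi \<beta> (\<lambda>\<xi>. J (V n) a \<xi> - J t a \<xi>) < e"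
    proof eventually_elim
      case (elim n)
      have Vw: "w \<le> V n" using elim(2) V(1)[of n] unfolding w_def abs_less_iff by simp
      then have \<tau>n: "\<tau> n = V n - w" by (simp add: \<tau>_def)
      have eq: "J (V n) a \<xi> - J t a \<xi> =
        ((exp (- \<xi> * (V n - w)) *\<^sub>R J w a \<xi> - exp (- \<xi> * (t - w)) *\<^sub>R J w a \<xi>) + (J (V n) w \<xi> - J t w \<xi>)) +
        (dtil3 J (V n) w a \<xi> - dtil3 J t w a \<xi>)" for \<xi>
        by (simp add: dtil3_def)
      have "Nrm phi \<beta> (\<lambda>\<xi>. J (V n) a \<xi> - J t a \<xi>) \<le>
         (Nrm phi \<beta> (\<lambda>\<xi>. exp (- \<xi> * \<tau> n) *\<^sub>R J w a \<xi> - exp (- \<xi> * (t - w)) *\<^sub>R J w a \<xi>) + (e / 3 + e / 3)) + (0 + 0)"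
        unfolding eq \<tau>n using Vw w t V(1)[of n] elim(2)[unfolded abs_less_iff] \<eta>
        by (intro Nrm_add_le Nrm_diff_le Lb_add Lb_diff Lb_exp JL dL d0 Jw order_refl) auto
      with elim(1) show ?case by simp
    qed
  next
    fix e :: real assume "e < 0"
    then show "\<forall>\<^sub>F n in sequentially. e < Nrm phi \<beta> (\<lambda>\<xi>. J (V n) a \<xi> - J t a \<xi>)"
      by (intro always_eventually allI) (auto intro: less_le_trans)
  qed
  fix s t S U assume st: "a \<le> s" "s \<le> t" "t \<le> b"
    and SU: "\<And>n. a \<le> S n \<and> S n \<le> U n \<and> U n \<le> b" "S \<longlonglongrightarrow> s" "U \<longlonglongrightarrow> t"
  have eq: "J (U n) (S n) \<xi> - J t s \<xi> = ((J (U n) a \<xi> - J t a \<xi>) -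
     (exp (- \<xi> * (U n - S n)) *\<^sub>R (J (S n) a \<xi> - J s a \<xi>) +
      (exp (- \<xi> * (U n - S n)) *\<^sub>R J s a \<xi> - exp (- \<xi> * (t - s)) *\<^sub>R J s a \<xi>))) -
     (dtil3 J (U n) (S n) a \<xi> - dtil3 J t s a \<xi>)" for n \<xi>
    by (simp add: dtil3_def scaleR_diff_right)
  have bnd: "Nrm phi \<beta> (\<lambda>\<xi>. J (U n) (S n) \<xi> - J t s \<xi>) \<le> (Nrm phi \<beta> (\<lambda>\<xi>. J (U n) a \<xi> - J t a \<xi>) +
     (Nrm phi \<beta> (\<lambda>\<xi>. J (S n) a \<xi> - J s a \<xi>) +
      Nrm phi \<beta> (\<lambda>\<xi>. exp (- \<xi> * (U n - S n)) *\<^sub>R J s a \<xi> - exp (- \<xi> * (t - s)) *\<^sub>R J s a \<xi>))) + (0 + 0)" for n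
    unfolding eq using st SU(1)[of n]
    by (intro Nrm_diff_le Nrm_add_le Nrm_exp_le_bound Lb_add Lb_diff Lb_exp JL dL d0 order_refl) auto
  have ab: "\<And>n. a \<le> U n \<and> U n \<le> b" "\<And>n. a \<le> S n \<and> S n \<le> b"
    using SU(1) by (auto intro: order_trans)
  have lim: "(\<lambda>n. Nrm phi \<beta> (\<lambda>\<xi>. exp (- \<xi> * (U n - S n)) *\<^sub>R J s a \<xi> - exp (- \<xi> * (t - s)) *\<^sub>R J s a \<xi>)) \<longlonglongrightarrow> 0"
    using st SU by (intro Nrm_exp_tendsto JL tendsto_intros) auto
  have "(\<lambda>n. (Nrm phi \<beta> (\<lambda>\<xi>. J (U n) a \<xi> - J t a \<xi>) +
     (Nrm phi \<beta> (\<lambda>\<xi>. J (S n) a \<xi> - J s a \<xi>) +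
      Nrm phi \<beta> (\<lambda>\<xi>. exp (- \<xi> * (U n - S n)) *\<^sub>R J s a \<xi> - exp (- \<xi> * (t - s)) *\<^sub>R J s a \<xi>))) + (0 + 0)) \<longlonglongrightarrow> (0 + (0 + 0)) + (0 + 0)"
    using st by (intro tendsto_add tendsto_const path lim ab SU) auto
  then show "(\<lambda>n. Nrm phi \<beta> (\<lambda>\<xi>. J (U n) (S n) \<xi> - J t s \<xi>)) \<longlonglongrightarrow> 0"
    by (intro Nrm_tendsto_0[OF bnd]) simp
qed

section \<open>Existence and uniqueness of the sewing map, and Riemann sums\<close>

lemma C2hol_I:
  assumes "C2 phi \<beta> a b B"
    and "\<And>s t. a \<le> s \<Longrightarrow> s < t \<Longrightarrow> t \<le> b \<Longrightarrow> Nrm phi \<beta> (B t s) \<le> K * (t - s) powr \<mu>"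
  shows "C2hol phi \<beta> \<mu> a b B"
  unfolding C2hol_def
proof (intro conjI bdd_aboveI[of _ K])
  show "x \<le> K" if x: "x \<in> {Nrm phi \<beta> (B t s) / (t - s) powr \<mu> |s t. a \<le> s \<and> s < t \<and> t \<le> b}" for x
    using x assms(2) by (auto simp: divide_le_eq)
qed fact

text \<open>The witness is \<open>max 0\<close> of the supremum: if there is no pair
  \<open>s < t\<close>, the supremum is over the empty set and its sign is unknown.\<close>

lemma C2hol_bound:
  assumes "C2hol phi \<beta> \<mu> a b B"
  obtains K where "0 \<le> K"
    "\<And>s t. a \<le> s \<Longrightarrow> s < t \<Longrightarrow> t \<le> b \<Longrightarrow> Nrm phi \<beta> (B t s) \<le> K * (t - s) powr \<mu>"
proof -
  define X where "X = {Nrm phi \<beta> (B t s) / (t - s) powr \<mu> |s t. a \<le> s \<and> s < t \<and> t \<le> b}"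
  have X: "bdd_above X" using assms by (simp only: C2hol_def X_def)
  show thesis
  proof
    fix s t assume st: "a \<le> s" "s < t" "t \<le> b"
    then have "Nrm phi \<beta> (B t s) / (t - s) powr \<mu> \<in> X" unfolding X_def by blast
    then have "Nrm phi \<beta> (B t s) / (t - s) powr \<mu> \<le> max 0 (Sup X)"
      by (rule order_trans[OF cSup_upper[OF _ X]]) simp
    with st show "Nrm phi \<beta> (B t s) \<le> max 0 (Sup X) * (t - s) powr \<mu>"
      by (simp add: divide_le_eq)
  qed simp
qed

text \<open>Halving the interval improves any bound \<open>M / (1 - q) + c\<close> to \<open>M / (1 - q) + q c\<close>, where
  \<open>q = 2\<^bsup>1-\<mu>\<^esup> < 1\<close>, so the a priori constant disappears.\<close>

lemma sewing_apriori:
  fixes A :: "real \<Rightarrow> real \<Rightarrow> real \<Rightarrow> 'v::euclidean_space"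
  assumes AL: "\<And>s t. a \<le> s \<Longrightarrow> s \<le> t \<Longrightarrow> t \<le> b \<Longrightarrow> A t s \<in> Lb phi \<beta>"
    and AK: "\<And>s t. a \<le> s \<Longrightarrow> s < t \<Longrightarrow> t \<le> b \<Longrightarrow> Nrm phi \<beta> (A t s) \<le> K * (t - s) powr \<mu>"
    and dA: "\<And>s u t. a \<le> s \<Longrightarrow> s \<le> u \<Longrightarrow> u \<le> t \<Longrightarrow> t \<le> b \<Longrightarrow>
        Nrm phi \<beta> (dtil3 A t u s) \<le> M * (t - s) powr \<mu>"
    and M: "0 \<le> M" and \<mu>: "1 < \<mu>" and st: "a \<le> s" "s \<le> t" "t \<le> b"
  shows "Nrm phi \<beta> (A t s) \<le> M / (1 - 2 powr (1 - \<mu>)) * (t - s) powr \<mu>"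
proof -
  define q where "q = 2 powr (1 - \<mu>)"
  have q: "0 \<le> q" "q < 1" using \<mu> by (auto simp: q_def powr_less_one)
  \<comment> \<open>Fixed point of \<open>c \<mapsto> q * c + M\<close>, the effect of one bisection
    on an admissible constant. Starting at \<open>R + K\<close>, n bisections lead to
    \<open>R + q ^ n * K\<close>.\<close>
  define R where "R = M / (1 - q)"
  have R: "0 \<le> R" "q * R + M = R"
  proof -
    have "R * (1 - q) = M" using q by (simp add: R_def)
    then show "q * R + M = R" by (simp add: algebra_simps)
    show "0 \<le> R" using M q by (simp add: R_def)
  qed
  have bound: "Nrm phi \<beta> (A t s) \<le> (R + q ^ n * K) * (t - s) powr \<mu>"
    if "a \<le> s" "s \<le> t" "t \<le> b" for n s t
    using that
  proof (induction n arbitrary: s t)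
    case 0
    show ?case
    proof (cases "s = t")
      case True
      with 0 dA[of s s s] show ?thesis by (simp add: Nrm_dtil3_diag)
    next
      case False
      have "K * (t - s) powr \<mu> \<le> (R + q ^ 0 * K) * (t - s) powr \<mu>"
        using R by (intro mult_right_mono) auto
      with 0 False show ?thesis by (intro order_trans[OF AK]) auto
    qed
  next
    case (Suc n)
    define u where "u = (s + t) / 2"
    have u: "s \<le> u" "u \<le> t" "t - u = (t - s) / 2" "u - s = (t - s) / 2"
      using Suc.prems by (auto simp: u_def field_simps)
    have half: "2 * ((t - s) / 2) powr \<mu> = q * (t - s) powr \<mu>"
      using Suc.prems by (simp add: powr_divide powr_diff q_def)
    have eq: "A t s \<xi> = (A t u \<xi> + exp (- \<xi> * (t - u)) *\<^sub>R A u s \<xi>) + dtil3 A t u s \<xi>" for \<xi>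
      by (simp add: dtil3_def)
    have dL: "dtil3 A t u s \<in> Lb phi \<beta>"
      using Suc.prems u by (intro dtil3_Lb[OF AL]) auto
    have "Nrm phi \<beta> (\<lambda>\<xi>. (A t u \<xi> + exp (- \<xi> * (t - u)) *\<^sub>R A u s \<xi>) + dtil3 A t u s \<xi>) \<le>
       ((R + q ^ n * K) * (t - u) powr \<mu> + (R + q ^ n * K) * (u - s) powr \<mu>) + M * (t - s) powr \<mu>"
      using Suc.prems u(1,2)
      by (intro Nrm_add_le Nrm_exp_le_bound Lb_add Lb_exp AL Suc.IH dA dL) auto
    also have "\<dots> = (R + q ^ n * K) * (2 * ((t - s) / 2) powr \<mu>) + M * (t - s) powr \<mu>"
      unfolding u by (simp add: algebra_simps)
    also have "\<dots> = ((q * R + M) + q ^ Suc n * K) * (t - s) powr \<mu>"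
      unfolding half by (simp add: algebra_simps)
    finally show ?case unfolding eq[symmetric] R(2) .
  qed
  have "(\<lambda>n. (R + q ^ n * K) * (t - s) powr \<mu>) \<longlonglongrightarrow> (R + 0 * K) * (t - s) powr \<mu>"
    using q by (intro tendsto_intros LIMSEQ_power_zero) auto
  then have "Nrm phi \<beta> (A t s) \<le> (R + 0 * K) * (t - s) powr \<mu>"
    by (rule LIMSEQ_le_const) (use bound[OF st] in auto)
  then show ?thesis by (simp add: R_def q_def)
qed

text \<open>The witness is \<open>B - J\<close> with \<open>J\<close> the additive map close to
  \<open>B\<close>: subtracting \<open>J\<close> leaves the increment unchanged in norm and improves
  the order from \<alpha> to \<mu>. The bound on \<open>B\<close> itself serves only the continuity
  of \<open>J\<close>.\<close>

lemma sewing_map_exists: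
  fixes B :: "real \<Rightarrow> real \<Rightarrow> real \<Rightarrow> 'v::euclidean_space"
  assumes B: "C2 phi \<beta> a b B"
    and Bb: "\<And>s t. a \<le> s \<Longrightarrow> s \<le> t \<Longrightarrow> t \<le> b \<Longrightarrow> Nrm phi \<beta> (B t s) \<le> D * (t - s) powr \<alpha>"
    and dB: "\<And>s u t. a \<le> s \<Longrightarrow> s \<le> u \<Longrightarrow> u \<le> t \<Longrightarrow> t \<le> b \<Longrightarrow>
        Nrm phi \<beta> (dtil3 B t u s) \<le> C * (t - s) powr \<mu>"
    and C: "0 \<le> C" "0 \<le> D" and \<mu>: "1 < \<mu>" "0 < \<alpha>" "\<alpha> \<le> \<mu>"
  shows "\<exists>A. C2hol phi \<beta> \<mu> a b A \<and> (\<forall>s u t. a \<le> s \<and> s \<le> u \<and> u \<le> t \<and> t \<le> b \<longrightarrow>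
      Leq phi \<beta> (dtil3 A t u s) (dtil3 B t u s))"
proof -
  note BL = C2_Lb[OF B]
  define K where "K = 2 * C / (1 - 2 powr (1 - \<mu>))"
  have K: "0 \<le> K" using C \<mu> by (simp add: K_def powr_less_one less_imp_le)
  obtain J where J: "\<And>s t. a \<le> s \<Longrightarrow> s \<le> t \<Longrightarrow> t \<le> b \<Longrightarrow> J t s \<in> Lb phi \<beta>"
    "\<And>s u t. a \<le> s \<Longrightarrow> s \<le> u \<Longrightarrow> u \<le> t \<Longrightarrow> t \<le> b \<Longrightarrow> Nrm phi \<beta> (dtil3 J t u s) = 0"
    "\<And>s t. a \<le> s \<Longrightarrow> s \<le> t \<Longrightarrow> t \<le> b \<Longrightarrow> Nrm phi \<beta> (\<lambda>\<xi>. J t s \<xi> - B t s \<xi>) \<le> K * (t - s) powr \<mu>"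
    using sewing[OF BL dB C(1) \<mu>(1), folded K_def] by blast
  have "C2 phi \<beta> a b J"
  proof (rule C2_of_additive[OF J(1,2)])
    fix s t assume st: "a \<le> s" "s \<le> t" "t \<le> b"
    have "Nrm phi \<beta> (\<lambda>\<xi>. (J t s \<xi> - B t s \<xi>) + B t s \<xi>) \<le> K * (t - s) powr \<mu> + D * (t - s) powr \<alpha>"
      using st by (intro Nrm_add_le Lb_diff J BL Bb)
    \<comment> \<open>On a bounded interval the higher power is dominated by the lower one, so that
      \<open>J\<close> has a bound with the single exponent \<alpha>.\<close>
    moreover have "(t - s) powr \<mu> \<le> (b - a) powr (\<mu> - \<alpha>) * (t - s) powr \<alpha>"
    proof -
      have "(t - s) powr \<mu> = (t - s) powr (\<mu> - \<alpha>) * (t - s) powr \<alpha>"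
        by (simp flip: powr_add)
      also have "\<dots> \<le> (b - a) powr (\<mu> - \<alpha>) * (t - s) powr \<alpha>"
        using st \<mu> by (intro mult_right_mono powr_mono2) auto
      finally show ?thesis .
    qed
    then have "K * (t - s) powr \<mu> \<le> K * ((b - a) powr (\<mu> - \<alpha>) * (t - s) powr \<alpha>)"
      using K by (rule mult_left_mono)
    ultimately show "Nrm phi \<beta> (J t s) \<le> (K * (b - a) powr (\<mu> - \<alpha>) + D) * (t - s) powr \<alpha>"
      by (simp add: algebra_simps)
  qed (use K C \<mu> in auto)
  from C2_add[OF B C2_uminus[OF this]]
  have A2: "C2 phi \<beta> a b (\<lambda>t s \<xi>. B t s \<xi> - J t s \<xi>)" by simp
  have "C2hol phi \<beta> \<mu> a b (\<lambda>t s \<xi>. B t s \<xi> - J t s \<xi>)"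
    by (rule C2hol_I[OF A2, of K], subst Nrm_minus_commute, rule J(3)) auto
  moreover have "Leq phi \<beta> (dtil3 (\<lambda>t s \<xi>. B t s \<xi> - J t s \<xi>) t u s) (dtil3 B t u s)"
    if st: "a \<le> s" "s \<le> u" "u \<le> t" "t \<le> b" for s u t
  proof -
    have "dtil3 (\<lambda>t s \<xi>. B t s \<xi> - J t s \<xi>) t u s \<xi> - dtil3 B t u s \<xi> = - dtil3 J t u s \<xi>" for \<xi>
      by (simp add: dtil3_def scaleR_diff_right)
    then show ?thesis
      using J(2)[OF st] dtil3_Lb[OF J(1) st] by (simp add: Leq_def Lb_uminus)
  qed
  ultimately show ?thesis by blast
qed

text \<open>The difference of two solutions has increment of norm zero and still some bound of order
  \<mu>, so the a priori estimate applies with \<open>M = 0\<close>.\<close>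

lemma sewing_unique:
  fixes A A' :: "real \<Rightarrow> real \<Rightarrow> real \<Rightarrow> 'v::euclidean_space"
  assumes A: "C2hol phi \<beta> \<mu> a b A" and A': "C2hol phi \<beta> \<mu> a b A'" and \<mu>: "1 < \<mu>"
    and dA: "\<And>s u t. a \<le> s \<Longrightarrow> s \<le> u \<Longrightarrow> u \<le> t \<Longrightarrow> t \<le> b \<Longrightarrow> Leq phi \<beta> (dtil3 A t u s) (h t u s)"
    and dA': "\<And>s u t. a \<le> s \<Longrightarrow> s \<le> u \<Longrightarrow> u \<le> t \<Longrightarrow> t \<le> b \<Longrightarrow> Leq phi \<beta> (dtil3 A' t u s) (h t u s)"
    and st: "a \<le> s" "s \<le> t" "t \<le> b"
  shows "Leq phi \<beta> (A t s) (A' t s)"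
proof -
  note AL = C2_Lb[of a b A] C2_Lb[of a b A']
  have C2: "C2 phi \<beta> a b A" "C2 phi \<beta> a b A'" using A A' by (auto simp: C2hol_def)
  obtain K where "0 \<le> K" and K: "\<And>s t. a \<le> s \<Longrightarrow> s < t \<Longrightarrow> t \<le> b \<Longrightarrow> Nrm phi \<beta> (A t s) \<le> K * (t - s) powr \<mu>"
    using C2hol_bound[OF A] by blast
  obtain K' where "0 \<le> K'" and K': "\<And>s t. a \<le> s \<Longrightarrow> s < t \<Longrightarrow> t \<le> b \<Longrightarrow> Nrm phi \<beta> (A' t s) \<le> K' * (t - s) powr \<mu>"
    using C2hol_bound[OF A'] by blast
  have "Nrm phi \<beta> (\<lambda>\<xi>. A t s \<xi> - A' t s \<xi>) \<le> 0 / (1 - 2 powr (1 - \<mu>)) * (t - s) powr \<mu>"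
  proof (rule sewing_apriori[of a b "\<lambda>t s \<xi>. A t s \<xi> - A' t s \<xi>" "K + K'"])
    show "(\<lambda>\<xi>. A t s \<xi> - A' t s \<xi>) \<in> Lb phi \<beta>" if "a \<le> s" "s \<le> t" "t \<le> b" for s t
      using that by (intro Lb_diff AL C2)
    show "Nrm phi \<beta> (\<lambda>\<xi>. A t s \<xi> - A' t s \<xi>) \<le> (K + K') * (t - s) powr \<mu>"
      if "a \<le> s" "s < t" "t \<le> b" for s t
      unfolding distrib_right using that by (intro Nrm_diff_le AL C2 K K') auto
    show "Nrm phi \<beta> (dtil3 (\<lambda>t s \<xi>. A t s \<xi> - A' t s \<xi>) t u s) \<le> 0 * (t - s) powr \<mu>"
      if "a \<le> s" "s \<le> u" "u \<le> t" "t \<le> b" for s u t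
    proof -
      have eq: "dtil3 (\<lambda>t s \<xi>. A t s \<xi> - A' t s \<xi>) t u s =
          (\<lambda>\<xi>. (dtil3 A t u s \<xi> - h t u s \<xi>) - (dtil3 A' t u s \<xi> - h t u s \<xi>))"
        by (simp add: dtil3_def fun_eq_iff scaleR_diff_right)
      have "Nrm phi \<beta> (dtil3 (\<lambda>t s \<xi>. A t s \<xi> - A' t s \<xi>) t u s) \<le> 0 + 0"
        unfolding eq using dA[OF that] dA'[OF that] by (intro Nrm_diff_le) (auto simp: Leq_def)
      then show ?thesis by simp
    qed
  qed (use \<mu> st in auto)
  then show ?thesis
    using st by (auto simp: Leq_def order_antisym intro!: Lb_diff AL C2)
qed

text \<open>An additive \<open>J\<close> equals its own Riemann sum, so the error is a sum of
  transported differences \<open>J - B\<close> over the cells, each of superlinear order.\<close>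

lemma Nrm_Riemann_sum:
  fixes J :: "real \<Rightarrow> real \<Rightarrow> real \<Rightarrow> 'v::euclidean_space"
  assumes JL: "\<And>s t. a \<le> s \<Longrightarrow> s \<le> t \<Longrightarrow> t \<le> b \<Longrightarrow> J t s \<in> Lb phi \<beta>"
    and BL: "\<And>s t. a \<le> s \<Longrightarrow> s \<le> t \<Longrightarrow> t \<le> b \<Longrightarrow> B t s \<in> Lb phi \<beta>"
    and dJ: "\<And>s u t. a \<le> s \<Longrightarrow> s \<le> u \<Longrightarrow> u \<le> t \<Longrightarrow> t \<le> b \<Longrightarrow> Nrm phi \<beta> (dtil3 J t u s) = 0"
    and JB: "\<And>s t. a \<le> s \<Longrightarrow> s \<le> t \<Longrightarrow> t \<le> b \<Longrightarrow>
       Nrm phi \<beta> (\<lambda>\<xi>. J t s \<xi> - B t s \<xi>) \<le> K * (t - s) powr \<mu>"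
    and K: "0 \<le> K" and \<mu>: "1 < \<mu>"
    and p: "mono p" "\<And>k. a \<le> p k" "\<And>k. p k \<le> b" and d: "\<And>k. p (Suc k) - p k \<le> d"
  shows "Nrm phi \<beta> (\<lambda>\<xi>. J (p n) (p 0) \<xi> - RS B p 0 n \<xi>) \<le> K * d powr (\<mu> - 1) * (p n - p 0)"
proof -
  have mp: "p k \<le> p (Suc k)" for k using p(1) by (simp add: monoD)
  define X where "X k \<xi> = exp (- \<xi> * (p n - p (Suc k))) *\<^sub>R (J (p (Suc k)) (p k) \<xi> - B (p (Suc k)) (p k) \<xi>)" for k \<xi>
  have X: "X k \<in> Lb phi \<beta> \<and> Nrm phi \<beta> (X k) \<le> K * d powr (\<mu> - 1) * (p (Suc k) - p k)" if "k < n" for k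
  proof
    have pn: "0 \<le> p n - p (Suc k)" using that monoD[OF p(1), of "Suc k" n] by simp
    show "X k \<in> Lb phi \<beta>"
      unfolding X_def[abs_def] by (intro Lb_exp Lb_diff JL BL p mp pn)
    have "Nrm phi \<beta> (X k) \<le> K * (p (Suc k) - p k) powr \<mu>"
      unfolding X_def[abs_def] by (intro Nrm_exp_le_bound Lb_diff JL BL p mp pn JB)
    \<comment> \<open>One power of the cell length is kept for telescoping; the remaining
      \<open>\<mu> - 1\<close> is bounded by the mesh and makes the sum small.\<close>
    also have "(p (Suc k) - p k) powr \<mu> = (p (Suc k) - p k) powr (\<mu> - 1) * (p (Suc k) - p k)"
      using mp[of k] powr_add[of "p (Suc k) - p k" "\<mu> - 1" 1] by simp
    also have "K * \<dots> \<le> K * (d powr (\<mu> - 1) * (p (Suc k) - p k))"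
      using mp[of k] d[of k] \<mu> K by (intro mult_left_mono mult_right_mono powr_mono2) auto
    finally show "Nrm phi \<beta> (X k) \<le> K * d powr (\<mu> - 1) * (p (Suc k) - p k)" by (simp add: mult.assoc)
  qed
  have eq: "J (p n) (p 0) \<xi> - RS B p 0 n \<xi> =
     (\<Sum>k<n. X k \<xi>) - (RS J p 0 n \<xi> - J (p n) (p 0) \<xi>)" for \<xi>
    by (simp add: RS_def X_def atLeast0LessThan scaleR_diff_right sum_subtractf)
  \<comment> \<open>The germ estimate for \<open>J\<close> with \<open>C = 0\<close> gives zero; any
    exponent above 1 would do in place of 2.\<close>
  have "Nrm phi \<beta> (\<lambda>\<xi>. RS J p 0 n \<xi> - J (p n) (p 0) \<xi>) \<le> 2 * 0 / (1 - 2 powr (1 - 2)) * (p n - p 0) powr 2"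
    by (rule RS_germ_bound[OF JL _ _ _ p]) (use dJ in auto)
  then have tele: "Nrm phi \<beta> (\<lambda>\<xi>. RS J p 0 n \<xi> - J (p n) (p 0) \<xi>) \<le> 0" by simp
  have XL: "(\<lambda>\<xi>. \<Sum>k<n. X k \<xi>) \<in> Lb phi \<beta> \<and>
      Nrm phi \<beta> (\<lambda>\<xi>. \<Sum>k<n. X k \<xi>) \<le> (\<Sum>k<n. Nrm phi \<beta> (X k))"
    using X by (intro Nrm_sum) auto
  have "(\<Sum>k<n. Nrm phi \<beta> (X k)) \<le> (\<Sum>k<n. K * d powr (\<mu> - 1) * (p (Suc k) - p k))"
    using X by (intro sum_mono) auto
  also have "\<dots> = K * d powr (\<mu> - 1) * (p n - p 0)"
    by (simp only: sum_distrib_left[symmetric] sum_lessThan_telescope)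
  finally have "Nrm phi \<beta> (\<lambda>\<xi>. \<Sum>k<n. X k \<xi>) \<le> K * d powr (\<mu> - 1) * (p n - p 0)"
    using XL by linarith
  then have "Nrm phi \<beta> (\<lambda>\<xi>. J (p n) (p 0) \<xi> - RS B p 0 n \<xi>) \<le> K * d powr (\<mu> - 1) * (p n - p 0) + 0"
    unfolding eq using XL p(2,3) monoD[OF p(1), of 0 n] tele
    by (intro Nrm_diff_le Lb_diff Lb_RS[OF JL p] JL) auto
  then show ?thesis by simp
qed

end

section \<open>The convolutional Young integral\<close>

text \<open>The product is a combination of the rows of \<open>A\<close>, and the norm of a nested
  vector is the Frobenius norm, so Cauchy-Schwarz applies with constant 1.\<close>

lemma norm_vector_matrix_mult_le:
  fixes x :: "real ^ 'd" and A :: "real ^ 'm ^ 'd"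
  shows "norm (x v* A) \<le> norm x * norm A"
proof -
  have "x v* A = (\<Sum>i\<in>UNIV. x $ i *\<^sub>R A $ i)"
    by (simp add: vec_eq_iff vector_matrix_mult_def)
  then have "norm (x v* A) \<le> (\<Sum>i\<in>UNIV. norm (x $ i *\<^sub>R A $ i))"
    by (simp only: norm_sum)
  also have "\<dots> = (\<Sum>i\<in>UNIV. \<bar>norm (x $ i)\<bar> * \<bar>norm (A $ i)\<bar>)"
    by simp
  also have "\<dots> \<le> norm x * norm A"
    unfolding norm_vec_def by (rule L2_set_mult_ineq)
  finally show ?thesis .
qed

lemma bounded_bilinear_vector_matrix_mult:
  "bounded_bilinear ((v*) :: real ^ 'd \<Rightarrow> real ^ 'm ^ 'd \<Rightarrow> real ^ 'm)"
proof
  show "\<exists>K. \<forall>(a :: real ^ 'd) (b :: real ^ 'm ^ 'd). norm (a v* b) \<le> norm a * norm b * K"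
    by (intro exI[of _ 1]) (simp add: norm_vector_matrix_mult_le)
qed (simp_all add: vector_matrix_left_distrib vector_matrix_mult_add_rdistrib
    scaleR_vector_matrix_assoc vector_scaleR_matrix_ac)

context measurable_weight
begin

lemma Lb_vector_matrix_mult:
  fixes f :: "real \<Rightarrow> real ^ 'd" and A :: "real ^ 'm ^ 'd"
  assumes f: "f \<in> Lb phi \<beta>"
  shows "(\<lambda>\<xi>. f \<xi> v* A) \<in> Lb phi \<beta>"
    and Nrm_vector_matrix_mult: "Nrm phi \<beta> (\<lambda>\<xi>. f \<xi> v* A) \<le> norm A * Nrm phi \<beta> f"
proof -
  have "continuous_on UNIV (\<lambda>x :: real ^ 'd. x v* A)"
    by (intro linear_continuous_on
        bounded_bilinear.bounded_linear_left[OF bounded_bilinear_vector_matrix_mult])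
  then have [measurable]: "(\<lambda>x :: real ^ 'd. x v* A) \<in> borel_measurable borel"
    by (rule borel_measurable_continuous_onI)
  have "(\<lambda>\<xi>. (indicator {0<..} \<xi> *\<^sub>R f \<xi>) v* A) \<in> borel_measurable borel"
    by (rule measurable_compose[OF Lb_measurable[OF f]]) measurable
  then have m: "(\<lambda>\<xi>. indicator {0<..} \<xi> *\<^sub>R (f \<xi> v* A)) \<in> borel_measurable borel"
    by (simp add: scaleR_vector_matrix_assoc)
  have le: "norm (f \<xi> v* A) \<le> norm A * norm (f \<xi>)" for \<xi>
    using norm_vector_matrix_mult_le[of "f \<xi>" A] by (simp add: mult.commute)
  show "(\<lambda>\<xi>. f \<xi> v* A) \<in> Lb phi \<beta>" by (rule Lb_scaled(1)[OF m f le])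
  show "Nrm phi \<beta> (\<lambda>\<xi>. f \<xi> v* A) \<le> norm A * Nrm phi \<beta> f" by (rule Lb_scaled(2)[OF m f le])
qed

lemma Nrm_vector_matrix_mult_bound:
  fixes f :: "real \<Rightarrow> real ^ 'd" and A :: "real ^ 'm ^ 'd"
  assumes f: "f \<in> Lb phi \<beta>" and "Nrm phi \<beta> f \<le> N" "norm A \<le> H" "0 \<le> H"
  shows "Nrm phi \<beta> (\<lambda>\<xi>. f \<xi> v* A) \<le> N * H"
proof -
  have "Nrm phi \<beta> (\<lambda>\<xi>. f \<xi> v* A) \<le> norm A * Nrm phi \<beta> f" by (rule Nrm_vector_matrix_mult[OF f])
  also have "\<dots> \<le> H * N" using assms by (intro mult_mono) auto
  finally show ?thesis by (simp add: mult.commute)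
qed

lemma Leq_trans:
  fixes f g h :: "real \<Rightarrow> 'v::euclidean_space"
  assumes "Leq phi \<beta> f g" "Leq phi \<beta> g h"
  shows "Leq phi \<beta> f h"
proof -
  have "Nrm phi \<beta> (\<lambda>\<xi>. (f \<xi> - g \<xi>) + (g \<xi> - h \<xi>)) \<le> 0 + 0"
    using assms unfolding Leq_def by (intro Nrm_add_le) auto
  moreover have "(\<lambda>\<xi>. (f \<xi> - g \<xi>) + (g \<xi> - h \<xi>)) \<in> Lb phi \<beta>"
    using assms unfolding Leq_def by (intro Lb_add) auto
  ultimately show ?thesis by (simp add: Leq_def order_antisym)
qed

lemma Leq_Nrm_le:
  fixes f g :: "real \<Rightarrow> 'v::euclidean_space"
  assumes "Leq phi \<beta> f g" "g \<in> Lb phi \<beta>"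
  shows "Nrm phi \<beta> f \<le> Nrm phi \<beta> g"
  using Nrm_add_le[of "\<lambda>\<xi>. f \<xi> - g \<xi>" g 0 "Nrm phi \<beta> g"] assms by (simp add: Leq_def)

text \<open>A limit in the weighted space and a pointwise limit of the same sequence coincide: some
  subsequence converges almost everywhere also to the former. Measurability and integrability of
  \<open>f - g\<close> come out of the argument.\<close>

lemma Leq_of_limits:
  fixes f g :: "real \<Rightarrow> 'v::euclidean_space"
  assumes f: "f \<in> Lb phi \<beta>" and r: "\<And>n. r n \<in> Lb phi \<beta>"
    and N: "(\<lambda>n. Nrm phi \<beta> (\<lambda>\<xi>. f \<xi> - r n \<xi>)) \<longlonglongrightarrow> 0"
    and lim: "\<And>\<xi>. 0 < \<xi> \<Longrightarrow> (\<lambda>n. r n \<xi>) \<longlonglongrightarrow> g \<xi>"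
  shows "Leq phi \<beta> f g"
proof -
  have "(\<lambda>\<xi>. indicator {0<..} \<xi> *\<^sub>R g \<xi>) \<in> borel_measurable borel"
  proof (rule borel_measurable_LIMSEQ_metric)
    show "(\<lambda>\<xi>. indicator {0<..} \<xi> *\<^sub>R r n \<xi>) \<in> borel_measurable borel" for n
      by (rule Lb_measurable[OF r])
    show "(\<lambda>n. indicator {0<..} \<xi> *\<^sub>R r n \<xi>) \<longlonglongrightarrow> indicator {0<..} \<xi> *\<^sub>R g \<xi>" for \<xi> :: real
      using lim[of \<xi>] by (cases "0 < \<xi>") auto
  qed
  then have m: "(\<lambda>\<xi>. indicator {0<..} \<xi> *\<^sub>R (f \<xi> - g \<xi>)) \<in> borel_measurable borel"
    using Lb_measurable[OF f] by (simp add: scaleR_diff_right)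
  have "integrable lborel (\<lambda>\<xi>. W \<xi> * norm (f \<xi> - r n \<xi>))" for n
    by (intro Lb_integrable Lb_diff f r)
  moreover have "(\<lambda>n. \<integral>\<xi>. norm (W \<xi> * norm (f \<xi> - r n \<xi>)) \<partial>lborel) \<longlonglongrightarrow> 0"
    using N by (simp add: Nrm_eq abs_mult)
  ultimately obtain k :: "nat \<Rightarrow> nat" where k: "strict_mono k"
    "AE \<xi> in lborel. (\<lambda>n. W \<xi> * norm (f \<xi> - r (k n) \<xi>)) \<longlonglongrightarrow> 0"
    using tendsto_L1_AE_subseq[of lborel "\<lambda>n \<xi>. W \<xi> * norm (f \<xi> - r n \<xi>)"] by auto
  from k(2) have ae: "AE \<xi> in lborel. W \<xi> * norm (f \<xi> - g \<xi>) = 0"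
  proof eventually_elim
    case (elim \<xi>)
    show ?case
    proof (cases "0 < \<xi>")
      case True
      have "(\<lambda>n. r (k n) \<xi>) \<longlonglongrightarrow> g \<xi>"
        using LIMSEQ_subseq_LIMSEQ[OF lim[OF True] k(1)] by (simp add: o_def)
      then have "(\<lambda>n. W \<xi> * norm (f \<xi> - r (k n) \<xi>)) \<longlonglongrightarrow> W \<xi> * norm (f \<xi> - g \<xi>)"
        by (intro tendsto_intros)
      from LIMSEQ_unique[OF this elim] show ?thesis .
    qed (simp add: W_def)
  qed
  have "integrable lborel (\<lambda>\<xi>. W \<xi> * norm (f \<xi> - g \<xi>))"
    by (rule Bochner_Integration.integrable_bound[of _ "\<lambda>_. 0 :: real"])
      (use ae W_mult_measurable[OF m] in auto)
  with m have "(\<lambda>\<xi>. f \<xi> - g \<xi>) \<in> Lb phi \<beta>" by (simp add: Lb_iff)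
  moreover have "Nrm phi \<beta> (\<lambda>\<xi>. f \<xi> - g \<xi>) = 0"
    unfolding Nrm_eq by (rule integral_eq_zero_AE[OF ae])
  ultimately show ?thesis by (simp add: Leq_def)
qed

end

section \<open>Elementary bounds for continuous and Hoelder paths\<close>

lemma continuous_bound:
  fixes w :: "real \<Rightarrow> 'v::real_normed_vector"
  assumes "continuous_on {a..b} w"
  obtains M where "0 \<le> M" "\<And>s. a \<le> s \<Longrightarrow> s \<le> b \<Longrightarrow> norm (w s) \<le> M"
proof -
  have "bounded (w ` {a..b})"
    by (intro compact_imp_bounded compact_continuous_image assms) simp
  then obtain M where "0 < M" "\<forall>x\<in>w ` {a..b}. norm x \<le> M" unfolding bounded_pos by blast
  then show thesis by (intro that[of M]) auto
qed

lemma holder_onE: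
  assumes "holder_on g S f"
  obtains H where "0 \<le> H" "\<And>s t. s \<in> S \<Longrightarrow> t \<in> S \<Longrightarrow> norm (f t - f s) \<le> H * \<bar>t - s\<bar> powr g"
proof -
  obtain H where H: "\<forall>s\<in>S. \<forall>t\<in>S. norm (f t - f s) \<le> H * \<bar>t - s\<bar> powr g"
    using assms unfolding holder_on_def ..
  show thesis
  proof
    fix s t assume "s \<in> S" "t \<in> S"
    then have "norm (f t - f s) \<le> H * \<bar>t - s\<bar> powr g" using H by blast
    also have "\<dots> \<le> max 0 H * \<bar>t - s\<bar> powr g" by (intro mult_right_mono) auto
    finally show "norm (f t - f s) \<le> max 0 H * \<bar>t - s\<bar> powr g" .
  qed simp
qed

lemma holder_on_continuous:
  assumes f: "holder_on g S f" and g: "0 < g"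
  shows "continuous_on S f"
proof -
  obtain H where H: "0 \<le> H" "\<And>s t. s \<in> S \<Longrightarrow> t \<in> S \<Longrightarrow> norm (f t - f s) \<le> H * \<bar>t - s\<bar> powr g"
    using holder_onE[OF f] by blast
  show ?thesis
    unfolding continuous_on_def
  proof
    fix s assume s: "s \<in> S"
    have "((\<lambda>t. H * \<bar>t - s\<bar> powr g) \<longlongrightarrow> H * \<bar>s - s\<bar> powr g) (at s within S)"
      using g by (intro tendsto_intros tendsto_powr') auto
    then have lim: "((\<lambda>t. H * \<bar>t - s\<bar> powr g) \<longlongrightarrow> 0) (at s within S)" by simp
    have "((\<lambda>t. f t - f s) \<longlongrightarrow> 0) (at s within S)"
      by (rule Lim_null_comparison[OF _ lim]) (use H(2) s in \<open>auto simp: eventually_at_filter\<close>)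
    then show "(f \<longlongrightarrow> f s) (at s within S)" by (simp add: LIM_zero_iff)
  qed
qed

lemma Young_powr_le:
  fixes s u t g :: real
  assumes "s \<le> u" "u \<le> t" "0 \<le> g"
  shows "(t - u) powr g * (u - s) powr g \<le> (t - s) powr (2 * g)"
proof -
  have "(t - u) powr g * (u - s) powr g \<le> (t - s) powr g * (t - s) powr g"
    using assms by (intro mult_mono powr_mono2) auto
  also have "\<dots> = (t - s) powr (2 * g)" by (simp flip: powr_add)
  finally show ?thesis .
qed

text \<open>Only data of the integrator are fixed here; integrands \<open>w\<close> are arguments of
  the lemmas. Constants defined in this locale are thereby independent of the integrand.\<close>

locale convolutional_path = measurable_weight phi \<gamma> for phi \<gamma> +
  fixes T :: real and x1 :: "real \<Rightarrow> real \<Rightarrow> real \<Rightarrow> real ^ 'd"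
  assumes gam: "1/2 < \<gamma>"
    and x1_C: "C2hol phi \<gamma> \<gamma> 0 T x1"
    and x1_chen: "\<And>s u t. 0 \<le> s \<Longrightarrow> s \<le> u \<Longrightarrow> u \<le> t \<Longrightarrow> t \<le> T \<Longrightarrow>
                    Leq phi \<gamma> (dtil3 x1 t u s) (\<lambda>\<xi>. 0)"
begin

definition germ :: "(real \<Rightarrow> real ^ 'm ^ 'd) \<Rightarrow> real \<Rightarrow> real \<Rightarrow> real \<Rightarrow> real ^ 'm" where
  "germ w t s \<xi> = x1 t s \<xi> v* w s"

lemma x1_C2: "C2 phi \<gamma> 0 T x1"
  using x1_C by (simp add: C2hol_def)

lemmas x1_Lb = C2_Lb[OF x1_C2]

lemma x1_chen_Nrm:
  "0 \<le> s \<Longrightarrow> s \<le> u \<Longrightarrow> u \<le> t \<Longrightarrow> t \<le> T \<Longrightarrow> Nrm phi \<gamma> (dtil3 x1 t u s) = 0"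
  using x1_chen[of s u t] by (simp add: Leq_def)

text \<open>Some Hoelder constant of \<open>x1\<close>, named before any integrand is mentioned, so
  that it may enter the constant of (2).\<close>

definition Nx :: real where
  "Nx = (SOME N. 0 \<le> N \<and> (\<forall>s t. 0 \<le> s \<and> s < t \<and> t \<le> T \<longrightarrow> Nrm phi \<gamma> (x1 t s) \<le> N * (t - s) powr \<gamma>))"

lemma Nx_ex: "\<exists>N. 0 \<le> N \<and> (\<forall>s t. 0 \<le> s \<and> s < t \<and> t \<le> T \<longrightarrow> Nrm phi \<gamma> (x1 t s) \<le> N * (t - s) powr \<gamma>)"
proof -
  obtain N where "0 \<le> N" "\<And>s t. 0 \<le> s \<Longrightarrow> s < t \<Longrightarrow> t \<le> T \<Longrightarrow> Nrm phi \<gamma> (x1 t s) \<le> N * (t - s) powr \<gamma>"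
    using C2hol_bound[OF x1_C] by blast
  then show ?thesis by blast
qed

lemma Nx_nonneg: "0 \<le> Nx"
  using someI_ex[OF Nx_ex] unfolding Nx_def by blast

text \<open>The Hoelder norm speaks of \<open>s < t\<close>; on the diagonal the relation for three
  equal times makes \<open>x1 t t\<close> vanish in norm.\<close>

lemma x1_bound:
  assumes "0 \<le> s" "s \<le> t" "t \<le> T"
  shows "Nrm phi \<gamma> (x1 t s) \<le> Nx * (t - s) powr \<gamma>"
proof (cases "s = t")
  case True
  with assms x1_chen_Nrm[of t t t] show ?thesis by (simp add: Nrm_dtil3_diag)
next
  case False
  with assms someI_ex[OF Nx_ex, folded Nx_def] show ?thesis by simp
qed

lemma germ_Lb: "0 \<le> s \<Longrightarrow> s \<le> t \<Longrightarrow> t \<le> T \<Longrightarrow> germ w t s \<in> Lb phi \<gamma>"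
  unfolding germ_def[abs_def] by (intro Lb_vector_matrix_mult x1_Lb)

lemma hJ_Lb: "0 \<le> u \<Longrightarrow> u \<le> t \<Longrightarrow> t \<le> T \<Longrightarrow> hJ x1 w t u s \<in> Lb phi \<gamma>"
  unfolding hJ_def[abs_def] by (intro Lb_vector_matrix_mult x1_Lb)

text \<open>The germ freezes \<open>w\<close> at the left end of each interval. Only the term over
  [u,t] sees \<open>w u\<close>; replacing it by \<open>w s\<close> costs \<open>hJ\<close>, and the
  rest is the increment of \<open>x1\<close>, which is null.\<close>

lemma dtil3_germ: "dtil3 (germ w) t u s \<xi> + hJ x1 w t u s \<xi> = dtil3 x1 t u s \<xi> v* w s"
  by (simp add: dtil3_def germ_def hJ_def vector_matrix_mult_diff_distrib
      vector_matrix_mult_diff_rdistrib scaleR_vector_matrix_assoc)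

lemma dtil3_germ_zero:
  assumes "0 \<le> s" "s \<le> u" "u \<le> t" "t \<le> T"
  shows "Nrm phi \<gamma> (\<lambda>\<xi>. dtil3 (germ w) t u s \<xi> + hJ x1 w t u s \<xi>) \<le> 0"
  unfolding dtil3_germ
  using Nrm_vector_matrix_mult_bound[OF dtil3_Lb[OF x1_Lb assms], where N=0 and A="w s" and H="norm (w s)"]
    x1_chen_Nrm[OF assms] by simp

text \<open>Exhibits \<open>hJ\<close> as an increment, as the domain of the sewing map requires.
  The sign comes from the preceding identity.\<close>

lemma Leq_dtil3_germ:
  assumes "0 \<le> s" "s \<le> u" "u \<le> t" "t \<le> T"
  shows "Leq phi \<gamma> (dtil3 (\<lambda>t s \<xi>. - germ w t s \<xi>) t u s) (hJ x1 w t u s)"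
proof -
  have eq: "dtil3 (\<lambda>t s \<xi>. - germ w t s \<xi>) t u s \<xi> - hJ x1 w t u s \<xi> =
     - (dtil3 (germ w) t u s \<xi> + hJ x1 w t u s \<xi>)" for \<xi>
    by (simp add: dtil3_def)
  have "(\<lambda>\<xi>. dtil3 (germ w) t u s \<xi> + hJ x1 w t u s \<xi>) \<in> Lb phi \<gamma>"
    using assms by (intro Lb_add dtil3_Lb[OF germ_Lb assms] hJ_Lb) auto
  with dtil3_germ_zero[OF assms, of w] show ?thesis
    unfolding Leq_def eq Nrm_uminus by (intro conjI Lb_uminus order_antisym Nrm_nonneg)
qed

lemma hJ_bound:
  assumes "0 \<le> u" "s \<le> u" "u \<le> t" "t \<le> T" and H: "norm (w u - w s) \<le> H * (u - s) powr \<gamma>" "0 \<le> H"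
  shows "Nrm phi \<gamma> (hJ x1 w t u s) \<le> Nx * H * ((t - u) powr \<gamma> * (u - s) powr \<gamma>)"
proof -
  have "Nrm phi \<gamma> (hJ x1 w t u s) \<le> (Nx * (t - u) powr \<gamma>) * (H * (u - s) powr \<gamma>)"
    unfolding hJ_def[abs_def] using assms
    by (intro Nrm_vector_matrix_mult_bound x1_Lb x1_bound) auto
  then show ?thesis by (simp add: mult_ac)
qed

lemma hJ_bound_powr:
  assumes "0 \<le> u" "s \<le> u" "u \<le> t" "t \<le> T" and H: "norm (w u - w s) \<le> H * (u - s) powr \<gamma>" "0 \<le> H"
  shows "Nrm phi \<gamma> (hJ x1 w t u s) \<le> Nx * H * (t - s) powr (2 * \<gamma>)"
  using assms gam Nx_nonneg
  by (intro order_trans[OF hJ_bound[OF assms]] mult_left_mono Young_powr_le) auto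

lemma germ_C2:
  assumes w: "continuous_on {0..T} w"
  shows "C2 phi \<gamma> 0 T (germ w)"
proof (rule C2_I[OF germ_Lb])
  fix s t S U assume st: "0 \<le> s" "s \<le> t" "t \<le> T"
    and SU: "\<And>n. 0 \<le> S n \<and> S n \<le> U n \<and> U n \<le> T" "S \<longlonglongrightarrow> s" "U \<longlonglongrightarrow> t"
  have Sin: "S n \<in> {0..T}" for n using SU(1)[of n] by auto
  have wS: "(\<lambda>n. w (S n)) \<longlonglongrightarrow> w s"
    using continuous_on_tendsto_compose[OF w SU(2)] Sin st by auto
  have eq: "germ w (U n) (S n) \<xi> - germ w t s \<xi> =
     (x1 (U n) (S n) \<xi> - x1 t s \<xi>) v* w (S n) + x1 t s \<xi> v* (w (S n) - w s)" for n \<xi>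
    by (simp add: germ_def vector_matrix_mult_diff_distrib vector_matrix_mult_diff_rdistrib)
  have bnd: "Nrm phi \<gamma> (\<lambda>\<xi>. germ w (U n) (S n) \<xi> - germ w t s \<xi>) \<le>
     norm (w (S n)) * Nrm phi \<gamma> (\<lambda>\<xi>. x1 (U n) (S n) \<xi> - x1 t s \<xi>) + norm (w (S n) - w s) * Nrm phi \<gamma> (x1 t s)" for n
    unfolding eq using st SU(1)[of n]
    by (intro Nrm_add_le Nrm_vector_matrix_mult Lb_vector_matrix_mult Lb_diff x1_Lb) auto
  have "(\<lambda>n. norm (w (S n)) * Nrm phi \<gamma> (\<lambda>\<xi>. x1 (U n) (S n) \<xi> - x1 t s \<xi>) + norm (w (S n) - w s) * Nrm phi \<gamma> (x1 t s))
     \<longlonglongrightarrow> norm (w s) * 0 + norm (w s - w s) * Nrm phi \<gamma> (x1 t s)"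
    by (intro tendsto_intros wS C2_tendsto[OF x1_C2 st SU])
  then show "(\<lambda>n. Nrm phi \<gamma> (\<lambda>\<xi>. germ w (U n) (S n) \<xi> - germ w t s \<xi>)) \<longlonglongrightarrow> 0"
    by (intro Nrm_tendsto_0[OF bnd]) simp
qed

text \<open>Product rule for continuity: the change of \<open>x1\<close> is multiplied by a bounded
  increment of \<open>w\<close>, and the fixed \<open>x1 t u\<close> by the change of that
  increment.\<close>

lemma hJ_C3:
  assumes w: "continuous_on {0..T} w"
  shows "C3 phi \<gamma> 0 T (hJ x1 w)"
  unfolding C3_def
proof (intro conjI allI impI)
  show "hJ x1 w t u s \<in> Lb phi \<gamma>" if "0 \<le> s \<and> s \<le> u \<and> u \<le> t \<and> t \<le> T" for s u t
    using that by (intro hJ_Lb) auto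
  fix s u t and e :: real assume st: "0 \<le> s \<and> s \<le> u \<and> u \<le> t \<and> t \<le> T" and e: "0 < e"
  obtain M where M: "0 \<le> M" "\<And>s. 0 \<le> s \<Longrightarrow> s \<le> T \<Longrightarrow> norm (w s) \<le> M"
    using continuous_bound[OF w] by blast
  define N where "N = Nrm phi \<gamma> (x1 t u)"
  have N: "0 \<le> N" by (simp add: N_def)
  \<comment> \<open>These make \<open>e1 * (2 * M)\<close> and \<open>N * (2 * e2)\<close> both less
    than \<open>e / 2\<close>, also when \<open>M\<close> or \<open>N\<close> is zero.\<close>
  define e1 where "e1 = e / (2 * (2 * M + 1))"
  define e2 where "e2 = e / (4 * (N + 1))"
  have e12: "0 < e1" "0 < e2" using e M(1) N by (auto simp: e1_def e2_def)
  have "\<exists>d>0. \<forall>s' t'. 0 \<le> s' \<and> s' \<le> t' \<and> t' \<le> T \<and> \<bar>s' - u\<bar> < d \<and> \<bar>t' - t\<bar> < d \<longrightarrow>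
     Nrm phi \<gamma> (\<lambda>\<xi>. x1 t' s' \<xi> - x1 t u \<xi>) < e1"
    by (rule x1_C2[unfolded C2_def, THEN conjunct2, rule_format]) (use st e12 in auto)
  then obtain d1 where d1: "0 < d1" "\<And>s' t'. 0 \<le> s' \<and> s' \<le> t' \<and> t' \<le> T \<and> \<bar>s' - u\<bar> < d1 \<and> \<bar>t' - t\<bar> < d1 \<Longrightarrow>
     Nrm phi \<gamma> (\<lambda>\<xi>. x1 t' s' \<xi> - x1 t u \<xi>) < e1" by blast
  have wc: "\<exists>d>0. \<forall>v'\<in>{0..T}. dist v' v < d \<longrightarrow> dist (w v') (w v) < e2" if "v \<in> {0..T}" for v
    using w that e12 unfolding continuous_on_iff by blast
  have "u \<in> {0..T}" "s \<in> {0..T}" using st by auto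
  from wc[OF this(1)] wc[OF this(2)] obtain d2 d3 where d2: "0 < d2" "\<forall>v'\<in>{0..T}. dist v' u < d2 \<longrightarrow> dist (w v') (w u) < e2"
    and d3: "0 < d3" "\<forall>v'\<in>{0..T}. dist v' s < d3 \<longrightarrow> dist (w v') (w s) < e2" by blast
  show "\<exists>d>0. \<forall>s' u' t'. 0 \<le> s' \<and> s' \<le> u' \<and> u' \<le> t' \<and> t' \<le> T \<and>
      \<bar>s' - s\<bar> < d \<and> \<bar>u' - u\<bar> < d \<and> \<bar>t' - t\<bar> < d \<longrightarrow>
      Nrm phi \<gamma> (\<lambda>\<xi>. hJ x1 w t' u' s' \<xi> - hJ x1 w t u s \<xi>) < e"
  proof (intro exI[of _ "min d1 (min d2 d3)"] conjI allI impI)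
    fix s' u' t' assume H: "0 \<le> s' \<and> s' \<le> u' \<and> u' \<le> t' \<and> t' \<le> T \<and> \<bar>s' - s\<bar> < min d1 (min d2 d3) \<and>
      \<bar>u' - u\<bar> < min d1 (min d2 d3) \<and> \<bar>t' - t\<bar> < min d1 (min d2 d3)"
    have eq: "hJ x1 w t' u' s' \<xi> - hJ x1 w t u s \<xi> =
      (x1 t' u' \<xi> - x1 t u \<xi>) v* (w u' - w s') + x1 t u \<xi> v* ((w u' - w u) - (w s' - w s))" for \<xi>
      by (simp add: hJ_def vector_matrix_mult_diff_distrib vector_matrix_mult_diff_rdistrib)
    have xx: "Nrm phi \<gamma> (\<lambda>\<xi>. x1 t' u' \<xi> - x1 t u \<xi>) \<le> e1"
      by (rule less_imp_le, rule d1(2)) (use H in auto)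
    have n1: "norm (w u' - w s') \<le> 2 * M"
      using norm_triangle_ineq4[of "w u'" "w s'"] M(2)[of u'] M(2)[of s'] H by auto
    have "dist (w u') (w u) < e2" "dist (w s') (w s) < e2"
      using d2(2) d3(2) H by (auto simp: dist_real_def)
    then have n2: "norm ((w u' - w u) - (w s' - w s)) \<le> 2 * e2"
      using norm_triangle_ineq4[of "w u' - w u" "w s' - w s"] by (simp add: dist_norm)
    have "Nrm phi \<gamma> (\<lambda>\<xi>. hJ x1 w t' u' s' \<xi> - hJ x1 w t u s \<xi>) \<le> e1 * (2 * M) + N * (2 * e2)"
      unfolding eq using H st xx n1 n2 M(1) e12
      by (intro Nrm_add_le Nrm_vector_matrix_mult_bound Lb_vector_matrix_mult Lb_diff x1_Lb)
        (auto simp: N_def)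
    also have "\<dots> < e / 2 + e / 2"
    proof (rule add_strict_mono)
      show "e1 * (2 * M) < e / 2" using e M(1) by (simp add: e1_def field_simps)
      show "N * (2 * e2) < e / 2" using e N by (simp add: e2_def field_simps)
    qed
    finally show "Nrm phi \<gamma> (\<lambda>\<xi>. hJ x1 w t' u' s' \<xi> - hJ x1 w t u s \<xi>) < e" by simp
  qed (use d1 d2 d3 in auto)
qed

lemma holder_continuous: "holder_on \<gamma> {0..T} w \<Longrightarrow> continuous_on {0..T} w"
  using gam by (intro holder_on_continuous[of \<gamma>]) auto

text \<open>A decomposition into a single summand suffices, with exponent \<gamma> on either side of
  \<open>u\<close>.\<close>

lemma hJ_C3hol:
  assumes w: "holder_on \<gamma> {0..T} w"
  shows "C3hol phi \<gamma> (2 * \<gamma>) 0 T (hJ x1 w)"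
proof -
  obtain H where H: "0 \<le> H" "\<And>s t. s \<in> {0..T} \<Longrightarrow> t \<in> {0..T} \<Longrightarrow> norm (w t - w s) \<le> H * \<bar>t - s\<bar> powr \<gamma>"
    using holder_onE[OF w] by blast
  have C3: "C3 phi \<gamma> 0 T (hJ x1 w)" by (rule hJ_C3[OF holder_continuous[OF w]])
  have "bdd_above {Nrm phi \<gamma> (hJ x1 w t u s) / ((t - u) powr \<gamma> * (u - s) powr (2 * \<gamma> - \<gamma>))
                     | s u t. 0 \<le> s \<and> s < u \<and> u < t \<and> t \<le> T}"
  proof (rule bdd_aboveI[of _ "Nx * H"])
    fix y assume "y \<in> {Nrm phi \<gamma> (hJ x1 w t u s) / ((t - u) powr \<gamma> * (u - s) powr (2 * \<gamma> - \<gamma>))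
                     | s u t. 0 \<le> s \<and> s < u \<and> u < t \<and> t \<le> T}"
    then obtain s u t where y: "y = Nrm phi \<gamma> (hJ x1 w t u s) / ((t - u) powr \<gamma> * (u - s) powr \<gamma>)"
      and st: "0 \<le> s" "s < u" "u < t" "t \<le> T" by auto
    have "Nrm phi \<gamma> (hJ x1 w t u s) \<le> Nx * H * ((t - u) powr \<gamma> * (u - s) powr \<gamma>)"
      using H(2)[of s u] st H(1) by (intro hJ_bound) auto
    then show "y \<le> Nx * H" unfolding y using st by (subst pos_divide_le_eq) auto
  qed
  then show ?thesis
    unfolding C3hol_def using C3 gam
    by (intro conjI exI[of _ "1::nat"] exI[of _ "\<lambda>_. hJ x1 w"] exI[of _ "\<lambda>_. \<gamma>"]) auto
qed

lemma sew_exists: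
  assumes w: "holder_on \<gamma> {0..T} w"
  shows "\<exists>A. C2hol phi \<gamma> (2 * \<gamma>) 0 T A \<and> (\<forall>s u t. 0 \<le> s \<and> s \<le> u \<and> u \<le> t \<and> t \<le> T \<longrightarrow>
              Leq phi \<gamma> (dtil3 A t u s) (hJ x1 w t u s))"
proof -
  obtain H where H: "0 \<le> H" "\<And>s t. s \<in> {0..T} \<Longrightarrow> t \<in> {0..T} \<Longrightarrow> norm (w t - w s) \<le> H * \<bar>t - s\<bar> powr \<gamma>"
    using holder_onE[OF w] by blast
  obtain M where M: "0 \<le> M" "\<And>s. 0 \<le> s \<Longrightarrow> s \<le> T \<Longrightarrow> norm (w s) \<le> M"
    using continuous_bound[OF holder_continuous[OF w]] by blast
  \<comment> \<open>The increment of the germ is \<open>- hJ\<close> in norm, hence the negated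
    germ.\<close>
  let ?G = "\<lambda>t s \<xi>. - germ w t s \<xi>"
  have "\<exists>A. C2hol phi \<gamma> (2 * \<gamma>) 0 T A \<and> (\<forall>s u t. 0 \<le> s \<and> s \<le> u \<and> u \<le> t \<and> t \<le> T \<longrightarrow>
      Leq phi \<gamma> (dtil3 A t u s) (dtil3 ?G t u s))"
  proof (rule sewing_map_exists[where D="Nx * M" and \<alpha>=\<gamma> and C="Nx * H"])
    show "C2 phi \<gamma> 0 T ?G" by (intro C2_uminus germ_C2 holder_continuous w)
    show "Nrm phi \<gamma> (?G t s) \<le> Nx * M * (t - s) powr \<gamma>" if "0 \<le> s" "s \<le> t" "t \<le> T" for s t
    proof -
      have "Nrm phi \<gamma> (germ w t s) \<le> (Nx * (t - s) powr \<gamma>) * M"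
        unfolding germ_def[abs_def] using that M
        by (intro Nrm_vector_matrix_mult_bound x1_Lb x1_bound) auto
      then show ?thesis by (simp add: mult_ac)
    qed
    show "Nrm phi \<gamma> (dtil3 ?G t u s) \<le> Nx * H * (t - s) powr (2 * \<gamma>)"
      if st: "0 \<le> s" "s \<le> u" "u \<le> t" "t \<le> T" for s u t
    proof -
      have "Nrm phi \<gamma> (dtil3 ?G t u s) \<le> Nrm phi \<gamma> (hJ x1 w t u s)"
        using st by (intro Leq_Nrm_le Leq_dtil3_germ hJ_Lb) auto
      also have "\<dots> \<le> Nx * H * (t - s) powr (2 * \<gamma>)"
        using st H(2)[of s u] H(1) by (intro hJ_bound_powr) auto
      finally show ?thesis .
    qed
  qed (use gam Nx_nonneg H(1) M(1) in auto)
  then obtain A where A: "C2hol phi \<gamma> (2 * \<gamma>) 0 T A"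
    "\<forall>s u t. 0 \<le> s \<and> s \<le> u \<and> u \<le> t \<and> t \<le> T \<longrightarrow> Leq phi \<gamma> (dtil3 A t u s) (dtil3 ?G t u s)"
    by blast
  show ?thesis
  proof (intro exI[of _ A] conjI allI impI A(1))
    fix s u t assume "0 \<le> s \<and> s \<le> u \<and> u \<le> t \<and> t \<le> T"
    then show "Leq phi \<gamma> (dtil3 A t u s) (hJ x1 w t u s)"
      using A(2) by (intro Leq_trans[OF _ Leq_dtil3_germ]) auto
  qed
qed

lemma sew_spec:
  assumes "holder_on \<gamma> {0..T} w"
  shows "C2hol phi \<gamma> (2 * \<gamma>) 0 T (sew phi \<gamma> (2 * \<gamma>) 0 T (hJ x1 w))"
    and "0 \<le> s \<Longrightarrow> s \<le> u \<Longrightarrow> u \<le> t \<Longrightarrow> t \<le> T \<Longrightarrow>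
       Leq phi \<gamma> (dtil3 (sew phi \<gamma> (2 * \<gamma>) 0 T (hJ x1 w)) t u s) (hJ x1 w t u s)"
  using someI_ex[OF sew_exists[OF assms]] unfolding sew_def by blast+

lemma sew_Lb:
  assumes "holder_on \<gamma> {0..T} w" "0 \<le> s" "s \<le> t" "t \<le> T"
  shows "sew phi \<gamma> (2 * \<gamma>) 0 T (hJ x1 w) t s \<in> Lb phi \<gamma>"
  using C2_Lb[OF conjunct1[OF sew_spec(1)[OF assms(1), unfolded C2hol_def]] assms(2-)] .

text \<open>Membership in the Hoelder class over [0,T] provides some constant \<open>K\<close>; the
  a priori estimate on [l1,l2] trades it for the Hoelder constant \<open>H\<close> of
  \<open>w\<close> on that subinterval alone.\<close>

lemma sew_local_bound:
  assumes w: "holder_on \<gamma> {0..T} w" and l: "0 \<le> l1" "l2 \<le> T" and H: "0 \<le> H"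
    and wH: "\<And>s u. l1 \<le> s \<Longrightarrow> s \<le> u \<Longrightarrow> u \<le> l2 \<Longrightarrow> norm (w u - w s) \<le> H * (u - s) powr \<gamma>"
    and st: "l1 \<le> s" "s \<le> t" "t \<le> l2"
  shows "Nrm phi \<gamma> (sew phi \<gamma> (2 * \<gamma>) 0 T (hJ x1 w) t s) \<le>
    Nx * H / (1 - 2 powr (1 - 2 * \<gamma>)) * (t - s) powr (2 * \<gamma>)"
proof -
  obtain K where "0 \<le> K" and K: "\<And>s t. 0 \<le> s \<Longrightarrow> s < t \<Longrightarrow> t \<le> T \<Longrightarrow>
     Nrm phi \<gamma> (sew phi \<gamma> (2 * \<gamma>) 0 T (hJ x1 w) t s) \<le> K * (t - s) powr (2 * \<gamma>)"
    using C2hol_bound[OF sew_spec(1)[OF w]] by blast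
  show ?thesis
  proof (rule sewing_apriori[of l1 l2 _ K])
    show "sew phi \<gamma> (2 * \<gamma>) 0 T (hJ x1 w) t s \<in> Lb phi \<gamma>" if "l1 \<le> s" "s \<le> t" "t \<le> l2" for s t
      using that l by (intro sew_Lb w) auto
    show "Nrm phi \<gamma> (sew phi \<gamma> (2 * \<gamma>) 0 T (hJ x1 w) t s) \<le> K * (t - s) powr (2 * \<gamma>)"
      if "l1 \<le> s" "s < t" "t \<le> l2" for s t
      using that l by (intro K) auto
    show "Nrm phi \<gamma> (dtil3 (sew phi \<gamma> (2 * \<gamma>) 0 T (hJ x1 w)) t u s) \<le> Nx * H * (t - s) powr (2 * \<gamma>)"
      if "l1 \<le> s" "s \<le> u" "u \<le> t" "t \<le> l2" for s u t
    proof -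
      have "Nrm phi \<gamma> (dtil3 (sew phi \<gamma> (2 * \<gamma>) 0 T (hJ x1 w)) t u s) \<le> Nrm phi \<gamma> (hJ x1 w t u s)"
        using that l by (intro Leq_Nrm_le sew_spec(2) w hJ_Lb) auto
      also have "\<dots> \<le> Nx * H * (t - s) powr (2 * \<gamma>)"
        using that l H by (intro hJ_bound_powr wH) auto
      finally show ?thesis .
    qed
  qed (use st gam Nx_nonneg H in auto)
qed

lemma Jint_eq: "Jint phi \<gamma> T x1 w t s = (\<lambda>\<xi>. germ w t s \<xi> + sew phi \<gamma> (2 * \<gamma>) 0 T (hJ x1 w) t s \<xi>)"
  by (simp add: Jint_def germ_def fun_eq_iff)

lemma Jint_Lb:
  "holder_on \<gamma> {0..T} w \<Longrightarrow> 0 \<le> s \<Longrightarrow> s \<le> t \<Longrightarrow> t \<le> T \<Longrightarrow> Jint phi \<gamma> T x1 w t s \<in> Lb phi \<gamma>"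
  unfolding Jint_eq by (intro Lb_add germ_Lb sew_Lb)

lemma Jint_C2:
  assumes w: "holder_on \<gamma> {0..T} w"
  shows "C2 phi \<gamma> 0 T (Jint phi \<gamma> T x1 w)"
proof -
  have "C2 phi \<gamma> 0 T (\<lambda>t s \<xi>. germ w t s \<xi> + sew phi \<gamma> (2 * \<gamma>) 0 T (hJ x1 w) t s \<xi>)"
    using sew_spec(1)[OF w] by (intro C2_add germ_C2 holder_continuous w) (simp add: C2hol_def)
  then show ?thesis by (simp add: Jint_eq[abs_def])
qed

text \<open>The increments of the germ and of the sewing map are \<open>- hJ\<close> and
  \<open>hJ\<close> up to norm zero and cancel.\<close>

lemma Jint_additive:
  assumes w: "holder_on \<gamma> {0..T} w" and st: "0 \<le> s" "s \<le> u" "u \<le> t" "t \<le> T"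
  shows "Nrm phi \<gamma> (dtil3 (Jint phi \<gamma> T x1 w) t u s) = 0"
proof -
  let ?A = "sew phi \<gamma> (2 * \<gamma>) 0 T (hJ x1 w)"
  have eq: "dtil3 (Jint phi \<gamma> T x1 w) t u s = (\<lambda>\<xi>. (dtil3 (germ w) t u s \<xi> + hJ x1 w t u s \<xi>) +
     (dtil3 ?A t u s \<xi> - hJ x1 w t u s \<xi>))"
    by (simp add: dtil3_def Jint_eq fun_eq_iff scaleR_add_right)
  have "Nrm phi \<gamma> (dtil3 (Jint phi \<gamma> T x1 w) t u s) \<le> 0 + 0"
    unfolding eq
  proof (rule Nrm_add_le)
    show "(\<lambda>\<xi>. dtil3 (germ w) t u s \<xi> + hJ x1 w t u s \<xi>) \<in> Lb phi \<gamma>"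
      using st by (intro Lb_add dtil3_Lb[OF germ_Lb st] hJ_Lb) auto
  qed (use dtil3_germ_zero[OF st] sew_spec(2)[OF w st] in \<open>auto simp: Leq_def\<close>)
  then show ?thesis by (simp add: order_antisym)
qed

text \<open>The germ contributes the supremum of \<open>w\<close> at order \<gamma>. The sewing term
  has order \<open>2 * \<gamma>\<close>, and its surplus factor is bounded by
  \<open>(l2 - l1) powr \<gamma>\<close>.\<close>

lemma Jint_local_bound:
  assumes w: "holder_on \<gamma> {0..T} w" and l: "0 \<le> l1" "l2 \<le> T" and H: "0 \<le> H"
    and wH: "\<And>s u. l1 \<le> s \<Longrightarrow> s \<le> u \<Longrightarrow> u \<le> l2 \<Longrightarrow> norm (w u - w s) \<le> H * (u - s) powr \<gamma>"
    and wM: "\<And>s. l1 \<le> s \<Longrightarrow> s \<le> l2 \<Longrightarrow> norm (w s) \<le> M"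
    and st: "l1 \<le> s" "s \<le> t" "t \<le> l2"
  shows "Nrm phi \<gamma> (Jint phi \<gamma> T x1 w t s) \<le>
    (Nx * M + Nx / (1 - 2 powr (1 - 2 * \<gamma>)) * ((l2 - l1) powr \<gamma> * H)) * (t - s) powr \<gamma>"
proof -
  let ?q = "1 - 2 powr (1 - 2 * \<gamma>)"
  have q: "0 < ?q" using gam by (simp add: powr_less_one)
  have M: "norm (w s) \<le> M" using st by (intro wM) auto
  have M0: "0 \<le> M" using M norm_ge_zero[of "w s"] by linarith
  have "Nrm phi \<gamma> (Jint phi \<gamma> T x1 w t s) \<le> (Nx * (t - s) powr \<gamma>) * M + Nx * H / ?q * (t - s) powr (2 * \<gamma>)"
    unfolding Jint_eq
  proof (rule Nrm_add_le)
    show "Nrm phi \<gamma> (germ w t s) \<le> (Nx * (t - s) powr \<gamma>) * M"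
      unfolding germ_def[abs_def] using st l M M0
      by (intro Nrm_vector_matrix_mult_bound x1_Lb x1_bound) auto
    show "Nrm phi \<gamma> (sew phi \<gamma> (2 * \<gamma>) 0 T (hJ x1 w) t s) \<le> Nx * H / ?q * (t - s) powr (2 * \<gamma>)"
      by (rule sew_local_bound[OF w l H wH st])
  qed (use st l in \<open>auto intro!: germ_Lb sew_Lb w\<close>)
  also have "(t - s) powr (2 * \<gamma>) = (t - s) powr \<gamma> * (t - s) powr \<gamma>"
    by (simp flip: powr_add)
  also have "Nx * H / ?q * ((t - s) powr \<gamma> * (t - s) powr \<gamma>) \<le> Nx * H / ?q * ((l2 - l1) powr \<gamma> * (t - s) powr \<gamma>)"
    using st gam Nx_nonneg H q by (intro mult_left_mono mult_right_mono powr_mono2) auto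
  finally show ?thesis by (simp add: algebra_simps)
qed

lemma Jint_C2hol:
  assumes w: "holder_on \<gamma> {0..T} w"
  shows "C2hol phi \<gamma> \<gamma> 0 T (Jint phi \<gamma> T x1 w)"
proof -
  obtain H where H: "0 \<le> H" "\<And>s t. s \<in> {0..T} \<Longrightarrow> t \<in> {0..T} \<Longrightarrow> norm (w t - w s) \<le> H * \<bar>t - s\<bar> powr \<gamma>"
    using holder_onE[OF w] by blast
  obtain M where M: "0 \<le> M" "\<And>s. 0 \<le> s \<Longrightarrow> s \<le> T \<Longrightarrow> norm (w s) \<le> M"
    using continuous_bound[OF holder_continuous[OF w]] by blast
  show ?thesis
  proof (rule C2hol_I[OF Jint_C2[OF w]])
    fix s t assume st: "0 \<le> s" "s < t" "t \<le> T"
    show "Nrm phi \<gamma> (Jint phi \<gamma> T x1 w t s) \<le>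
      (Nx * M + Nx / (1 - 2 powr (1 - 2 * \<gamma>)) * ((T - 0) powr \<gamma> * H)) * (t - s) powr \<gamma>"
    proof (rule Jint_local_bound[OF w _ _ H(1)])
      show "norm (w u - w s) \<le> H * (u - s) powr \<gamma>" if "0 \<le> s" "s \<le> u" "u \<le> T" for s u
        using H(2)[of s u] that by auto
    qed (use st M in auto)
  qed
qed

lemma Jint_N2_bound:
  assumes w: "holder_on \<gamma> {0..T} w" and l: "0 \<le> l1" "l1 < l2" "l2 \<le> T"
  shows "N2 phi \<gamma> \<gamma> l1 l2 (Jint phi \<gamma> T x1 w) \<le>
    (Nx + Nx / (1 - 2 powr (1 - 2 * \<gamma>)) + 1) * (N1sup w l1 l2 + (l2 - l1) powr \<gamma> * N1hol \<gamma> w l1 l2)"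
proof -
  let ?q = "1 - 2 powr (1 - 2 * \<gamma>)"
  have q: "0 < ?q" using gam by (simp add: powr_less_one)
  obtain H where H: "0 \<le> H" "\<And>s t. s \<in> {0..T} \<Longrightarrow> t \<in> {0..T} \<Longrightarrow> norm (w t - w s) \<le> H * \<bar>t - s\<bar> powr \<gamma>"
    using holder_onE[OF w] by blast
  obtain M where M: "0 \<le> M" "\<And>s. 0 \<le> s \<Longrightarrow> s \<le> T \<Longrightarrow> norm (w s) \<le> M"
    using continuous_bound[OF holder_continuous[OF w]] by blast
  \<comment> \<open>Regularity of \<open>w\<close> on [0,T] bounds both sets, so the suprema in
    \<open>N1sup\<close> and \<open>N1hol\<close> are genuine upper bounds.\<close>
  define S0 where "S0 = {norm (w s) | s. l1 \<le> s \<and> s \<le> l2}"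
  define S1 where "S1 = {norm (w t - w s) / \<bar>t - s\<bar> powr \<gamma> | s t. l1 \<le> s \<and> s \<le> l2 \<and> l1 \<le> t \<and> t \<le> l2 \<and> s \<noteq> t}"
  have b0: "bdd_above S0"
    using M l by (intro bdd_aboveI[of _ M]) (auto simp: S0_def)
  have b1: "bdd_above S1"
    using H l by (intro bdd_aboveI[of _ H]) (auto simp: S1_def divide_le_eq)
  have sup: "norm (w s) \<le> N1sup w l1 l2" if "l1 \<le> s" "s \<le> l2" for s
    unfolding N1sup_def S0_def[symmetric] using that by (intro cSup_upper b0) (auto simp: S0_def)
  have hol': "norm (w t - w s) / \<bar>t - s\<bar> powr \<gamma> \<le> N1hol \<gamma> w l1 l2"
    if "l1 \<le> s" "s < t" "t \<le> l2" for s t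
  proof -
    have "norm (w t - w s) / \<bar>t - s\<bar> powr \<gamma> \<in> S1"
      unfolding S1_def using that by (intro CollectI exI[of _ s] exI[of _ t]) auto
    then show ?thesis unfolding N1hol_def S1_def[symmetric] by (rule cSup_upper[OF _ b1])
  qed
  have hol: "norm (w t - w s) \<le> N1hol \<gamma> w l1 l2 * (t - s) powr \<gamma>"
    if "l1 \<le> s" "s \<le> t" "t \<le> l2" for s t
    using hol'[of s t] that by (cases "s = t") (auto simp: pos_divide_le_eq)
  have h0: "0 \<le> N1hol \<gamma> w l1 l2"
    using l by (intro order_trans[OF _ hol'[of l1 l2]]) auto
  have s0: "0 \<le> N1sup w l1 l2"
    using l sup[of l1] norm_ge_zero[of "w l1"] by linarith
  have e0: "0 \<le> (l2 - l1) powr \<gamma> * N1hol \<gamma> w l1 l2" using h0 by simp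
  show ?thesis
    unfolding N2_def
  proof (rule cSup_least)
    show "{Nrm phi \<gamma> (Jint phi \<gamma> T x1 w t s) / (t - s) powr \<gamma> |s t. l1 \<le> s \<and> s < t \<and> t \<le> l2} \<noteq> {}"
      using l by blast
    fix y assume "y \<in> {Nrm phi \<gamma> (Jint phi \<gamma> T x1 w t s) / (t - s) powr \<gamma> |s t. l1 \<le> s \<and> s < t \<and> t \<le> l2}"
    then obtain s t where y: "y = Nrm phi \<gamma> (Jint phi \<gamma> T x1 w t s) / (t - s) powr \<gamma>"
      and st: "l1 \<le> s" "s < t" "t \<le> l2" by auto
    have "Nrm phi \<gamma> (Jint phi \<gamma> T x1 w t s) \<le>
      (Nx * N1sup w l1 l2 + Nx / ?q * ((l2 - l1) powr \<gamma> * N1hol \<gamma> w l1 l2)) * (t - s) powr \<gamma>"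
      using l st by (intro Jint_local_bound[OF w _ _ h0 hol sup]) auto
    then have "y \<le> Nx * N1sup w l1 l2 + Nx / ?q * ((l2 - l1) powr \<gamma> * N1hol \<gamma> w l1 l2)"
      unfolding y using st by (simp add: pos_divide_le_eq)
    also have "\<dots> \<le> (Nx + Nx / ?q + 1) * N1sup w l1 l2 + (Nx + Nx / ?q + 1) * ((l2 - l1) powr \<gamma> * N1hol \<gamma> w l1 l2)"
      using Nx_nonneg q s0 e0 by (intro add_mono mult_right_mono) auto
    finally show "y \<le> (Nx + Nx / ?q + 1) * (N1sup w l1 l2 + (l2 - l1) powr \<gamma> * N1hol \<gamma> w l1 l2)"
      by (simp only: distrib_left)
  qed
qed

text \<open>The constant is fixed before the partition. This one quantitative estimate serves both
  (3) and the identification in the smooth case.\<close>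

lemma Jint_Riemann_bound:
  assumes w: "holder_on \<gamma> {0..T} w"
  obtains K where "0 \<le> K"
    "\<And>p d n. mono p \<Longrightarrow> (\<And>k. 0 \<le> p k) \<Longrightarrow> (\<And>k. p k \<le> T) \<Longrightarrow> (\<And>k. p (Suc k) - p k \<le> d) \<Longrightarrow>
      Nrm phi \<gamma> (\<lambda>\<xi>. Jint phi \<gamma> T x1 w (p n) (p 0) \<xi> - RS (germ w) p 0 n \<xi>) \<le>
        K * d powr (2 * \<gamma> - 1) * (p n - p 0)"
proof -
  let ?A = "sew phi \<gamma> (2 * \<gamma>) 0 T (hJ x1 w)"
  obtain H where H: "0 \<le> H" "\<And>s t. s \<in> {0..T} \<Longrightarrow> t \<in> {0..T} \<Longrightarrow> norm (w t - w s) \<le> H * \<bar>t - s\<bar> powr \<gamma>"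
    using holder_onE[OF w] by blast
  define K where "K = Nx * H / (1 - 2 powr (1 - 2 * \<gamma>))"
  have K0: "0 \<le> K" using gam Nx_nonneg H(1) by (simp add: K_def powr_less_one less_imp_le)
  have K: "Nrm phi \<gamma> (\<lambda>\<xi>. Jint phi \<gamma> T x1 w t s \<xi> - germ w t s \<xi>) \<le> K * (t - s) powr (2 * \<gamma>)"
    if "0 \<le> s" "s \<le> t" "t \<le> T" for s t
  proof -
    have "Nrm phi \<gamma> (?A t s) \<le> K * (t - s) powr (2 * \<gamma>)"
      unfolding K_def
    proof (rule sew_local_bound[OF w _ _ H(1), of 0 T])
      show "norm (w u - w s) \<le> H * (u - s) powr \<gamma>" if "0 \<le> s" "s \<le> u" "u \<le> T" for s u
        using H(2)[of s u] that by auto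
    qed (use that in auto)
    then show ?thesis by (simp add: Jint_eq)
  qed
  show thesis
  proof (rule that[OF K0])
    fix p :: "nat \<Rightarrow> real" and d n
    assume p: "mono p" "\<And>k. 0 \<le> p k" "\<And>k. p k \<le> T" "\<And>k. p (Suc k) - p k \<le> d"
    show "Nrm phi \<gamma> (\<lambda>\<xi>. Jint phi \<gamma> T x1 w (p n) (p 0) \<xi> - RS (germ w) p 0 n \<xi>) \<le>
        K * d powr (2 * \<gamma> - 1) * (p n - p 0)"
      using gam
      by (intro Nrm_Riemann_sum[of 0 T "Jint phi \<gamma> T x1 w" "germ w"] Jint_Lb[OF w] germ_Lb Jint_additive[OF w] K K0 p) auto
  qed
qed

lemma Jint_Riemann_sums:
  assumes w: "holder_on \<gamma> {0..T} w" and st: "0 \<le> s" "s < t" "t \<le> T" and e: "0 < e"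
  shows "\<exists>d>0. \<forall>(n::nat) p. p 0 = s \<and> p (Suc n) = t \<and> (\<forall>i\<le>n. p i < p (Suc i))
              \<and> (\<forall>i\<le>n. p (Suc i) - p i < d) \<longrightarrow>
              Nrm phi \<gamma> (\<lambda>\<xi>. Jint phi \<gamma> T x1 w t s \<xi> -
                 (\<Sum>i\<le>n. exp (- \<xi> * (t - p (Suc i))) *\<^sub>R (x1 (p (Suc i)) (p i) \<xi> v* w (p i)))) < e"
proof -
  obtain K where K: "0 \<le> K" and RB:
    "\<And>p d n. mono p \<Longrightarrow> (\<And>k. 0 \<le> p k) \<Longrightarrow> (\<And>k. p k \<le> T) \<Longrightarrow> (\<And>k. p (Suc k) - p k \<le> d) \<Longrightarrow>
      Nrm phi \<gamma> (\<lambda>\<xi>. Jint phi \<gamma> T x1 w (p n) (p 0) \<xi> - RS (germ w) p 0 n \<xi>) \<le>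
        K * d powr (2 * \<gamma> - 1) * (p n - p 0)"
    using Jint_Riemann_bound[OF w] by blast
  \<comment> \<open>Solves \<open>d powr (2 * \<gamma> - 1) = e / (K * (t - s) + 1)\<close>; the
    \<open>+ 1\<close> allows \<open>K = 0\<close> and yields a strict inequality.\<close>
  define d where "d = (e / (K * (t - s) + 1)) powr (1 / (2 * \<gamma> - 1))"
  have Kt: "0 \<le> K * (t - s)" using K st by simp
  have d: "0 < d" using e Kt by (simp add: d_def)
  have "d powr (2 * \<gamma> - 1) = e / (K * (t - s) + 1)"
    using e Kt gam by (simp add: d_def powr_powr)
  then have small: "K * d powr (2 * \<gamma> - 1) * (t - s) < e"
  proof -
    assume *: "d powr (2 * \<gamma> - 1) = e / (K * (t - s) + 1)"
    have "(K * (t - s) + 1) * d powr (2 * \<gamma> - 1) = e" unfolding * using Kt by simp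
    moreover have "0 < d powr (2 * \<gamma> - 1)" using d by simp
    moreover have "K * d powr (2 * \<gamma> - 1) * (t - s) = (K * (t - s) + 1) * d powr (2 * \<gamma> - 1) - d powr (2 * \<gamma> - 1)"
      by (simp add: algebra_simps)
    ultimately show ?thesis by linarith
  qed
  show ?thesis
  proof (intro exI[of _ d] conjI allI impI d)
    fix n :: nat and p assume p: "p 0 = s \<and> p (Suc n) = t \<and> (\<forall>i\<le>n. p i < p (Suc i))
              \<and> (\<forall>i\<le>n. p (Suc i) - p i < d)"
    \<comment> \<open>Nothing is known about \<open>p\<close> beyond index \<open>Suc n\<close>;
      freezing it there gives a monotone sequence with the same sum and no larger mesh.\<close>
    define p' where "p' k = p (min k (Suc n))" for k
    have mp: "mono p'"
      unfolding mono_iff_le_Suc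
    proof
      fix k show "p' k \<le> p' (Suc k)"
        using p by (cases "k \<le> n") (auto simp: p'_def min_absorb1 min_absorb2 less_imp_le)
    qed
    have ends: "p' 0 = s" "p' (Suc n) = t" using p by (auto simp: p'_def)
    have "s \<le> p' k \<and> p' k \<le> t" for k
    proof
      show "s \<le> p' k" using monoD[OF mp, of 0 k] ends by simp
      have "p' k \<le> p' (max k (Suc n))" by (intro monoD[OF mp]) simp
      also have "\<dots> = t" using p by (simp add: p'_def)
      finally show "p' k \<le> t" .
    qed
    then have in_T: "0 \<le> p' k" "p' k \<le> T" for k using st by (auto intro: order_trans)
    have step: "p' (Suc k) - p' k \<le> d" for k
      using p d by (cases "k \<le> n") (auto simp: p'_def min_absorb1 min_absorb2 less_imp_le)
    have "RS (germ w) p' 0 (Suc n) \<xi> =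
       (\<Sum>i\<le>n. exp (- \<xi> * (t - p (Suc i))) *\<^sub>R (x1 (p (Suc i)) (p i) \<xi> v* w (p i)))" for \<xi>
      unfolding RS_def ends atLeast0LessThan lessThan_Suc_atMost
      by (intro sum.cong refl) (auto simp: germ_def p'_def min_def)
    then show "Nrm phi \<gamma> (\<lambda>\<xi>. Jint phi \<gamma> T x1 w t s \<xi> -
                 (\<Sum>i\<le>n. exp (- \<xi> * (t - p (Suc i))) *\<^sub>R (x1 (p (Suc i)) (p i) \<xi> v* w (p i)))) < e"
      using RB[OF mp in_T step, of "Suc n"] small by (simp add: ends)
  qed
qed

end

section \<open>The smooth case\<close>

text \<open>The ordinary convolution integral obeys exactly the splitting rule of
  \<open>RS_split\<close>, so the two can be compared by induction over the cells.\<close>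

lemma conv_integral_split:
  fixes g :: "real \<Rightarrow> 'v::euclidean_space"
  assumes g: "continuous_on {0..T} g" and st: "0 \<le> s" "s \<le> u" "u \<le> t" "t \<le> T"
  shows "integral {s..t} (\<lambda>v. exp (- \<xi> * (t - v)) *\<^sub>R g v) =
    integral {u..t} (\<lambda>v. exp (- \<xi> * (t - v)) *\<^sub>R g v) +
    exp (- \<xi> * (t - u)) *\<^sub>R integral {s..u} (\<lambda>v. exp (- \<xi> * (u - v)) *\<^sub>R g v)"
proof -
  have "continuous_on {s..t} (\<lambda>v. exp (- \<xi> * (t - v)) *\<^sub>R g v)"
    by (intro continuous_intros continuous_on_subset[OF g]) (use st in auto)
  then have "(\<lambda>v. exp (- \<xi> * (t - v)) *\<^sub>R g v) integrable_on {s..t}"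
    by (rule integrable_continuous_interval)
  from Henstock_Kurzweil_Integration.integral_combine[OF st(2,3) this]
  have "integral {s..t} (\<lambda>v. exp (- \<xi> * (t - v)) *\<^sub>R g v) =
    integral {u..t} (\<lambda>v. exp (- \<xi> * (t - v)) *\<^sub>R g v) +
    integral {s..u} (\<lambda>v. exp (- \<xi> * (t - v)) *\<^sub>R g v)" by (simp add: add.commute)
  also have "integral {s..u} (\<lambda>v. exp (- \<xi> * (t - v)) *\<^sub>R g v) =
    integral {s..u} (\<lambda>v. exp (- \<xi> * (t - u)) *\<^sub>R exp (- \<xi> * (u - v)) *\<^sub>R g v)"
    by (intro Henstock_Kurzweil_Integration.integral_cong, subst exp_split[of _ _ _ u]) simp
  finally show ?thesis by (simp only: integral_cmul)
qed

text \<open>The constant matrix \<open>w s\<close> moves under the integral, leaving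
  \<open>w v - w s\<close> as integrand; the exponential is at most 1.\<close>

lemma conv_integral_germ_bound:
  fixes D :: "real \<Rightarrow> real ^ 'd" and w :: "real \<Rightarrow> real ^ 'm ^ 'd"
  assumes D: "continuous_on {0..T} D" and w: "continuous_on {0..T} w"
    and st: "0 \<le> s" "s \<le> t" "t \<le> T" and \<xi>: "0 \<le> \<xi>"
    and M: "\<And>v. 0 \<le> v \<Longrightarrow> v \<le> T \<Longrightarrow> norm (D v) \<le> M" "0 \<le> M"
    and R: "\<And>v. s \<le> v \<Longrightarrow> v \<le> t \<Longrightarrow> norm (w v - w s) \<le> R" "0 \<le> R"
  shows "norm (integral {s..t} (\<lambda>v. exp (- \<xi> * (t - v)) *\<^sub>R (D v v* w v)) -
    integral {s..t} (\<lambda>v. exp (- \<xi> * (t - v)) *\<^sub>R D v) v* w s) \<le> M * R * (t - s)"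
proof -
  have sub: "{s..t} \<subseteq> {0..T}" using st by auto
  have cD: "continuous_on {s..t} (\<lambda>v. exp (- \<xi> * (t - v)) *\<^sub>R D v)"
    by (intro continuous_intros continuous_on_subset[OF D sub])
  have cw: "continuous_on {s..t} (\<lambda>v. exp (- \<xi> * (t - v)) *\<^sub>R (D v v* w v))"
    by (intro continuous_intros bounded_bilinear.continuous_on[OF bounded_bilinear_vector_matrix_mult]
        continuous_on_subset[OF D sub] continuous_on_subset[OF w sub])
  have cc: "continuous_on {s..t} (\<lambda>v. exp (- \<xi> * (t - v)) *\<^sub>R (D v v* (w v - w s)))"
    by (intro continuous_intros bounded_bilinear.continuous_on[OF bounded_bilinear_vector_matrix_mult]
        continuous_on_subset[OF D sub] continuous_on_subset[OF w sub])
  have bl: "bounded_linear (\<lambda>x :: real ^ 'd. x v* w s)"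
    by (rule bounded_bilinear.bounded_linear_left[OF bounded_bilinear_vector_matrix_mult])
  have iD: "(\<lambda>v. exp (- \<xi> * (t - v)) *\<^sub>R D v) integrable_on {s..t}"
    by (rule integrable_continuous_interval[OF cD])
  have "integral {s..t} (\<lambda>v. exp (- \<xi> * (t - v)) *\<^sub>R D v) v* w s =
     integral {s..t} (\<lambda>v. (exp (- \<xi> * (t - v)) *\<^sub>R D v) v* w s)"
    using integral_linear[OF iD bl] by (simp add: o_def)
  then have "integral {s..t} (\<lambda>v. exp (- \<xi> * (t - v)) *\<^sub>R (D v v* w v)) -
      integral {s..t} (\<lambda>v. exp (- \<xi> * (t - v)) *\<^sub>R D v) v* w s =
      integral {s..t} (\<lambda>v. exp (- \<xi> * (t - v)) *\<^sub>R (D v v* w v) - (exp (- \<xi> * (t - v)) *\<^sub>R D v) v* w s)"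
    using integrable_linear[OF iD bl] integrable_continuous_interval[OF cw]
    by (simp add: o_def Henstock_Kurzweil_Integration.integral_diff)
  also have "\<dots> = integral {s..t} (\<lambda>v. exp (- \<xi> * (t - v)) *\<^sub>R (D v v* (w v - w s)))"
    by (simp only: scaleR_vector_matrix_assoc vector_matrix_mult_diff_rdistrib scaleR_diff_right)
  also have "norm \<dots> \<le> M * R * (t - s)"
  proof (rule integral_bound[OF st(2) cc])
    fix v assume v: "v \<in> {s..t}"
    have "norm (exp (- \<xi> * (t - v)) *\<^sub>R (D v v* (w v - w s))) \<le> 1 * norm (D v v* (w v - w s))"
      unfolding norm_scaleR using v \<xi> by (intro mult_right_mono) auto
    also have "\<dots> \<le> 1 * (norm (D v) * norm (w v - w s))"
      by (intro mult_left_mono norm_vector_matrix_mult_le) simp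
    also have "\<dots> \<le> 1 * (M * R)"
      using v st M R by (intro mult_left_mono mult_mono) auto
    finally show "norm (exp (- \<xi> * (t - v)) *\<^sub>R (D v v* (w v - w s))) \<le> M * R" by simp
  qed
  finally show ?thesis .
qed

context convolutional_path
begin

text \<open>For a fixed \<xi>, old errors are damped when transported and each new cell adds an
  error proportional to its length, so the total telescopes.\<close>

lemma Riemann_sums_pointwise:
  fixes w :: "real \<Rightarrow> real ^ 'm ^ 'd"
  assumes D: "continuous_on {0..T} D" and w: "continuous_on {0..T} w" and \<xi>: "0 \<le> \<xi>"
    and x1: "\<And>s t. 0 \<le> s \<Longrightarrow> s \<le> t \<Longrightarrow> t \<le> T \<Longrightarrow>
      x1 t s \<xi> = integral {s..t} (\<lambda>v. exp (- \<xi> * (t - v)) *\<^sub>R D v)"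
    and M: "\<And>v. 0 \<le> v \<Longrightarrow> v \<le> T \<Longrightarrow> norm (D v) \<le> M" "0 \<le> M"
    and H: "\<And>s u. 0 \<le> s \<Longrightarrow> s \<le> u \<Longrightarrow> u \<le> T \<Longrightarrow> norm (w u - w s) \<le> H * (u - s) powr \<gamma>" "0 \<le> H"
    and p: "mono p" "\<And>k. 0 \<le> p k" "\<And>k. p k \<le> T" "\<And>k. p (Suc k) - p k \<le> d"
  shows "norm (integral {p 0..p n} (\<lambda>v. exp (- \<xi> * (p n - v)) *\<^sub>R (D v v* w v)) - RS (germ w) p 0 n \<xi>)
     \<le> M * (H * d powr \<gamma>) * (p n - p 0)"
proof -
  have mp: "p k \<le> p (Suc k)" for k using p(1) by (simp add: monoD)
  have cg: "continuous_on {0..T} (\<lambda>v. D v v* w v)"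
    by (intro bounded_bilinear.continuous_on[OF bounded_bilinear_vector_matrix_mult] D w)
  define Y where "Y t s = integral {s..t} (\<lambda>v. exp (- \<xi> * (t - v)) *\<^sub>R (D v v* w v))" for t s
  have "norm (Y (p n) (p 0) - RS (germ w) p 0 n \<xi>) \<le> M * (H * d powr \<gamma>) * (p n - p 0)"
  proof (induction n)
    case 0
    show ?case by (simp add: Y_def)
  next
    case (Suc n)
    have p0n: "p 0 \<le> p n" by (intro monoD[OF p(1)]) simp
    have Y: "Y (p (Suc n)) (p 0) = Y (p (Suc n)) (p n) + exp (- \<xi> * (p (Suc n) - p n)) *\<^sub>R Y (p n) (p 0)"
      unfolding Y_def by (rule conv_integral_split[OF cg p(2) p0n mp p(3)])
    have R: "RS (germ w) p 0 (Suc n) \<xi> = germ w (p (Suc n)) (p n) \<xi> +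
        exp (- \<xi> * (p (Suc n) - p n)) *\<^sub>R RS (germ w) p 0 n \<xi>"
      using RS_split[of 0 n "Suc n" "germ w" p \<xi>] by simp
    have "norm (Y (p (Suc n)) (p n) - germ w (p (Suc n)) (p n) \<xi>) \<le> M * (H * d powr \<gamma>) * (p (Suc n) - p n)"
      unfolding Y_def germ_def x1[OF p(2) mp p(3)]
    proof (rule conv_integral_germ_bound[OF D w p(2) mp p(3) \<xi> M])
      fix v assume v: "p n \<le> v" "v \<le> p (Suc n)"
      have "norm (w v - w (p n)) \<le> H * (v - p n) powr \<gamma>"
        using v p(2)[of n] p(3)[of "Suc n"] by (intro H(1)) auto
      also have "\<dots> \<le> H * d powr \<gamma>"
        using v p(4)[of n] gam H(2) by (intro mult_left_mono powr_mono2) auto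
      finally show "norm (w v - w (p n)) \<le> H * d powr \<gamma>" .
    qed (use H(2) in auto)
    moreover have "norm (exp (- \<xi> * (p (Suc n) - p n)) *\<^sub>R (Y (p n) (p 0) - RS (germ w) p 0 n \<xi>)) \<le>
       1 * norm (Y (p n) (p 0) - RS (germ w) p 0 n \<xi>)"
      unfolding norm_scaleR using \<xi> mp[of n] by (intro mult_right_mono) auto
    moreover have eq: "Y (p (Suc n)) (p 0) - RS (germ w) p 0 (Suc n) \<xi> =
       (Y (p (Suc n)) (p n) - germ w (p (Suc n)) (p n) \<xi>) +
       exp (- \<xi> * (p (Suc n) - p n)) *\<^sub>R (Y (p n) (p 0) - RS (germ w) p 0 n \<xi>)"
      unfolding Y R by (simp add: scaleR_diff_right)
    ultimately have "norm (Y (p (Suc n)) (p 0) - RS (germ w) p 0 (Suc n) \<xi>) \<le>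
       M * (H * d powr \<gamma>) * (p (Suc n) - p n) + M * (H * d powr \<gamma>) * (p n - p 0)"
      unfolding eq using Suc.IH norm_triangle_ineq[of "Y (p (Suc n)) (p n) - germ w (p (Suc n)) (p n) \<xi>"
        "exp (- \<xi> * (p (Suc n) - p n)) *\<^sub>R (Y (p n) (p 0) - RS (germ w) p 0 n \<xi>)"]
      by linarith
    then show ?case by (simp add: algebra_simps)
  qed
  then show ?thesis by (simp add: Y_def)
qed

text \<open>The equidistant Riemann sums of the germ tend to \<open>Jint\<close> in the weighted
  norm and to the classical integral for each \<xi> > 0, so both limits agree as classes.\<close>

lemma Jint_smooth:
  fixes w :: "real \<Rightarrow> real ^ 'm ^ 'd"
  assumes w: "holder_on \<gamma> {0..T} w" and D: "continuous_on {0..T} D"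
    and x1: "\<And>s t \<xi>. 0 \<le> s \<Longrightarrow> s \<le> t \<Longrightarrow> t \<le> T \<Longrightarrow> 0 \<le> \<xi> \<Longrightarrow>
      x1 t s \<xi> = integral {s..t} (\<lambda>v. exp (- \<xi> * (t - v)) *\<^sub>R D v)"
    and st: "0 \<le> s" "s \<le> t" "t \<le> T"
  shows "Leq phi \<gamma> (Jint phi \<gamma> T x1 w t s)
    (\<lambda>\<xi>. integral {s..t} (\<lambda>v. exp (- \<xi> * (t - v)) *\<^sub>R (D v v* w v)))"
proof -
  obtain K where K: "0 \<le> K" and RB:
    "\<And>p d n. mono p \<Longrightarrow> (\<And>k. 0 \<le> p k) \<Longrightarrow> (\<And>k. p k \<le> T) \<Longrightarrow> (\<And>k. p (Suc k) - p k \<le> d) \<Longrightarrow>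
      Nrm phi \<gamma> (\<lambda>\<xi>. Jint phi \<gamma> T x1 w (p n) (p 0) \<xi> - RS (germ w) p 0 n \<xi>) \<le>
        K * d powr (2 * \<gamma> - 1) * (p n - p 0)"
    using Jint_Riemann_bound[OF w] by blast
  obtain H where H: "0 \<le> H" "\<And>s t. s \<in> {0..T} \<Longrightarrow> t \<in> {0..T} \<Longrightarrow> norm (w t - w s) \<le> H * \<bar>t - s\<bar> powr \<gamma>"
    using holder_onE[OF w] by blast
  have H': "norm (w u - w s) \<le> H * (u - s) powr \<gamma>" if "0 \<le> s" "s \<le> u" "u \<le> T" for s u
    using H(2)[of s u] that by auto
  obtain M where M: "0 \<le> M" "\<And>v. 0 \<le> v \<Longrightarrow> v \<le> T \<Longrightarrow> norm (D v) \<le> M"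
    using continuous_bound[OF D] by blast
  define d where "d m = (t - s) * inverse (real (Suc m))" for m
  \<comment> \<open>Equidistant points, constant from index \<open>Suc m\<close> on; for
    \<open>s = t\<close> all points coincide and the mesh is zero.\<close>
  define p where "p m k = s + real (min k (Suc m)) * d m" for m k
  have d0: "0 \<le> d m" for m using st by (simp add: d_def)
  have dlim: "d \<longlonglongrightarrow> 0"
    unfolding d_def by (rule tendsto_mult_right_zero[OF LIMSEQ_inverse_real_of_nat])
  have dpow: "(\<lambda>m. d m powr c) \<longlonglongrightarrow> 0" if "0 < c" for c
    using tendsto_powr'[OF dlim tendsto_const, of c] that d0 by simp
  have ends: "p m 0 = s" "p m (Suc m) = t" for m
    by (simp_all add: p_def d_def mult.left_commute del: of_nat_Suc)
  have mp: "mono (p m)" for m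
  proof (rule monoI)
    fix k l :: nat assume "k \<le> l"
    then have "real (min k (Suc m)) \<le> real (min l (Suc m))" by simp
    then show "p m k \<le> p m l" unfolding p_def by (intro add_left_mono mult_right_mono d0)
  qed
  have pT: "0 \<le> p m k" "p m k \<le> T" for m k
  proof -
    show "0 \<le> p m k" using st d0[of m] by (simp add: p_def)
    have "p m k \<le> p m (max k (Suc m))" by (intro monoD[OF mp]) simp
    also have "\<dots> = p m (Suc m)" by (simp add: p_def)
    finally show "p m k \<le> T" using ends[of m] st by simp
  qed
  have step: "p m (Suc k) - p m k \<le> d m" for m k
  proof -
    have "real (min (Suc k) (Suc m)) \<le> real (min k (Suc m)) + 1" by linarith
    then have "real (min (Suc k) (Suc m)) * d m \<le> (real (min k (Suc m)) + 1) * d m"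
      by (rule mult_right_mono[OF _ d0])
    then show ?thesis by (simp add: p_def distrib_right)
  qed
  show ?thesis
  proof (rule Leq_of_limits[where r="\<lambda>m. RS (germ w) (p m) 0 (Suc m)"])
    show "Jint phi \<gamma> T x1 w t s \<in> Lb phi \<gamma>" by (rule Jint_Lb[OF w st])
    show "RS (germ w) (p m) 0 (Suc m) \<in> Lb phi \<gamma>" for m by (rule Lb_RS[OF germ_Lb mp pT])
    show "(\<lambda>m. Nrm phi \<gamma> (\<lambda>\<xi>. Jint phi \<gamma> T x1 w t s \<xi> - RS (germ w) (p m) 0 (Suc m) \<xi>)) \<longlonglongrightarrow> 0"
    proof (rule Nrm_tendsto_0)
      show "Nrm phi \<gamma> (\<lambda>\<xi>. Jint phi \<gamma> T x1 w t s \<xi> - RS (germ w) (p m) 0 (Suc m) \<xi>) \<le>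
         K * d m powr (2 * \<gamma> - 1) * (t - s)" for m
        using RB[of "p m" "d m" "Suc m", OF mp pT step] by (simp only: ends)
      show "(\<lambda>m. K * d m powr (2 * \<gamma> - 1) * (t - s)) \<longlonglongrightarrow> 0"
        using gam by (intro tendsto_mult_left_zero tendsto_mult_right_zero dpow) auto
    qed
    fix \<xi> :: real assume \<xi>: "0 < \<xi>"
    let ?Y = "integral {s..t} (\<lambda>v. exp (- \<xi> * (t - v)) *\<^sub>R (D v v* w v))"
    have le: "norm (RS (germ w) (p m) 0 (Suc m) \<xi> - ?Y) \<le> M * (H * d m powr \<gamma>) * (t - s)" for m
      using Riemann_sums_pointwise[OF D holder_continuous[OF w] less_imp_le[OF \<xi>]
          x1[OF _ _ _ less_imp_le[OF \<xi>]] M(2,1) H' H(1) mp pT step, of m "Suc m"]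
      by (simp only: ends norm_minus_commute)
    have lim: "(\<lambda>m. M * (H * d m powr \<gamma>) * (t - s)) \<longlonglongrightarrow> 0"
      using gam by (intro tendsto_mult_left_zero tendsto_mult_right_zero dpow) auto
    have "(\<lambda>m. RS (germ w) (p m) 0 (Suc m) \<xi> - ?Y) \<longlonglongrightarrow> 0"
      by (rule Lim_null_comparison[OF always_eventually lim]) (use le in auto)
    then show "(\<lambda>m. RS (germ w) (p m) 0 (Suc m) \<xi>) \<longlonglongrightarrow> ?Y" by (simp only: LIM_zero_iff)
  qed
qed

end

theorem theorem3p8:
  fixes phi :: "real \<Rightarrow> real" and \<gamma> T :: real
    and x :: "real \<Rightarrow> real ^ 'd" and x1 :: "real \<Rightarrow> real \<Rightarrow> real \<Rightarrow> real ^ 'd"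
    and z :: "real \<Rightarrow> real ^ 'm ^ 'd"
  assumes phi_meas: "set_borel_measurable lborel {0<..} phi"
    and T: "0 < T"
    and gam: "1/2 < \<gamma>" "\<gamma> < 1"
    and x_hol: "holder_on \<gamma> {0..T} x"
    and x1_C: "C2hol phi \<gamma> \<gamma> 0 T x1"
    and x1_chen: "\<And>s u t. 0 \<le> s \<Longrightarrow> s \<le> u \<Longrightarrow> u \<le> t \<Longrightarrow> t \<le> T \<Longrightarrow>
                    Leq phi \<gamma> (dtil3 x1 t u s) (\<lambda>\<xi>. 0)"
    and z_hol: "holder_on \<gamma> {0..T} z"
  shows
    \<comment> \<open>(1) well-definedness\<close>
    "(C3hol phi \<gamma> (2 * \<gamma>) 0 T (hJ x1 z)
      \<and> (\<exists>B. C2 phi \<gamma> 0 T B \<and> (\<forall>s u t. 0 \<le> s \<and> s \<le> u \<and> u \<le> t \<and> t \<le> T \<longrightarrow>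
              Leq phi \<gamma> (dtil3 B t u s) (hJ x1 z t u s)))
      \<and> (\<exists>A. C2hol phi \<gamma> (2 * \<gamma>) 0 T A \<and> (\<forall>s u t. 0 \<le> s \<and> s \<le> u \<and> u \<le> t \<and> t \<le> T \<longrightarrow>
              Leq phi \<gamma> (dtil3 A t u s) (hJ x1 z t u s)))
      \<and> (\<forall>A A'. C2hol phi \<gamma> (2 * \<gamma>) 0 T A \<and> (\<forall>s u t. 0 \<le> s \<and> s \<le> u \<and> u \<le> t \<and> t \<le> T \<longrightarrow>
              Leq phi \<gamma> (dtil3 A t u s) (hJ x1 z t u s))
            \<and> C2hol phi \<gamma> (2 * \<gamma>) 0 T A' \<and> (\<forall>s u t. 0 \<le> s \<and> s \<le> u \<and> u \<le> t \<and> t \<le> T \<longrightarrow>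
              Leq phi \<gamma> (dtil3 A' t u s) (hJ x1 z t u s))
            \<longrightarrow> (\<forall>s t. 0 \<le> s \<and> s \<le> t \<and> t \<le> T \<longrightarrow> Leq phi \<gamma> (A t s) (A' t s)))
      \<and> C2hol phi \<gamma> \<gamma> 0 T (Jint phi \<gamma> T x1 z))
     \<and> ((x C1_differentiable_on {0..T} \<and> z C1_differentiable_on {0..T} \<and>
         (\<forall>s t \<xi>. 0 \<le> s \<and> s \<le> t \<and> t \<le> T \<and> 0 \<le> \<xi> \<longrightarrow>
            x1 t s \<xi> = integral {s..t} (\<lambda>v. exp (- \<xi> * (t - v)) *\<^sub>R vector_derivative x (at v within {0..T}))))
        \<longrightarrow> (\<forall>s t. 0 \<le> s \<and> s \<le> t \<and> t \<le> T \<longrightarrow>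
              Leq phi \<gamma> (Jint phi \<gamma> T x1 z t s)
                (\<lambda>\<xi>. integral {s..t} (\<lambda>v. exp (- \<xi> * (t - v)) *\<^sub>R
                        (vector_derivative x (at v within {0..T}) v* z v)))))
     \<comment> \<open>(2) bound, with a constant independent of the integrand\<close>
     \<and> (\<exists>c>0. \<forall>w :: real \<Rightarrow> real ^ 'm ^ 'd. holder_on \<gamma> {0..T} w \<longrightarrow>
          (\<forall>l1 l2. 0 \<le> l1 \<and> l1 < l2 \<and> l2 \<le> T \<longrightarrow>
             N2 phi \<gamma> \<gamma> l1 l2 (Jint phi \<gamma> T x1 w)
               \<le> c * (N1sup w l1 l2 + (l2 - l1) powr \<gamma> * N1hol \<gamma> w l1 l2)))
     \<comment> \<open>(3) Riemann sums\<close>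
     \<and> (\<forall>s t. 0 \<le> s \<and> s < t \<and> t \<le> T \<longrightarrow>
          (\<forall>e>0. \<exists>d>0. \<forall>(n::nat) p. p 0 = s \<and> p (Suc n) = t \<and> (\<forall>i\<le>n. p i < p (Suc i))
              \<and> (\<forall>i\<le>n. p (Suc i) - p i < d) \<longrightarrow>
              Nrm phi \<gamma> (\<lambda>\<xi>. Jint phi \<gamma> T x1 z t s \<xi> -
                 (\<Sum>i\<le>n. exp (- \<xi> * (t - p (Suc i))) *\<^sub>R (x1 (p (Suc i)) (p i) \<xi> v* z (p i)))) < e))"
proof -
  interpret convolutional_path phi \<gamma> T x1
    by unfold_locales (use phi_meas gam x1_C x1_chen in auto)
  have germ: "\<exists>B. C2 phi \<gamma> 0 T B \<and> (\<forall>s u t. 0 \<le> s \<and> s \<le> u \<and> u \<le> t \<and> t \<le> T \<longrightarrow>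
      Leq phi \<gamma> (dtil3 B t u s) (hJ x1 z t u s))"
    using C2_uminus[OF germ_C2[OF holder_continuous[OF z_hol]]] Leq_dtil3_germ[where w=z] by blast
  have unique: "Leq phi \<gamma> (A t s) (A' t s)"
    if "C2hol phi \<gamma> (2 * \<gamma>) 0 T A \<and> (\<forall>s u t. 0 \<le> s \<and> s \<le> u \<and> u \<le> t \<and> t \<le> T \<longrightarrow>
              Leq phi \<gamma> (dtil3 A t u s) (hJ x1 z t u s))
            \<and> C2hol phi \<gamma> (2 * \<gamma>) 0 T A' \<and> (\<forall>s u t. 0 \<le> s \<and> s \<le> u \<and> u \<le> t \<and> t \<le> T \<longrightarrow>
              Leq phi \<gamma> (dtil3 A' t u s) (hJ x1 z t u s))" "0 \<le> s \<and> s \<le> t \<and> t \<le> T" for A A' s t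
    using that gam by (intro sewing_unique[of "2 * \<gamma>" 0 T A A' "hJ x1 z"]) auto
  have smooth: "Leq phi \<gamma> (Jint phi \<gamma> T x1 z t s)
                (\<lambda>\<xi>. integral {s..t} (\<lambda>v. exp (- \<xi> * (t - v)) *\<^sub>R
                        (vector_derivative x (at v within {0..T}) v* z v)))"
    if sm: "x C1_differentiable_on {0..T} \<and> z C1_differentiable_on {0..T} \<and>
         (\<forall>s t \<xi>. 0 \<le> s \<and> s \<le> t \<and> t \<le> T \<and> 0 \<le> \<xi> \<longrightarrow>
            x1 t s \<xi> = integral {s..t} (\<lambda>v. exp (- \<xi> * (t - v)) *\<^sub>R vector_derivative x (at v within {0..T})))"
      and st: "0 \<le> s \<and> s \<le> t \<and> t \<le> T" for s t
  proof (rule Jint_smooth[OF z_hol])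
    from sm obtain D where D: "\<And>v. v \<in> {0..T} \<Longrightarrow> (x has_vector_derivative D v) (at v)"
      and cD: "continuous_on {0..T} D"
      unfolding C1_differentiable_on_def by blast
    \<comment> \<open>On a nondegenerate interval the one-sided derivative at the endpoints is
      unique, so the continuous two-sided \<open>D\<close> computes it.\<close>
    have "vector_derivative x (at v within {0..T}) = D v" if "v \<in> {0..T}" for v
      by (rule vector_derivative_within_closed_interval[OF T that has_vector_derivative_at_within[OF D[OF that]]])
    then show "continuous_on {0..T} (\<lambda>v. vector_derivative x (at v within {0..T}))"
      using continuous_on_cong[OF refl, of "{0..T}" _ D] cD by simp
  qed (use sm st in auto)
  \<comment> \<open>Covers the factor \<open>Nx\<close> of the germ and that of the sewing term; the
    \<open>+ 1\<close> makes it positive even if \<open>Nx\<close> is zero.\<close>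
  define c where "c = Nx + Nx / (1 - 2 powr (1 - 2 * \<gamma>)) + 1"
  have c: "0 < c"
    unfolding c_def using gam Nx_nonneg by (intro add_nonneg_pos add_nonneg_nonneg) (auto simp: powr_less_one less_imp_le)
  have bound: "\<exists>c>0. \<forall>w :: real \<Rightarrow> real ^ 'm ^ 'd. holder_on \<gamma> {0..T} w \<longrightarrow>
          (\<forall>l1 l2. 0 \<le> l1 \<and> l1 < l2 \<and> l2 \<le> T \<longrightarrow>
             N2 phi \<gamma> \<gamma> l1 l2 (Jint phi \<gamma> T x1 w)
               \<le> c * (N1sup w l1 l2 + (l2 - l1) powr \<gamma> * N1hol \<gamma> w l1 l2))"
    by (intro exI[of _ c] conjI allI impI c, unfold c_def, rule Jint_N2_bound) auto
  show ?thesis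
    by (intro conjI allI impI hJ_C3hol germ sew_exists Jint_C2hol z_hol smooth bound Jint_Riemann_sums;
        (assumption | (rule unique; assumption) | simp))
qed

end
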